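(* There exists $\tau_0>0$ such that the following holds for every $\gamma\in[0,1]$ and every $\tau\ge\tau_0$. Let $I\subset\mathbb{R}$ be an open interval and $\Omega\subset\mathbb{R}^n$ an open set. Let $w: I\times\Omega\to(0,\infty)$ be a Borel function uniformly bounded from above and from below on compact subsets of $I\times\Omega$ (i.e. for every compact $K\subset I\times\Omega$ there are constants $0<c_K\le C_K<\infty$ with $c_K\le w\le C_K$ on $K$). Let $\varphi=\widetilde{\exp}_{\gamma,\tau}$ and let $b\in L^1_{\rm loc}(I;W^{1,1}_{\rm loc}(\Omega;\mathbb{R}^m))\cap C^0(I\times\Omega;\mathbb{R}^m)$ satisfy $$N_{\varphi,w}(|Db|):=\int_I\int_\Omega w(t,x)\,\varphi(|Db(t,x)|)\,\mathrm{d}x\,\mathrm{d}t<\infty.$$ Assume moreover that either $w|Db|\in L^1(I\times\Omega)$, or $w\in L^1(I\times\Omega)$. Then there exists a sequence $(b_h)_h\subset C^\infty(I\times\Omega;\mathbb{R}^m)$ such that, as $h\to\infty$, $$b_h\to b \text{ in } L^1_{\rm loc}(I\times\Omega;\mathbb{R}^m),\qquad Db_h\to Db\text{ in }L^1_{\rm loc}(I\times\Omega;\mathbb{R}^{nm}),$$ $$w\,\varphi(|Db_h|)\to w\,\varphi(|Db|)\ \text{ in } L^1(I\times\Omega),\qquad \lim_{h\to\infty}N_{\varphi,w}(|Db_h|)=N_{\varphi,w}(|Db|).$$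
   Context: For $0\le\gamma\le1$, $\tau>1$ and $t\ge0$ set $$\exp_{\gamma,\tau}(t):=\exp\left(\frac{t}{(\log(t+\tau))^\gamma}\right),\qquad \widetilde{\exp}_{\gamma,\tau}(t):=\exp_{\gamma,\tau}(t)-1-\frac{t}{(\log\tau)^\gamma}.$$ For a function $b=b(t,x)$ of time $t\in I$ and space $x\in\Omega$, $Db$ denotes the (weak) derivative with respect to the spatial variable $x$ only, an $m\times n$ matrix identified with an element of $\mathbb{R}^{nm}$, and $|\cdot|$ is the Euclidean norm. *)

theory Defs
  imports "HOL-Analysis.Analysis"
begin

definition exp_gt :: "real \<Rightarrow> real \<Rightarrow> real \<Rightarrow> real" where
  "exp_gt \<gamma> \<tau> t = exp (t / (ln (t + \<tau>) powr \<gamma>))"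

definition exp_gt_tilde :: "real \<Rightarrow> real \<Rightarrow> real \<Rightarrow> real" where
  "exp_gt_tilde \<gamma> \<tau> t = exp_gt \<gamma> \<tau> t - 1 - t / (ln \<tau> powr \<gamma>)"

(* Differentiability of every order, with derivatives taken as iterated directional
   derivatives so that all orders live in one type. Meant for open S. *)
primrec times_differentiable_on ::
    "nat \<Rightarrow> ('a::real_normed_vector \<Rightarrow> 'b::real_normed_vector) \<Rightarrow> 'a set \<Rightarrow> bool" where
  "times_differentiable_on 0 f S \<longleftrightarrow> continuous_on S f"
| "times_differentiable_on (Suc k) f S \<longleftrightarrow>
     (\<forall>x\<in>S. f differentiable (at x)) \<and>
     (\<forall>v. times_differentiable_on k (\<lambda>x. frechet_derivative f (at x) v) S)"

definition smooth_on ::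
    "('a::real_normed_vector \<Rightarrow> 'b::real_normed_vector) \<Rightarrow> 'a set \<Rightarrow> bool" where
  "smooth_on f S \<longleftrightarrow> (\<forall>k. times_differentiable_on k f S)"

definition test_function_on :: "'a::real_normed_vector set \<Rightarrow> ('a \<Rightarrow> real) \<Rightarrow> bool" where
  "test_function_on S \<psi> \<longleftrightarrow>
     smooth_on \<psi> UNIV \<and> compact (closure {x. \<psi> x \<noteq> 0}) \<and> closure {x. \<psi> x \<noteq> 0} \<subseteq> S"

definition locally_L1_on ::
    "'a::euclidean_space set \<Rightarrow> ('a \<Rightarrow> 'b::euclidean_space) \<Rightarrow> bool" where
  "locally_L1_on S f \<longleftrightarrow> (\<forall>K. compact K \<longrightarrow> K \<subseteq> S \<longrightarrow> set_integrable lebesgue K f)"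

(* f belongs to W^{1,1}_loc(S) and G is (a representative of) its weak derivative;
   G x $ i $ j is the j-th partial derivative of the i-th component. *)
definition W11_loc_with_deriv ::
    "(real^'n) set \<Rightarrow> (real^'n \<Rightarrow> real^'m) \<Rightarrow> (real^'n \<Rightarrow> real^'n^'m) \<Rightarrow> bool" where
  "W11_loc_with_deriv S f G \<longleftrightarrow>
     locally_L1_on S f \<and> locally_L1_on S G \<and>
     (\<forall>\<psi> i j. test_function_on S \<psi> \<longrightarrow>
        (LINT x:S|lebesgue. f x $ i * frechet_derivative \<psi> (at x) (axis j 1)) =
        - (LINT x:S|lebesgue. G x $ i $ j * \<psi> x))"

(* b belongs to L^1_loc(I; W^{1,1}_loc(S)) and Db is its weak derivative in space only.
   Functions of time with values in a space of functions of x are identified, as usual, with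
   jointly measurable functions of (t,x); the last clause says that the W^{1,1}(K) norm of
   b(t,.) is integrable over J for all compact J and K. *)
definition L1_loc_W11_loc_with_deriv ::
    "real set \<Rightarrow> (real^'n) set \<Rightarrow> (real \<times> (real^'n) \<Rightarrow> real^'m) \<Rightarrow>
     (real \<times> (real^'n) \<Rightarrow> real^'n^'m) \<Rightarrow> bool" where
  "L1_loc_W11_loc_with_deriv I S b Db \<longleftrightarrow>
     set_borel_measurable lebesgue (I \<times> S) b \<and> set_borel_measurable lebesgue (I \<times> S) Db \<and>
     (AE t in lebesgue. t \<in> I \<longrightarrow> W11_loc_with_deriv S (\<lambda>x. b (t, x)) (\<lambda>x. Db (t, x))) \<and>
     (\<forall>J K. compact J \<longrightarrow> J \<subseteq> I \<longrightarrow> compact K \<longrightarrow> K \<subseteq> S \<longrightarrow>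
        (\<integral>\<^sup>+t\<in>J. (\<integral>\<^sup>+x\<in>K. ennreal (norm (b (t, x)) + norm (Db (t, x))) \<partial>lebesgue) \<partial>lebesgue)
          < \<infinity>)"

definition space_deriv ::
    "(real \<times> (real^'n) \<Rightarrow> real^'m) \<Rightarrow> real \<times> (real^'n) \<Rightarrow> real^'n^'m" where
  "space_deriv f = (\<lambda>(t, x). jacobian (\<lambda>y. f (t, y)) (at x))"

(* Only used for nonnegative w and \<phi>: ennreal truncates negative values to 0. *)
definition weighted_energy ::
    "real set \<Rightarrow> (real^'n) set \<Rightarrow> (real \<Rightarrow> real) \<Rightarrow> (real \<times> (real^'n) \<Rightarrow> real) \<Rightarrow>
     (real \<times> (real^'n) \<Rightarrow> real) \<Rightarrow> ennreal" where
  "weighted_energy I S \<phi> w g =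
     (\<integral>\<^sup>+t\<in>I. (\<integral>\<^sup>+x\<in>S. ennreal (w (t, x) * \<phi> (g (t, x))) \<partial>lebesgue) \<partial>lebesgue)"

definition L1_tendsto_on ::
    "'a::euclidean_space set \<Rightarrow> (nat \<Rightarrow> 'a \<Rightarrow> 'b::euclidean_space) \<Rightarrow> ('a \<Rightarrow> 'b) \<Rightarrow> bool" where
  "L1_tendsto_on S F f \<longleftrightarrow>
     (\<forall>h. set_integrable lebesgue S (F h)) \<and> set_integrable lebesgue S f \<and>
     (\<lambda>h. LINT z:S|lebesgue. norm (F h z - f z)) \<longlonglongrightarrow> 0"

definition L1_loc_tendsto_on ::
    "'a::euclidean_space set \<Rightarrow> (nat \<Rightarrow> 'a \<Rightarrow> 'b::euclidean_space) \<Rightarrow> ('a \<Rightarrow> 'b) \<Rightarrow> bool" where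
  "L1_loc_tendsto_on S F f \<longleftrightarrow> (\<forall>K. compact K \<longrightarrow> K \<subseteq> S \<longrightarrow> L1_tendsto_on K F f)"

(* The dimensions of space and target are the cardinalities of the index types 'n and 'm, which
   a formula cannot quantify over. To keep the threshold \<tau>0 independent of the dimensions, the
   theorem bounds it by an absolute constant; the value 100 is not meant to be sharp, it leaves
   ample room for exp_gt_tilde \<gamma> \<tau> to be convex on [0,\<infinity>) for all \<gamma> in [0,1] and \<tau> \<ge> \<tau>0. *)

end

theory Submission
  imports Defs
begin

text \<open>The approximations are \<open>b\<^sub>h = (\<Sum>i. \<zeta>\<^sub>i (\<rho>\<^sub>i * b))\<close> with a smooth partition of unity
  \<open>\<zeta>\<^sub>i\<close> of \<open>I \<times> \<Omega>\<close> and space-time mollifiers \<open>\<rho>\<^sub>i\<close>. Since the cutoffs stand outside the convolutions,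
  \<open>Db\<^sub>h = (\<Sum>i. \<zeta>\<^sub>i (\<rho>\<^sub>i * Db)) + R\<close>, where the first part is an exact average of \<open>Db\<close> and
  \<open>R = (\<Sum>i. (\<rho>\<^sub>i * b - b) \<otimes> D\<zeta>\<^sub>i)\<close> is as small as desired because \<open>b\<close> is continuous. Jensen's inequality and
  \<open>\<phi> (s + d) \<le> C (\<phi> s + d)\<close> for \<open>d \<le> 1\<close> dominate \<open>w \<phi> (|Db\<^sub>h|)\<close> by \<open>C w (\<Sum>i. \<zeta>\<^sub>i (\<rho>\<^sub>i * \<phi> (|Db|)) + |R|)\<close>,
  which converges in \<open>L\<^sup>1\<close> to \<open>C w \<phi> (|Db|)\<close> if the radii are chosen according to the local bounds of \<open>w\<close>.
  Almost everywhere convergence of a subsequence then gives the \<open>L\<^sup>1\<close> convergence.\<close>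

subsection \<open>Iterated differentiability\<close>

text \<open>The obstacle is the exponential growth of \<phi>: finite energy of |Db| gives no control
  of \<phi> (2 |Db|), so a remainder that is merely small in L^1 could not be absorbed; only an
  additive perturbation bounded by a constant is harmless. Hence R must be small uniformly, which is
  what continuity of b provides. The order of cutoff and convolution matters for a second reason:
  for fixed z the sum over i of \<open>\<zeta>\<^sub>i z * \<rho>\<^sub>i (z - y)\<close> is a
  probability density in y, so Jensen applies with constant 1, whereas convolving the product of
  cutoff and Db would give weights whose total mass need not be 1. In the shift inequality the error
  is d and not a constant, because w times a constant does not become small, while w times d becomes
  small in L^1 through the choice of the radii. The weight is never mollified: \<phi> (|Db|) is
  averaged first and multiplied by w afterwards, so that only local bounds of w are used. Convexity
  of \<phi> for all \<gamma> in [0,1] rests on a derivative computation in which ln \<tau> \<ge> 4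
  and \<tau> \<ge> 100 suffice.\<close>

lemma times_differentiable_on_cong:
  assumes "open S" "\<And>x. x \<in> S \<Longrightarrow> f x = g x" "times_differentiable_on k f S"
  shows "times_differentiable_on k g S"
  using assms(2,3)
proof (induction k arbitrary: f g)
  case 0
  then show ?case using continuous_on_cong by (metis times_differentiable_on.simps(1))
next
  case (Suc k)
  have fd: "g differentiable (at x)" "frechet_derivative f (at x) = frechet_derivative g (at x)"
    if "x \<in> S" for x
  proof -
    have "f differentiable (at x)" using Suc.prems(2) that by simp
    then have "(f has_derivative frechet_derivative f (at x)) (at x)"
      using frechet_derivative_works by blast
    then have *: "(g has_derivative frechet_derivative f (at x)) (at x)"
      by (rule has_derivative_transform_within_open[OF _ \<open>open S\<close> that]) (use Suc.prems in auto)
    show "g differentiable (at x)" using * differentiable_def by blast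
    show "frechet_derivative f (at x) = frechet_derivative g (at x)"
      using frechet_derivative_at[OF *] .
  qed
  have "times_differentiable_on k (\<lambda>x. frechet_derivative g (at x) v) S" for v
    by (rule Suc.IH[of "\<lambda>x. frechet_derivative f (at x) v"]) (use fd Suc.prems in auto)
  then show ?case using fd by simp
qed

lemma times_differentiable_on_SucD:
  "times_differentiable_on (Suc k) f S \<Longrightarrow> times_differentiable_on k f S"
proof (induction k arbitrary: f)
  case 0
  then show ?case
    by (auto intro!: continuous_at_imp_continuous_on differentiable_imp_continuous_within)
next
  case (Suc k)
  then show ?case by (metis times_differentiable_on.simps(2))
qed

lemma times_differentiable_on_subset:
  "times_differentiable_on k f S \<Longrightarrow> T \<subseteq> S \<Longrightarrow> times_differentiable_on k f T"
  by (induction k arbitrary: f) (auto intro: continuous_on_subset)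

text \<open>A locally finite sum of infinitely many functions is a different finite sum near each
  point, so its smoothness is checked neighbourhood by neighbourhood.\<close>

lemma times_differentiable_on_locally:
  assumes "\<And>x. x \<in> S \<Longrightarrow> \<exists>V. open V \<and> x \<in> V \<and> times_differentiable_on k f V"
  shows "times_differentiable_on k f S"
  using assms
proof (induction k arbitrary: f)
  case 0
  show ?case
    unfolding times_differentiable_on.simps
  proof (rule continuous_at_imp_continuous_on, rule ballI)
    fix x assume "x \<in> S"
    then obtain V where "open V" "x \<in> V" "continuous_on V f" using 0 by auto
    then show "isCont f x" using continuous_on_eq_continuous_at by blast
  qed
next
  case (Suc k)
  have "f differentiable (at x)" if "x \<in> S" for x
    using Suc.prems[OF that] by auto
  moreover have "times_differentiable_on k (\<lambda>x. frechet_derivative f (at x) v) S" for v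
    by (rule Suc.IH) (use Suc.prems in fastforce)
  ultimately show ?case by simp
qed

text \<open>Uniqueness of the derivative on an open set lets an explicit \<open>f'\<close> stand in
  for \<open>frechet_derivative\<close>, so that the inductions below can work with
  formulas.\<close>

lemma times_differentiable_on_SucI:
  assumes "open S" "\<And>x. x \<in> S \<Longrightarrow> (f has_derivative f' x) (at x)"
    and "\<And>v. times_differentiable_on k (\<lambda>x. f' x v) S"
  shows "times_differentiable_on (Suc k) f S"
proof -
  have eq: "frechet_derivative f (at x) = f' x" if "x \<in> S" for x
    using frechet_derivative_at[OF assms(2)[OF that]] by simp
  have "times_differentiable_on k (\<lambda>x. frechet_derivative f (at x) v) S" for v
    by (rule times_differentiable_on_cong[OF assms(1) _ assms(3)[of v]]) (simp add: eq)
  then show ?thesis using assms(2) by (auto simp: differentiable_def)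
qed

lemma times_differentiable_on_SucE:
  assumes "times_differentiable_on (Suc k) f S" "x \<in> S"
  shows "(f has_derivative frechet_derivative f (at x)) (at x)"
  using assms frechet_derivative_works by auto

lemma times_differentiable_on_const: "open S \<Longrightarrow> times_differentiable_on k (\<lambda>x. c) S"
proof (induction k arbitrary: c)
  case (Suc k)
  show ?case
    by (rule times_differentiable_on_SucI[where f'="\<lambda>x v. 0"]) (use Suc in auto)
qed auto

lemma times_differentiable_on_bounded_linear:
  assumes "open S" "bounded_linear f"
  shows "times_differentiable_on k f S"
proof (cases k)
  case 0
  then show ?thesis using assms linear_continuous_on by auto
next
  case (Suc j)
  show ?thesis unfolding Suc
    by (rule times_differentiable_on_SucI[where f'="\<lambda>x. f"])
      (use assms in \<open>auto intro: times_differentiable_on_const bounded_linear_imp_has_derivative\<close>)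
qed

lemma times_differentiable_on_add:
  assumes "open S"
  shows "times_differentiable_on k f S \<Longrightarrow> times_differentiable_on k g S \<Longrightarrow>
    times_differentiable_on k (\<lambda>x. f x + g x) S"
proof (induction k arbitrary: f g)
  case 0
  then show ?case by (auto intro: continuous_intros)
next
  case (Suc k)
  show ?case
    by (rule times_differentiable_on_SucI[OF assms has_derivative_add
          [OF times_differentiable_on_SucE[OF Suc.prems(1)] times_differentiable_on_SucE[OF Suc.prems(2)]]])
      (use Suc in auto)
qed

lemma times_differentiable_on_scaleR:
  assumes "open S"
  shows "times_differentiable_on k f S \<Longrightarrow> times_differentiable_on k g S \<Longrightarrow>
    times_differentiable_on k (\<lambda>x. f x *\<^sub>R g x) S"
proof (induction k arbitrary: f g)
  case 0
  then show ?case by (auto intro: continuous_intros)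
next
  case (Suc k)
  \<comment> \<open>The product rule leaves one factor undifferentiated, and the induction
    hypothesis needs that factor at order \<open>k\<close> only.\<close>
  note low = Suc.prems[THEN times_differentiable_on_SucD]
  show ?case
    by (rule times_differentiable_on_SucI[OF assms has_derivative_scaleR
          [OF times_differentiable_on_SucE[OF Suc.prems(1)] times_differentiable_on_SucE[OF Suc.prems(2)]]])
      (use Suc low in \<open>auto intro!: times_differentiable_on_add[OF assms] Suc.IH\<close>)
qed

lemma times_differentiable_on_sum:
  assumes "open S" "\<And>i. i \<in> A \<Longrightarrow> times_differentiable_on k (f i) S"
  shows "times_differentiable_on k (\<lambda>x. \<Sum>i\<in>A. f i x) S"
  using assms(2)
  by (induction A rule: infinite_finite_induct)
    (auto intro: times_differentiable_on_const times_differentiable_on_add assms(1))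

text \<open>Two substitutions rely on it: the reflected kernel
  \<open>y \<mapsto> \<rho> (z - y)\<close>, with \<open>L = uminus\<close>, and the time slice,
  with \<open>L x = (0, x)\<close>.\<close>

lemma times_differentiable_on_affine:
  assumes L: "bounded_linear L"
  shows "times_differentiable_on k f UNIV \<Longrightarrow> times_differentiable_on k (\<lambda>x. f (c + L x)) UNIV"
proof (induction k arbitrary: f)
  case 0
  have "continuous_on UNIV (\<lambda>x. c + L x)"
    by (rule continuous_on_add[OF continuous_on_const linear_continuous_on[OF L]])
  with 0 show ?case by (auto intro: continuous_on_compose2)
next
  case (Suc k)
  have "((\<lambda>x. f (c + L x)) has_derivative (\<lambda>v. frechet_derivative f (at (c + L x)) (L v))) (at x)" for x
    by (rule has_derivative_compose[OF _ times_differentiable_on_SucE[OF Suc.prems]])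
      (auto intro!: derivative_eq_intros bounded_linear_imp_has_derivative L)
  then show ?case
    by (rule times_differentiable_on_SucI[OF open_UNIV]) (use Suc in auto)
qed

text \<open>With a real inner function the chain rule produces a scalar, the derivative of
  \<open>p\<close> along \<open>v\<close>, times the vector
  \<open>frechet_derivative \<theta> (at (p x)) 1\<close>; the induction therefore closes under
  products alone.\<close>

lemma times_differentiable_on_compose_real:
  fixes p :: "'a::real_normed_vector \<Rightarrow> real" and \<theta> :: "real \<Rightarrow> 'b::real_normed_vector"
  shows "times_differentiable_on k \<theta> UNIV \<Longrightarrow> times_differentiable_on k p UNIV \<Longrightarrow>
    times_differentiable_on k (\<lambda>x. \<theta> (p x)) UNIV"
proof (induction k arbitrary: \<theta>)
  case 0
  then show ?case using continuous_on_compose2[of UNIV \<theta> UNIV p] by simp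
next
  case (Suc k)
  have "((\<lambda>x. \<theta> (p x)) has_derivative
      (\<lambda>v. frechet_derivative p (at x) v *\<^sub>R frechet_derivative \<theta> (at (p x)) 1)) (at x)" for x
  proof -
    have lin: "linear (frechet_derivative \<theta> (at (p x)))"
      using times_differentiable_on_SucE[OF Suc.prems(1)] has_derivative_linear by blast
    have "((\<lambda>x. \<theta> (p x)) has_derivative
      (\<lambda>v. frechet_derivative \<theta> (at (p x)) (frechet_derivative p (at x) v))) (at x)"
      by (rule has_derivative_compose[OF times_differentiable_on_SucE[OF Suc.prems(2)]
          times_differentiable_on_SucE[OF Suc.prems(1)]]) auto
    moreover have "frechet_derivative \<theta> (at (p x)) c = c *\<^sub>R frechet_derivative \<theta> (at (p x)) 1" for c
      using linear_scale[OF lin, of c 1] by (metis mult.right_neutral real_scaleR_def)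
    ultimately show ?thesis by (metis (no_types, lifting) ext)
  qed
  moreover have "times_differentiable_on k (\<lambda>x. frechet_derivative p (at x) v *\<^sub>R frechet_derivative \<theta> (at (p x)) 1) UNIV" for v
  proof (rule times_differentiable_on_scaleR[OF open_UNIV])
    show "times_differentiable_on k (\<lambda>x. frechet_derivative p (at x) v) UNIV"
      using Suc.prems(2) by simp
    show "times_differentiable_on k (\<lambda>x. frechet_derivative \<theta> (at (p x)) 1) UNIV"
      by (rule Suc.IH[of "\<lambda>y. frechet_derivative \<theta> (at y) 1"])
        (use Suc.prems(1) times_differentiable_on_SucD[OF Suc.prems(2)] in simp_all)
  qed
  ultimately show ?case
    by (rule times_differentiable_on_SucI[OF open_UNIV])
qed

lemma smooth_on_has_derivative:
  "smooth_on f S \<Longrightarrow> x \<in> S \<Longrightarrow> (f has_derivative frechet_derivative f (at x)) (at x)"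
  unfolding smooth_on_def using times_differentiable_on_SucE by blast

lemma smooth_on_frechet_derivative:
  "smooth_on f S \<Longrightarrow> smooth_on (\<lambda>x. frechet_derivative f (at x) v) S"
  unfolding smooth_on_def by (metis times_differentiable_on.simps(2))

lemma smooth_on_imp_continuous_on: "smooth_on f S \<Longrightarrow> continuous_on S f"
  unfolding smooth_on_def by (metis times_differentiable_on.simps(1))

text \<open>The bump function \<open>exp (-1/x)\<close> and its derivatives lie in the span of this family.\<close>

definition flat_exp :: "nat \<Rightarrow> real \<Rightarrow> real" where
  "flat_exp k x = (if x > 0 then inverse x ^ k * exp (- inverse x) else 0)"

text \<open>Away from 0 this is calculus; at 0 both one-sided difference quotients tend to 0, on the
  right because exponential decay beats every negative power of \<open>x\<close>.\<close>

lemma flat_exp_has_derivative: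
  "(flat_exp k has_real_derivative (flat_exp (k + 2) x - real k * flat_exp (k + 1) x)) (at x)"
proof -
  consider "x > 0" | "x < 0" | "x = 0" by linarith
  then show ?thesis
  proof cases
    case 1
    have "((\<lambda>x. inverse x ^ k * exp (- inverse x)) has_real_derivative
        (flat_exp (k + 2) x - real k * flat_exp (k + 1) x)) (at x)"
    proof -
      have inv: "(inverse has_real_derivative (- (inverse x ^ 2))) (at x)"
        using DERIV_inverse[of x UNIV] 1 by (simp add: numeral_2_eq_2)
      have "((\<lambda>x. inverse x ^ k) has_real_derivative (- (real k * inverse x ^ (k + 1)))) (at x)"
        using DERIV_power[OF inv, of k] by (cases k) (auto simp: algebra_simps power2_eq_square)
      from DERIV_mult[OF this DERIV_fun_exp[OF DERIV_minus[OF inv]]] 1 show ?thesis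
        by (simp add: flat_exp_def algebra_simps power2_eq_square)
    qed
    then show ?thesis
      by (rule has_field_derivative_transform_within_open[where S="{0<..}"])
        (use 1 in \<open>auto simp: flat_exp_def\<close>)
  next
    case 2
    show ?thesis
      by (rule has_field_derivative_transform_within_open[where S="{..<0}" and f="\<lambda>x. 0"])
        (use 2 in \<open>auto simp: flat_exp_def\<close>)
  next
    case 3
    \<comment> \<open>Substituting \<open>inverse y\<close> for \<open>y\<close> gives the right
      difference quotient at 0; the power is \<open>Suc k\<close> because dividing by
      \<open>y\<close> adds one factor \<open>inverse y\<close>.\<close>
    have "((\<lambda>y::real. y ^ Suc k / exp y) \<longlongrightarrow> 0) at_top"
      by (rule tendsto_power_div_exp_0)
    then have "((\<lambda>y::real. inverse y ^ Suc k / exp (inverse y)) \<longlongrightarrow> 0) (at_right 0)"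
      using filterlim_compose[OF _ filterlim_inverse_at_top_right] by blast
    then have "((\<lambda>y. (flat_exp k y - flat_exp k 0) / (y - 0)) \<longlongrightarrow> 0) (at_right 0)"
      by (rule Lim_transform_eventually)
        (auto simp: eventually_at_filter flat_exp_def exp_minus field_simps)
    moreover have "((\<lambda>y. (flat_exp k y - flat_exp k 0) / (y - 0)) \<longlongrightarrow> 0) (at_left 0)"
      by (rule Lim_transform_eventually[OF tendsto_const])
        (auto simp: eventually_at_filter flat_exp_def)
    ultimately have "((\<lambda>y. (flat_exp k y - flat_exp k 0) / (y - 0)) \<longlongrightarrow> 0) (at 0)"
      using filterlim_split_at by blast
    then show ?thesis unfolding has_field_derivative_iff 3 by (simp add: flat_exp_def)
  qed
qed

lemma smooth_on_flat_exp: "smooth_on (flat_exp k) UNIV"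
  unfolding smooth_on_def
proof
  fix n show "times_differentiable_on n (flat_exp k) UNIV"
  proof (induction n arbitrary: k)
    case 0
    show ?case using flat_exp_has_derivative
      by (auto intro!: continuous_at_imp_continuous_on DERIV_isCont)
  next
    case (Suc n)
    have "times_differentiable_on n (\<lambda>x. v *\<^sub>R (flat_exp (k + 2) x + (- real k) *\<^sub>R flat_exp (k + 1) x)) UNIV" for v
      by (intro times_differentiable_on_scaleR times_differentiable_on_add times_differentiable_on_const Suc) auto
    then have *: "times_differentiable_on n (\<lambda>x. (flat_exp (k + 2) x - real k * flat_exp (k + 1) x) * v) UNIV" for v
      by (simp add: mult.commute)
    show ?case
      by (rule times_differentiable_on_SucI[where f'="\<lambda>x v. (flat_exp (k + 2) x - real k * flat_exp (k + 1) x) * v"])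
        (simp_all only: open_UNIV * flat_exp_has_derivative[unfolded has_field_derivative_def])
  qed
qed

subsection \<open>Mollifiers\<close>

text \<open>Sign and normalisation are left to \<open>mollifier\<close>, so that the derivatives of
  a mollifier stay in this class.\<close>

definition smooth_supported :: "real \<Rightarrow> ('a::euclidean_space \<Rightarrow> real) \<Rightarrow> bool" where
  "smooth_supported d \<rho> \<longleftrightarrow> smooth_on \<rho> UNIV \<and> (\<forall>z. d < norm z \<longrightarrow> \<rho> z = 0)"

definition mollifier :: "real \<Rightarrow> ('a::euclidean_space \<Rightarrow> real) \<Rightarrow> bool" where
  "mollifier d \<rho> \<longleftrightarrow> smooth_supported d \<rho> \<and> (\<forall>z. 0 \<le> \<rho> z) \<and> (LINT z|lborel. \<rho> z) = 1"

text \<open>The integral runs over the whole space. A function that is integrable only near a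
  compact set \<open>L\<close> is first multiplied by \<open>indicator L\<close>, which changes
  nothing at points \<open>z\<close> for which the shifted support of the kernel lies in
  \<open>L\<close>.\<close>

definition convolve :: "('a::euclidean_space \<Rightarrow> real) \<Rightarrow> ('a \<Rightarrow> 'b::euclidean_space) \<Rightarrow> 'a \<Rightarrow> 'b" where
  "convolve \<rho> f z = (LINT y|lborel. \<rho> (z - y) *\<^sub>R f y)"

lemma smooth_supported_continuous: "smooth_supported d \<rho> \<Longrightarrow> continuous_on UNIV \<rho>"
  unfolding smooth_supported_def using smooth_on_imp_continuous_on by blast

lemma smooth_supported_measurable [measurable_dest]:
  "smooth_supported d \<rho> \<Longrightarrow> \<rho> \<in> borel_measurable borel"
  by (rule borel_measurable_continuous_onI[OF smooth_supported_continuous])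

text \<open>Two points at distance less than 1 lie either both in \<open>cball 0 (d + 1)\<close>,
  where compactness gives uniform continuity, or both outside the support.\<close>

lemma smooth_supported_uniformly_continuous:
  assumes "smooth_supported d \<rho>" "e > 0"
  shows "\<exists>\<delta>>0. \<forall>x y. norm (x - y) < \<delta> \<longrightarrow> \<bar>\<rho> x - \<rho> y\<bar> < e"
proof -
  have "uniformly_continuous_on (cball 0 (d + 1)) \<rho>"
    by (intro compact_uniformly_continuous continuous_on_subset[OF smooth_supported_continuous[OF assms(1)]]) auto
  then obtain \<delta> where \<delta>: "\<delta> > 0" "\<And>x y. norm x \<le> d + 1 \<Longrightarrow> norm y \<le> d + 1 \<Longrightarrow> norm (x - y) < \<delta> \<Longrightarrow> \<bar>\<rho> x - \<rho> y\<bar> < e"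
    using \<open>e > 0\<close> unfolding uniformly_continuous_on_def
    by (auto simp: dist_norm real_norm_def[symmetric] norm_minus_commute simp del: real_norm_def)
  have zero: "\<rho> x = 0" if "d < norm x" for x using assms that by (auto simp: smooth_supported_def)
  have "\<bar>\<rho> x - \<rho> y\<bar> < e" if xy: "norm (x - y) < min \<delta> 1" for x y
  proof (cases "norm x \<le> d + 1 \<and> norm y \<le> d + 1")
    case False
    have "norm x \<le> norm y + norm (x - y)" "norm y \<le> norm x + norm (x - y)"
      using norm_triangle_sub norm_triangle_sub[of y x] by (auto simp: norm_minus_commute)
    with False xy have "d < norm x" "d < norm y" by auto
    then show ?thesis using zero \<open>e > 0\<close> by simp
  qed (use \<delta> xy in auto)
  then show ?thesis using \<open>\<delta> > 0\<close> by (intro exI[of _ "min \<delta> 1"]) auto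
qed

lemma smooth_supported_bounded:
  assumes "smooth_supported d \<rho>"
  shows "\<exists>M\<ge>0. \<forall>x. \<bar>\<rho> x\<bar> \<le> M"
proof -
  have "compact (\<rho> ` cball 0 d)"
    by (intro compact_continuous_image continuous_on_subset[OF smooth_supported_continuous[OF assms]]) auto
  then obtain M where "\<And>x. norm x \<le> d \<Longrightarrow> \<bar>\<rho> x\<bar> \<le> M"
    by (metis bounded_iff compact_imp_bounded image_eqI mem_cball_0 real_norm_def)
  then show ?thesis using assms
    by (intro exI[of _ "max M 0"]) (auto simp: smooth_supported_def le_max_iff_disj not_le[symmetric])
qed

lemma smooth_supported_derivative:
  assumes "smooth_supported d \<rho>"
  shows "smooth_supported d (\<lambda>z. frechet_derivative \<rho> (at z) v)"
proof -
  have "frechet_derivative \<rho> (at z) v = 0" if "d < norm z" for z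
  proof -
    have "open {z::'a. d < norm z}" by (intro open_Collect_less continuous_intros)
    moreover have "((\<lambda>z. 0) has_derivative (\<lambda>v. 0)) (at z)" by simp
    ultimately have "(\<rho> has_derivative (\<lambda>v. 0)) (at z)"
      using has_derivative_transform_within_open[of "\<lambda>z. 0" "\<lambda>v. 0" z UNIV "{z. d < norm z}" \<rho>] assms that
      by (auto simp: smooth_supported_def)
    then show ?thesis by (metis frechet_derivative_at)
  qed
  then show ?thesis using assms smooth_on_frechet_derivative unfolding smooth_supported_def by blast
qed

lemma smooth_supported_integrable_scaleR:
  fixes f :: "'a::euclidean_space \<Rightarrow> 'b::euclidean_space"
  assumes "smooth_supported d \<rho>" "integrable lborel f"
  shows "integrable lborel (\<lambda>y. \<rho> (z - y) *\<^sub>R f y)"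
proof -
  obtain M where M: "\<And>x. \<bar>\<rho> x\<bar> \<le> M" using smooth_supported_bounded[OF assms(1)] by auto
  have [measurable]: "\<rho> \<in> borel_measurable borel" using smooth_supported_measurable assms by blast
  have [measurable]: "f \<in> borel_measurable borel" using assms(2) by auto
  show ?thesis
    by (rule Bochner_Integration.integrable_bound[OF integrable_norm[OF integrable_scaleR_right[of M lborel f]]])
      (simp_all add: assms(2) mult_right_mono[OF order_trans[OF M abs_ge_self]])
qed

lemma smooth_supported_integrable:
  fixes \<rho> :: "'a::euclidean_space \<Rightarrow> real"
  assumes "smooth_supported d \<rho>"
  shows "integrable lborel \<rho>"
proof -
  have "integrable lborel (\<lambda>x. indicator (cball 0 d) x *\<^sub>R \<rho> x)"
    by (rule borel_integrable_compact) (auto intro: continuous_on_subset[OF smooth_supported_continuous[OF assms]])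
  moreover have "(\<lambda>x. indicator (cball 0 d) x *\<^sub>R \<rho> x) = \<rho>"
    using assms by (intro ext) (auto simp: smooth_supported_def indicator_def not_le[symmetric])
  ultimately show ?thesis by simp
qed

text \<open>The finitely many partial derivatives are uniformly continuous, hence so is the
  derivative in operator norm, and the mean value inequality bounds the Taylor remainder uniformly
  in the base point. This uniformity is what permits differentiation under the convolution
  integral.\<close>

lemma linearization_bound:
  fixes \<rho> :: "'a::euclidean_space \<Rightarrow> real"
  assumes "smooth_supported d \<rho>" "e > 0"
  shows "\<exists>\<delta>>0. \<forall>x y. norm (y - x) < \<delta> \<longrightarrow>
    \<bar>\<rho> y - \<rho> x - frechet_derivative \<rho> (at x) (y - x)\<bar> \<le> e * norm (y - x)"
proof -
  let ?D = "\<lambda>x. frechet_derivative \<rho> (at x)"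
  let ?N = "real DIM('a)"
  have D: "(\<rho> has_derivative ?D x) (at x)" for x
    using assms smooth_on_has_derivative unfolding smooth_supported_def by blast
  \<comment> \<open>Each of the \<open>?N\<close> coordinate directions receives the share
    \<open>e / ?N\<close>; together they bound the operator norm by \<open>e\<close>.\<close>
  have "\<forall>i\<in>Basis. \<exists>\<delta>>0. \<forall>x y. norm (x - y) < \<delta> \<longrightarrow> \<bar>?D x i - ?D y i\<bar> < e / ?N"
    using smooth_supported_uniformly_continuous[OF smooth_supported_derivative[OF assms(1)]] assms(2) by simp
  then obtain \<delta> where \<delta>: "\<And>i. i \<in> Basis \<Longrightarrow> \<delta> i > 0"
    "\<And>i x y. i \<in> Basis \<Longrightarrow> norm (x - y) < \<delta> i \<Longrightarrow> \<bar>?D x i - ?D y i\<bar> < e / ?N"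
    by metis
  define d0 where "d0 = Min (\<delta> ` Basis)"
  have d0: "d0 > 0" "\<And>i. i \<in> Basis \<Longrightarrow> d0 \<le> \<delta> i" using \<delta>(1) by (auto simp: d0_def)
  have on: "onorm (\<lambda>v. ?D y v - ?D x v) \<le> e" if "norm (y - x) < d0" for x y
  proof (rule onorm_le)
    fix v
    have lin: "linear (\<lambda>v. ?D y v - ?D x v)"
      using D has_derivative_linear linear_compose_sub by blast
    have "?D y v - ?D x v = (\<Sum>i\<in>Basis. (v \<bullet> i) * (?D y i - ?D x i))"
      using Linear_Algebra.linear_componentwise[OF lin, of v 1] by simp
    also have "\<bar>\<dots>\<bar> \<le> (\<Sum>i\<in>Basis. \<bar>(v \<bullet> i) * (?D y i - ?D x i)\<bar>)" by (rule sum_abs)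
    also have "\<dots> \<le> (\<Sum>i\<in>(Basis::'a set). norm v * (e / ?N))"
    proof (rule sum_mono)
      fix i :: 'a assume i: "i \<in> Basis"
      have "norm (y - x) < \<delta> i" using d0(2)[OF i] that by simp
      then show "\<bar>(v \<bullet> i) * (?D y i - ?D x i)\<bar> \<le> norm v * (e / ?N)"
        unfolding abs_mult by (intro mult_mono Basis_le_norm[OF i] less_imp_le[OF \<delta>(2)[OF i]]) auto
    qed
    also have "\<dots> = e * norm v" by simp
    finally show "norm (?D y v - ?D x v) \<le> e * norm v" by simp
  qed
  have "\<bar>\<rho> y - \<rho> x - ?D x (y - x)\<bar> \<le> e * norm (y - x)" if "norm (y - x) < d0" for x y
  proof -
    have "norm (\<rho> y - \<rho> x - ?D x (y - x)) \<le> norm (y - x) * e"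
    proof (rule differentiable_bound_linearization[where S="ball x d0" and f'="?D"])
      show "x + t *\<^sub>R (y - x) \<in> ball x d0" if "t \<in> {0..1}" for t
      proof -
        have "norm (t *\<^sub>R (y - x)) \<le> 1 * norm (y - x)"
          unfolding norm_scaleR by (rule mult_right_mono) (use that in auto)
        then show ?thesis using \<open>norm (y - x) < d0\<close> by (simp add: dist_norm)
      qed
      show "onorm (?D z - ?D x) \<le> e" if "z \<in> ball x d0" for z
        using on[of z x] that by (simp add: dist_norm norm_minus_commute fun_diff_def)
    qed (use D d0 in \<open>auto intro: has_derivative_at_withinI\<close>)
    then show ?thesis by (simp add: mult.commute)
  qed
  then show ?thesis using d0(1) by blast
qed

text \<open>The Taylor remainder of the kernel, uniform in the base point, is integrated against
  \<open>f\<close>, whose L^1 norm is all that enters.\<close>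

lemma convolve_has_derivative:
  fixes f :: "'a::euclidean_space \<Rightarrow> 'b::euclidean_space"
  assumes \<rho>: "smooth_supported d \<rho>" and f: "integrable lborel f"
  shows "(convolve \<rho> f has_derivative (\<lambda>v. convolve (\<lambda>z. frechet_derivative \<rho> (at z) v) f z)) (at z)"
proof -
  let ?D = "\<lambda>x. frechet_derivative \<rho> (at x)"
  have lin: "linear (?D x)" for x
    by (rule has_derivative_linear[OF smooth_on_has_derivative[of \<rho> UNIV]])
      (use \<rho> in \<open>auto simp: smooth_supported_def\<close>)
  note intD = smooth_supported_integrable_scaleR[OF smooth_supported_derivative[OF \<rho>] f]
  note int\<rho> = smooth_supported_integrable_scaleR[OF \<rho> f]
  have "linear (\<lambda>v. convolve (\<lambda>z. ?D z v) f z)"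
  proof (rule linearI)
    fix a b :: 'a and c :: real
    show "convolve (\<lambda>z. ?D z (a + b)) f z = convolve (\<lambda>z. ?D z a) f z + convolve (\<lambda>z. ?D z b) f z"
      unfolding convolve_def linear_add[OF lin] scaleR_add_left
      by (rule Bochner_Integration.integral_add[OF intD intD])
    show "convolve (\<lambda>z. ?D z (c *\<^sub>R a)) f z = c *\<^sub>R convolve (\<lambda>z. ?D z a) f z"
    proof -
      have eq: "?D x (c *\<^sub>R a) *\<^sub>R v = c *\<^sub>R (?D x a *\<^sub>R v)" for x and v :: 'b
        using linear_scale[OF lin, of x c a] by simp
      show ?thesis unfolding convolve_def eq by (rule integral_scaleR_right)
    qed
  qed
  then have bl: "bounded_linear (\<lambda>v. convolve (\<lambda>z. ?D z v) f z)"
    by (simp add: linear_conv_bounded_linear)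
  let ?F = "LINT y|lborel. norm (f y)"
  have F0: "?F \<ge> 0" by simp
  show ?thesis unfolding has_derivative_at_alt
  proof (intro conjI bl allI impI)
    fix e :: real assume "e > 0"
    \<comment> \<open>Adding 1 keeps the divisor positive when \<open>f\<close> vanishes almost
      everywhere.\<close>
    then have "e / (?F + 1) > 0" using F0 by (simp add: add_nonneg_pos)
    from linearization_bound[OF \<rho> this] obtain \<delta> where \<delta>: "\<delta> > 0"
      "\<And>x y. norm (y - x) < \<delta> \<Longrightarrow> \<bar>\<rho> y - \<rho> x - ?D x (y - x)\<bar> \<le> e / (?F + 1) * norm (y - x)" by blast
    have "norm (convolve \<rho> f x - convolve \<rho> f z - convolve (\<lambda>u. ?D u (x - z)) f z) \<le> e * norm (x - z)"
      if x: "norm (x - z) < \<delta>" for x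
    proof -
      have "convolve \<rho> f x - convolve \<rho> f z - convolve (\<lambda>u. ?D u (x - z)) f z =
          (LINT y|lborel. (\<rho> (x - y) - \<rho> (z - y) - ?D (z - y) (x - z)) *\<^sub>R f y)"
        unfolding convolve_def scaleR_diff_left
        by (simp add: int\<rho> intD Bochner_Integration.integral_diff)
      also have "norm \<dots> \<le> (LINT y|lborel. norm ((\<rho> (x - y) - \<rho> (z - y) - ?D (z - y) (x - z)) *\<^sub>R f y))"
        by (rule integral_norm_bound)
      also have "\<dots> \<le> (LINT y|lborel. (e / (?F + 1) * norm (x - z)) * norm (f y))"
      proof (rule integral_mono)
        show "integrable lborel (\<lambda>y. norm ((\<rho> (x - y) - \<rho> (z - y) - ?D (z - y) (x - z)) *\<^sub>R f y))"
          unfolding scaleR_diff_left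
          by (rule integrable_norm, rule Bochner_Integration.integrable_diff,
              rule Bochner_Integration.integrable_diff) (rule int\<rho> intD)+
        show "integrable lborel (\<lambda>y. (e / (?F + 1) * norm (x - z)) * norm (f y))"
          by (intro integrable_mult_right integrable_norm f)
        fix y
        have "(x - y) - (z - y) = x - z" by simp
        then show "norm ((\<rho> (x - y) - \<rho> (z - y) - ?D (z - y) (x - z)) *\<^sub>R f y)
            \<le> (e / (?F + 1) * norm (x - z)) * norm (f y)"
          unfolding norm_scaleR using \<delta>(2)[of "x - y" "z - y"] x
          by (intro mult_right_mono norm_ge_zero) (simp only: real_norm_def)
      qed
      also have "\<dots> = e * norm (x - z) * (?F / (?F + 1))" by simp
      also have "\<dots> \<le> e * norm (x - z) * 1"
        using \<open>e > 0\<close> F0 by (intro mult_left_mono) (auto simp: divide_le_eq add_nonneg_pos)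
      finally show ?thesis by simp
    qed
    then show "\<exists>d>0. \<forall>y. norm (y - z) < d \<longrightarrow>
        norm (convolve \<rho> f y - convolve \<rho> f z - convolve (\<lambda>u. ?D u (y - z)) f z) \<le> e * norm (y - z)"
      by (intro exI[of _ \<delta>] conjI allI impI \<open>\<delta> > 0\<close>)
  qed
qed

lemma frechet_derivative_convolve:
  fixes f :: "'a::euclidean_space \<Rightarrow> 'b::euclidean_space"
  assumes "smooth_supported d \<rho>" "integrable lborel f"
  shows "frechet_derivative (convolve \<rho> f) (at z) v = convolve (\<lambda>z. frechet_derivative \<rho> (at z) v) f z"
  using frechet_derivative_at[OF convolve_has_derivative[OF assms]] by metis

text \<open>Differentiation only replaces the kernel by its derivative, so the induction generalises
  over \<open>\<rho>\<close> and keeps \<open>f\<close> fixed; from \<open>f\<close> only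
  integrability is required.\<close>

lemma smooth_on_convolve:
  fixes f :: "'a::euclidean_space \<Rightarrow> 'b::euclidean_space"
  assumes "smooth_supported d \<rho>" and f: "integrable lborel f"
  shows "smooth_on (convolve \<rho> f) UNIV"
  unfolding smooth_on_def
proof
  fix k show "times_differentiable_on k (convolve \<rho> f) UNIV"
    using assms(1)
  proof (induction k arbitrary: \<rho>)
    case 0
    show ?case using convolve_has_derivative[OF 0 f]
      by (auto intro!: continuous_at_imp_continuous_on has_derivative_continuous)
  next
    case (Suc k)
    show ?case
      by (rule times_differentiable_on_SucI[OF open_UNIV convolve_has_derivative[OF Suc.prems f]])
        (rule Suc.IH[OF smooth_supported_derivative[OF Suc.prems]])
  qed
qed

text \<open>The argument is negative outside the ball, where \<open>flat_exp\<close> vanishes;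
  squaring the norm removes its singularity at the origin.\<close>

lemma smooth_supported_bump: "smooth_supported d (\<lambda>z. flat_exp 0 (d\<^sup>2 - (norm z)\<^sup>2))" if "d > 0"
proof -
  have "times_differentiable_on k (\<lambda>z::'a. flat_exp 0 (d\<^sup>2 - (norm z)\<^sup>2)) UNIV" for k
  proof (rule times_differentiable_on_compose_real[of k "flat_exp 0" "\<lambda>z. d\<^sup>2 - (norm z)\<^sup>2"])
    show "times_differentiable_on k (flat_exp 0) UNIV"
      using smooth_on_flat_exp by (simp add: smooth_on_def)
    \<comment> \<open>Written in coordinates, the squared norm is a sum of products of bounded
      linear functions, to which the closure rules apply.\<close>
    have "times_differentiable_on k (\<lambda>z::'a. d\<^sup>2 + (-1) *\<^sub>R (\<Sum>i\<in>Basis. (z \<bullet> i) *\<^sub>R (z \<bullet> i))) UNIV"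
      by (intro times_differentiable_on_add times_differentiable_on_scaleR times_differentiable_on_sum
          times_differentiable_on_const times_differentiable_on_bounded_linear bounded_linear_inner_left open_UNIV)
    then show "times_differentiable_on k (\<lambda>z::'a. d\<^sup>2 - (norm z)\<^sup>2) UNIV"
      by (simp add: power2_norm_eq_inner euclidean_inner[symmetric])
  qed
  moreover have "flat_exp 0 (d\<^sup>2 - (norm z)\<^sup>2) = 0" if "d < norm z" for z :: 'a
    using power_strict_mono[OF that, of 2] \<open>d > 0\<close> by (simp add: flat_exp_def)
  ultimately show ?thesis
    by (simp add: smooth_supported_def smooth_on_def)
qed

lemma smooth_supported_cmult: "smooth_supported d \<rho> \<Longrightarrow> smooth_supported d (\<lambda>z. c * \<rho> z)"
  using times_differentiable_on_scaleR[OF open_UNIV times_differentiable_on_const[OF open_UNIV], of _ \<rho> c]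
  by (simp add: smooth_supported_def smooth_on_def)

text \<open>The bump is divided by its integral, which is nonzero: a nonnegative function with zero
  integral vanishes almost everywhere, but the bump is positive on an open ball.\<close>

lemma mollifier_exists:
  assumes "d > 0"
  shows "\<exists>\<rho>::'a::euclidean_space \<Rightarrow> real. mollifier d \<rho>"
proof -
  define \<rho> where "\<rho> = (\<lambda>z::'a. flat_exp 0 (d\<^sup>2 - (norm z)\<^sup>2))"
  have \<rho>: "smooth_supported d \<rho>" unfolding \<rho>_def by (rule smooth_supported_bump[OF assms])
  have nn: "0 \<le> \<rho> z" for z by (simp add: \<rho>_def flat_exp_def)
  have pos: "0 < \<rho> z" if "z \<in> ball 0 d" for z
    using that power_strict_mono[of "norm z" d 2] by (auto simp: \<rho>_def flat_exp_def)
  have "(LINT z|lborel. \<rho> z) \<noteq> 0"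
  proof
    assume "(LINT z|lborel. \<rho> z) = 0"
    then have "AE z in lborel. \<rho> z = 0"
      using integral_nonneg_eq_0_iff_AE[OF smooth_supported_integrable[OF \<rho>]] nn by simp
    then have "AE z::'a in lborel. z \<notin> ball 0 d" by (rule AE_mp) (intro AE_I2, metis less_irrefl pos)
    then have "emeasure lborel (ball (0::'a) d) = 0"
      by (subst (asm) AE_iff_measurable[where N="ball (0::'a) d"]) auto
    then have "negligible (ball (0::'a) d)"
      by (simp add: negligible_iff_null_sets null_sets_def)
    then show False using open_not_negligible[of "ball (0::'a) d"] assms by simp
  qed
  moreover have "(LINT z|lborel. \<rho> z) \<ge> 0" using nn by simp
  ultimately have "mollifier d (\<lambda>z. inverse (LINT z|lborel. \<rho> z) * \<rho> z)"
    unfolding mollifier_def using smooth_supported_cmult[OF \<rho>] nn by auto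
  then show ?thesis by blast
qed

subsection \<open>Convergence of mollifications\<close>

lemma nn_integral_lborel_translate:
  fixes f :: "'a::euclidean_space \<Rightarrow> ennreal"
  assumes [measurable]: "f \<in> borel_measurable borel"
  shows "(\<integral>\<^sup>+z. f (z - v) \<partial>lborel) = (\<integral>\<^sup>+z. f z \<partial>lborel)"
proof -
  have "(\<integral>\<^sup>+z. f z \<partial>lborel) = (\<integral>\<^sup>+z. f z \<partial>distr lborel borel ((+) (- v)))"
    by (simp only: lborel_distr_plus)
  also have "\<dots> = (\<integral>\<^sup>+z. f (z - v) \<partial>lborel)"
    by (subst nn_integral_distr) auto
  finally show ?thesis by simp
qed

lemma nn_integral_lborel_reflect:
  fixes f :: "'a::euclidean_space \<Rightarrow> ennreal"
  assumes [measurable]: "f \<in> borel_measurable borel"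
  shows "(\<integral>\<^sup>+z. f (c - z) \<partial>lborel) = (\<integral>\<^sup>+z. f z \<partial>lborel)"
proof -
  have "(\<integral>\<^sup>+z. f z \<partial>lborel) = (\<integral>\<^sup>+z. f z \<partial>distr lborel borel (\<lambda>x. c + (-1) *\<^sub>R x))"
    by (subst lborel_affine[of "-1" c]) (simp_all add: density_1)
  also have "\<dots> = (\<integral>\<^sup>+z. f (c - z) \<partial>lborel)"
    by (subst nn_integral_distr) auto
  finally show ?thesis by simp
qed

text \<open>Inner regularity supplies a closed set; intersecting it with a large ball makes it
  compact, and finiteness of the measure makes the discarded tail small. The error is shared by the
  outer, the inner and the tail part.\<close>

lemma finite_measure_compact_open_approx:
  fixes A :: "'a::euclidean_space set"
  assumes [measurable]: "A \<in> sets borel" and fin: "emeasure lborel A < \<infinity>" and "e > 0"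
  shows "\<exists>K U. compact K \<and> open U \<and> K \<subseteq> A \<and> A \<subseteq> U \<and> emeasure lborel (U - K) \<le> ennreal e"
proof -
  have A: "A \<in> sets lebesgue" using assms by simp
  have e3: "e / 3 > 0" using assms by simp
  obtain U where U: "open U" "A \<subseteq> U" "emeasure lebesgue (U - A) < ennreal (e / 3)"
    using sets_lebesgue_outer_open[OF A e3] by metis
  obtain T where T: "closed T" "T \<subseteq> A" "emeasure lebesgue (A - T) < ennreal (e / 3)"
    using sets_lebesgue_inner_closed[OF A e3] by metis
  note [measurable] = borel_open[OF U(1)] borel_closed[OF T(1)]
  have le: "emeasure lborel (T - cball 0 (real n)) \<le> emeasure lborel A" for n
    using T by (intro emeasure_mono) auto
  have "(\<lambda>n. emeasure lborel (T - cball 0 (real n))) \<longlonglongrightarrow> emeasure lborel (\<Inter>n. T - cball 0 (real n))"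
  proof (rule Lim_emeasure_decseq)
    show "emeasure lborel (T - cball 0 (real n)) \<noteq> \<infinity>" for n
      using le_less_trans[OF le fin] by (metis less_irrefl)
  qed (auto simp: decseq_def)
  moreover have "(\<Inter>n. T - cball 0 (real n)) = {}"
    by auto (use real_arch_simple in blast)
  ultimately have "(\<lambda>n. emeasure lborel (T - cball 0 (real n))) \<longlonglongrightarrow> 0"
    by (simp only: emeasure_empty)
  from order_tendstoD(2)[OF this, of "ennreal (e / 3)"] e3
  obtain n where n: "emeasure lborel (T - cball 0 (real n)) < ennreal (e / 3)"
    by (auto simp: eventually_sequentially)
  have "emeasure lborel (U - (T \<inter> cball 0 (real n)))
      \<le> emeasure lborel ((U - A) \<union> ((A - T) \<union> (T - cball 0 (real n))))"
    by (intro emeasure_mono) auto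
  also have "\<dots> \<le> emeasure lborel (U - A) + (emeasure lborel (A - T) + emeasure lborel (T - cball 0 (real n)))"
    by (intro order_trans[OF emeasure_subadditive] add_mono order_refl) auto
  also have "\<dots> \<le> ennreal (e / 3) + (ennreal (e / 3) + ennreal (e / 3))"
    using U(3) T(3) n by (intro add_mono) (auto intro: less_imp_le)
  also have "\<dots> = ennreal e" using e3 by (simp flip: ennreal_plus)
  finally show ?thesis using U T
    by (intro exI[of _ "T \<inter> cball 0 (real n)"] exI[of _ U]) (auto intro: closed_Int_compact)
qed

text \<open>Integrable functions arise from indicators by sums and dominated limits. For an
  indicator with \<open>K \<subseteq> A \<subseteq> U\<close>, a translation shorter than the
  distance from \<open>K\<close> to the complement of \<open>U\<close> changes the value only where
  \<open>z\<close> or \<open>z - v\<close> lies in the thin set \<open>U - K\<close>.\<close>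

lemma L1_translation_continuous:
  fixes f :: "'a::euclidean_space \<Rightarrow> 'b::euclidean_space"
  assumes "integrable lborel f"
  shows "\<forall>e>0. \<exists>d>0. \<forall>v. norm v \<le> d \<longrightarrow> (\<integral>\<^sup>+z. ennreal (norm (f (z - v) - f z)) \<partial>lborel) \<le> ennreal e"
  using assms
proof (induction rule: integrable_induct)
  case (base A c)
  show ?case
  proof (intro allI impI)
    fix e :: real assume "e > 0"
    \<comment> \<open>The division by 2 pays for two copies of \<open>U - K\<close>, one of them
      translated.\<close>
    define e' where "e' = e / (norm c + 1) / 2"
    have nc: "norm c + 1 > 0" by (simp add: add_nonneg_pos)
    have "e' > 0" using \<open>e > 0\<close> nc by (simp add: e'_def)
    then obtain K U where KU: "compact K" "open U" "K \<subseteq> A" "A \<subseteq> U" "emeasure lborel (U - K) \<le> ennreal e'"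
      using finite_measure_compact_open_approx[of A e'] base by auto
    obtain d where d: "d > 0" "\<And>x y. x \<in> K \<Longrightarrow> y \<in> - U \<Longrightarrow> d \<le> dist x y"
      using separate_compact_closed[of K "- U"] KU by (auto simp: closed_Compl) blast
    have [measurable]: "U - K \<in> sets borel" "A \<in> sets borel" using sets.Diff[OF borel_open[OF KU(2)] borel_compact[OF KU(1)]] base by auto
    have "(\<integral>\<^sup>+z. ennreal (norm (indicator A (z - v) *\<^sub>R c - indicator A z *\<^sub>R c)) \<partial>lborel) \<le> ennreal e"
      if v: "norm v \<le> d / 2" for v
    proof -
      have "ennreal (norm (indicator A (z - v) *\<^sub>R c - indicator A z *\<^sub>R c)) \<le>
          ennreal (norm c) * (indicator (U - K) (z - v) + indicator (U - K) z)" for z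
      proof -
        have near: "y \<in> U" if "x \<in> K" "x - y = v \<or> y - x = v" for x y
        proof (rule ccontr)
          assume "y \<notin> U"
          then have "d \<le> norm v" using d(2)[of x y] that by (auto simp: dist_norm norm_minus_commute)
          then show False using v d(1) by simp
        qed
        have "z - v \<in> U - K \<or> z \<in> U - K" if "(z - v \<in> A) \<noteq> (z \<in> A)"
          using that near[of "z - v" z] near[of z "z - v"] KU(3,4) by auto
        then show ?thesis
          by (auto simp: indicator_def ennreal_of_nat_eq_real_of_nat distrib_left)
      qed
      then have "(\<integral>\<^sup>+z. ennreal (norm (indicator A (z - v) *\<^sub>R c - indicator A z *\<^sub>R c)) \<partial>lborel) \<le>
        (\<integral>\<^sup>+z. ennreal (norm c) * (indicator (U - K) (z - v) + indicator (U - K) z) \<partial>lborel)"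
        by (intro nn_integral_mono) auto
      also have "\<dots> = ennreal (norm c) * (emeasure lborel (U - K) + emeasure lborel (U - K))"
        by (simp add: nn_integral_cmult nn_integral_add nn_integral_lborel_translate[of "indicator (U - K)"])
      also have "\<dots> \<le> ennreal (norm c) * (ennreal e' + ennreal e')"
        by (intro mult_left_mono add_mono KU(5)) auto
      also have "\<dots> = ennreal (e * (norm c / (norm c + 1)))"
      proof -
        have "e' + e' = e / (norm c + 1)" unfolding e'_def by (rule field_sum_of_halves)
        then show ?thesis
          using \<open>e' > 0\<close> by (simp flip: ennreal_plus ennreal_mult add: mult.commute)
      qed
      also have "\<dots> \<le> ennreal (e * 1)"
        using \<open>e > 0\<close> nc by (intro ennreal_leI mult_left_mono) (auto simp: divide_le_eq)
      finally show ?thesis by simp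
    qed
    then show "\<exists>d>0. \<forall>v. norm v \<le> d \<longrightarrow>
        (\<integral>\<^sup>+z. ennreal (norm (indicator A (z - v) *\<^sub>R c - indicator A z *\<^sub>R c)) \<partial>lborel) \<le> ennreal e"
      using d(1) by (intro exI[of _ "d / 2"]) auto
  qed
next
  case (add f g)
  note [measurable] = borel_measurable_integrable[OF add(1)] borel_measurable_integrable[OF add(2)]
  show ?case
  proof (intro allI impI)
    fix e :: real assume "e > 0"
    then have e2: "e / 2 > 0" by simp
    obtain d1 where d1: "d1 > 0"
      "\<And>v. norm v \<le> d1 \<Longrightarrow> (\<integral>\<^sup>+z. ennreal (norm (f (z - v) - f z)) \<partial>lborel) \<le> ennreal (e / 2)"
      using add.IH(1)[rule_format, OF e2] by auto
    obtain d2 where d2: "d2 > 0"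
      "\<And>v. norm v \<le> d2 \<Longrightarrow> (\<integral>\<^sup>+z. ennreal (norm (g (z - v) - g z)) \<partial>lborel) \<le> ennreal (e / 2)"
      using add.IH(2)[rule_format, OF e2] by auto
    note d = d1(1) d2(1) d1(2) d2(2)
    have "(\<integral>\<^sup>+z. ennreal (norm ((f (z - v) + g (z - v)) - (f z + g z))) \<partial>lborel) \<le> ennreal e"
      if v: "norm v \<le> min d1 d2" for v
    proof -
      have "(\<integral>\<^sup>+z. ennreal (norm ((f (z - v) + g (z - v)) - (f z + g z))) \<partial>lborel) \<le>
        (\<integral>\<^sup>+z. ennreal (norm (f (z - v) - f z)) + ennreal (norm (g (z - v) - g z)) \<partial>lborel)"
        by (intro nn_integral_mono) (simp flip: ennreal_plus add: norm_diff_triangle_ineq)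
      also have "\<dots> = (\<integral>\<^sup>+z. ennreal (norm (f (z - v) - f z)) \<partial>lborel) + (\<integral>\<^sup>+z. ennreal (norm (g (z - v) - g z)) \<partial>lborel)"
        by (intro nn_integral_add) auto
      also have "\<dots> \<le> ennreal (e / 2) + ennreal (e / 2)" using d v by (intro add_mono) auto
      finally show ?thesis using \<open>e > 0\<close> by (simp flip: ennreal_plus)
    qed
    then show "\<exists>d>0. \<forall>v. norm v \<le> d \<longrightarrow>
        (\<integral>\<^sup>+z. ennreal (norm ((f (z - v) + g (z - v)) - (f z + g z))) \<partial>lborel) \<le> ennreal e"
      using d(1,2) by (intro exI[of _ "min d1 d2"]) auto
  qed
next
  case (lim f s)
  note [measurable] = borel_measurable_integrable[OF lim(1)] borel_measurable_integrable[OF lim(4)]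
  show ?case
  proof (intro allI impI)
    fix e :: real assume "e > 0"
    have "(\<lambda>i. \<integral>\<^sup>+z. ennreal (norm (s i z - f z)) \<partial>lborel) \<longlonglongrightarrow> (\<integral>\<^sup>+z. 0 \<partial>(lborel :: 'a measure))"
    \<comment> \<open>The approximants satisfy \<open>norm (s i z) \<le> 2 * norm (f z)\<close>,
      hence the factor 3.\<close>
    proof (rule nn_integral_dominated_convergence[where w="\<lambda>z. ennreal (3 * norm (f z))"])
      show "(\<integral>\<^sup>+z. ennreal (3 * norm (f z)) \<partial>lborel) < \<infinity>"
        using lim(4) by (simp add: integrable_iff_bounded ennreal_mult nn_integral_cmult ennreal_mult_less_top)
      show "AE z in lborel. ennreal (norm (s i z - f z)) \<le> ennreal (3 * norm (f z))" for i
        using lim(3)[of _ i] norm_triangle_ineq4[of "s i _" "f _"]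
        by (intro AE_I2 ennreal_leI) (smt (verit) space_lborel UNIV_I)
      show "AE z in lborel. (\<lambda>i. ennreal (norm (s i z - f z))) \<longlonglongrightarrow> 0"
        using lim(2) by (intro AE_I2) (auto intro!: tendsto_ennrealI[of _ 0, simplified] tendsto_norm_zero LIM_zero)
    qed auto
    then have "(\<lambda>i. \<integral>\<^sup>+z. ennreal (norm (s i z - f z)) \<partial>lborel) \<longlonglongrightarrow> 0" by simp
    from order_tendstoD(2)[OF this, of "ennreal (e / 3)"] \<open>e > 0\<close>
    obtain i where i: "(\<integral>\<^sup>+z. ennreal (norm (s i z - f z)) \<partial>lborel) < ennreal (e / 3)"
      by (auto simp: eventually_sequentially)
    obtain d where d: "d > 0"
      "\<And>v. norm v \<le> d \<Longrightarrow> (\<integral>\<^sup>+z. ennreal (norm (s i (z - v) - s i z)) \<partial>lborel) \<le> ennreal (e / 3)"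
      using lim.IH[of i, rule_format, of "e / 3"] \<open>e > 0\<close> by auto
    have "(\<integral>\<^sup>+z. ennreal (norm (f (z - v) - f z)) \<partial>lborel) \<le> ennreal e" if v: "norm v \<le> d" for v
    proof -
      have "(\<integral>\<^sup>+z. ennreal (norm (f (z - v) - f z)) \<partial>lborel) \<le>
        (\<integral>\<^sup>+z. ennreal (norm (s i (z - v) - f (z - v))) + (ennreal (norm (s i z - f z)) + ennreal (norm (s i (z - v) - s i z))) \<partial>lborel)"
      proof (intro nn_integral_mono)
        fix z
        have tri: "norm (- a + (b + c)) \<le> norm a + (norm b + norm c)" for a b c :: 'b
          using norm_triangle_ineq[of "- a" "b + c"] norm_triangle_ineq[of b c] by simp
        have "norm (f (z - v) - f z) \<le> norm (s i (z - v) - f (z - v)) + (norm (s i z - f z) + norm (s i (z - v) - s i z))"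
          using tri[of "s i (z - v) - f (z - v)" "s i z - f z" "s i (z - v) - s i z"] by simp
        then show "ennreal (norm (f (z - v) - f z)) \<le> ennreal (norm (s i (z - v) - f (z - v))) +
            (ennreal (norm (s i z - f z)) + ennreal (norm (s i (z - v) - s i z)))"
          by (simp flip: ennreal_plus)
      qed
      also have "\<dots> = (\<integral>\<^sup>+z. ennreal (norm (s i z - f z)) \<partial>lborel) +
          ((\<integral>\<^sup>+z. ennreal (norm (s i z - f z)) \<partial>lborel) + (\<integral>\<^sup>+z. ennreal (norm (s i (z - v) - s i z)) \<partial>lborel))"
        by (simp add: nn_integral_add nn_integral_lborel_translate[of "\<lambda>z. ennreal (norm (s i z - f z))"])
      also have "\<dots> \<le> ennreal (e / 3) + (ennreal (e / 3) + ennreal (e / 3))"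
        using i d(2)[OF v] by (intro add_mono) auto
      finally show ?thesis using \<open>e > 0\<close> by (simp flip: ennreal_plus)
    qed
    then show "\<exists>d>0. \<forall>v. norm v \<le> d \<longrightarrow> (\<integral>\<^sup>+z. ennreal (norm (f (z - v) - f z)) \<partial>lborel) \<le> ennreal e"
      using d(1) by (intro exI[of _ d]) auto
  qed
qed

lemma mollifier_D:
  assumes "mollifier d \<rho>"
  shows "smooth_supported d \<rho>" "0 \<le> \<rho> z" "d < norm z \<Longrightarrow> \<rho> z = 0"
    "integrable lborel \<rho>" "\<rho> \<in> borel_measurable borel"
  using assms smooth_supported_integrable[of d \<rho>] smooth_supported_measurable[of d \<rho>]
  by (auto simp: mollifier_def smooth_supported_def)

lemma mollifier_nn_integral:
  assumes "mollifier d \<rho>"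
  shows "(\<integral>\<^sup>+y. ennreal (\<rho> y) \<partial>lborel) = 1" "(\<integral>\<^sup>+y. ennreal (\<rho> (z - y)) \<partial>lborel) = 1"
proof -
  have [measurable]: "\<rho> \<in> borel_measurable borel" by (rule mollifier_D[OF assms])
  show "(\<integral>\<^sup>+y. ennreal (\<rho> y) \<partial>lborel) = 1"
    using nn_integral_eq_integral[OF mollifier_D(4)[OF assms]] mollifier_D(2)[OF assms] assms
    by (simp add: mollifier_def)
  then show "(\<integral>\<^sup>+y. ennreal (\<rho> (z - y)) \<partial>lborel) = 1"
    using nn_integral_lborel_reflect[of "\<lambda>y. ennreal (\<rho> y)" z] by simp
qed

lemma mollifier_reflect:
  assumes "mollifier d \<rho>"
  shows "integrable lborel (\<lambda>y. \<rho> (z - y))" "(LINT y|lborel. \<rho> (z - y)) = 1"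
proof -
  have [measurable]: "\<rho> \<in> borel_measurable borel" by (rule mollifier_D[OF assms])
  have "has_bochner_integral lborel (\<lambda>y. \<rho> (z - y)) 1"
    by (rule has_bochner_integral_nn_integral)
      (use mollifier_nn_integral(2)[OF assms] mollifier_D(2)[OF assms] in auto)
  then show "integrable lborel (\<lambda>y. \<rho> (z - y))" "(LINT y|lborel. \<rho> (z - y)) = 1"
    by (auto simp: has_bochner_integral_iff)
qed

lemma mollifier_integrable_scaleR:
  fixes f :: "'a::euclidean_space \<Rightarrow> 'b::euclidean_space"
  shows "mollifier d \<rho> \<Longrightarrow> integrable lborel f \<Longrightarrow> integrable lborel (\<lambda>y. \<rho> (z - y) *\<^sub>R f y)"
  using smooth_supported_integrable_scaleR mollifier_D(1) by blast

text \<open>A constant is its own average against a kernel of mass 1, so the difference to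
  \<open>c\<close> becomes an average of differences.\<close>

lemma convolve_diff_eq:
  fixes f :: "'a::euclidean_space \<Rightarrow> 'b::euclidean_space"
  assumes "mollifier d \<rho>" "integrable lborel f"
  shows "integrable lborel (\<lambda>y. \<rho> (z - y) *\<^sub>R (f y - c))"
    "convolve \<rho> f z - c = (LINT y|lborel. \<rho> (z - y) *\<^sub>R (f y - c))"
proof -
  have i: "integrable lborel (\<lambda>y. \<rho> (z - y) *\<^sub>R c)"
    by (intro integrable_scaleR_left mollifier_reflect[OF assms(1)])
  show "integrable lborel (\<lambda>y. \<rho> (z - y) *\<^sub>R (f y - c))"
    unfolding scaleR_diff_right
    by (rule Bochner_Integration.integrable_diff[OF mollifier_integrable_scaleR[OF assms] i])
  have "(LINT y|lborel. \<rho> (z - y) *\<^sub>R c) = c"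
    using mollifier_reflect[OF assms(1), of z] by simp
  then show "convolve \<rho> f z - c = (LINT y|lborel. \<rho> (z - y) *\<^sub>R (f y - c))"
    unfolding scaleR_diff_right convolve_def
    by (simp add: Bochner_Integration.integral_diff[OF mollifier_integrable_scaleR[OF assms] i])
qed

text \<open>Minkowski's inequality by way of Fubini: the L^1 error is at most the average, over
  \<open>norm v \<le> r\<close>, of the L^1 distances between \<open>f\<close> and its translates.
  The bound \<open>d\<close> on the radius does not depend on the kernel, so several functions can
  share one.\<close>

lemma convolve_L1_close:
  fixes f :: "'a::euclidean_space \<Rightarrow> 'b::euclidean_space"
  assumes f: "integrable lborel f" and "e > 0"
  shows "\<exists>d>0. \<forall>r \<rho>. r \<le> d \<longrightarrow> mollifier r \<rho> \<longrightarrow>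
    (\<integral>\<^sup>+z. ennreal (norm (convolve \<rho> f z - f z)) \<partial>lborel) \<le> ennreal e"
proof -
  obtain d where d: "d > 0"
    "\<And>v. norm v \<le> d \<Longrightarrow> (\<integral>\<^sup>+z. ennreal (norm (f (z - v) - f z)) \<partial>lborel) \<le> ennreal e"
    using L1_translation_continuous[OF f] \<open>e > 0\<close> by metis
  have "(\<integral>\<^sup>+z. ennreal (norm (convolve \<rho> f z - f z)) \<partial>lborel) \<le> ennreal e"
    if "r \<le> d" and \<rho>: "mollifier r \<rho>" for r \<rho>
  proof -
    have [measurable]: "\<rho> \<in> borel_measurable borel" by (rule mollifier_D[OF \<rho>])
    have [measurable]: "f \<in> borel_measurable borel" using f by auto
    have "(\<integral>\<^sup>+z. ennreal (norm (convolve \<rho> f z - f z)) \<partial>lborel) \<le>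
      (\<integral>\<^sup>+z. (\<integral>\<^sup>+v. ennreal (\<rho> v) * ennreal (norm (f (z - v) - f z)) \<partial>lborel) \<partial>lborel)"
    proof (intro nn_integral_mono)
      fix z
      have "ennreal (norm (convolve \<rho> f z - f z)) \<le> (\<integral>\<^sup>+y. ennreal (norm (\<rho> (z - y) *\<^sub>R (f y - f z))) \<partial>lborel)"
        unfolding convolve_diff_eq(2)[OF \<rho> f]
        by (rule integral_norm_bound_ennreal[OF convolve_diff_eq(1)[OF \<rho> f]])
      also have "\<dots> = (\<integral>\<^sup>+y. (\<lambda>v. ennreal (\<rho> v) * ennreal (norm (f (z - v) - f z))) (z - y) \<partial>lborel)"
        using mollifier_D(2)[OF \<rho>] by (intro nn_integral_cong) (simp add: ennreal_mult)
      also have "\<dots> = (\<integral>\<^sup>+v. ennreal (\<rho> v) * ennreal (norm (f (z - v) - f z)) \<partial>lborel)"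
        by (rule nn_integral_lborel_reflect) measurable
      finally show "ennreal (norm (convolve \<rho> f z - f z)) \<le>
        (\<integral>\<^sup>+v. ennreal (\<rho> v) * ennreal (norm (f (z - v) - f z)) \<partial>lborel)" .
    qed
    also have "\<dots> = (\<integral>\<^sup>+v. (\<integral>\<^sup>+z. ennreal (\<rho> v) * ennreal (norm (f (z - v) - f z)) \<partial>lborel) \<partial>lborel)"
      by (rule lborel_pair.Fubini'[symmetric]) measurable
    also have "\<dots> = (\<integral>\<^sup>+v. ennreal (\<rho> v) * (\<integral>\<^sup>+z. ennreal (norm (f (z - v) - f z)) \<partial>lborel) \<partial>lborel)"
      by (intro nn_integral_cong nn_integral_cmult) measurable
    also have "\<dots> \<le> (\<integral>\<^sup>+v. ennreal (\<rho> v) * ennreal e \<partial>lborel)"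
    proof (intro nn_integral_mono)
      fix v show "ennreal (\<rho> v) * (\<integral>\<^sup>+z. ennreal (norm (f (z - v) - f z)) \<partial>lborel) \<le> ennreal (\<rho> v) * ennreal e"
        using mollifier_D(3)[OF \<rho>, of v] d(2)[of v] \<open>r \<le> d\<close>
        by (cases "r < norm v") (auto intro: mult_left_mono)
    qed
    also have "\<dots> = ennreal e"
      using mollifier_nn_integral(1)[OF \<rho>] by (simp add: nn_integral_multc)
    finally show ?thesis .
  qed
  then show ?thesis using d(1) by (intro exI[of _ d]) auto
qed

text \<open>An average over points within \<open>r\<close> of \<open>z\<close> inherits any bound
  valid at all of them. The case \<open>e = 0\<close> will give exact values of cutoffs, and
  \<open>c = e = 1 / 2\<close> their range.\<close>

lemma convolve_close_pointwise:
  fixes f :: "'a::euclidean_space \<Rightarrow> 'b::euclidean_space"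
  assumes \<rho>: "mollifier r \<rho>" and f: "integrable lborel f"
    and close: "\<And>y. norm (z - y) \<le> r \<Longrightarrow> norm (f y - c) \<le> e"
  shows "norm (convolve \<rho> f z - c) \<le> e"
proof -
  have "norm (convolve \<rho> f z - c) \<le> (LINT y|lborel. norm (\<rho> (z - y) *\<^sub>R (f y - c)))"
    unfolding convolve_diff_eq(2)[OF \<rho> f] by (rule integral_norm_bound)
  also have "\<dots> \<le> (LINT y|lborel. \<rho> (z - y) * e)"
  proof (rule integral_mono)
    show "integrable lborel (\<lambda>y. norm (\<rho> (z - y) *\<^sub>R (f y - c)))"
      by (rule integrable_norm[OF convolve_diff_eq(1)[OF \<rho> f]])
    show "integrable lborel (\<lambda>y. \<rho> (z - y) * e)"
      by (intro integrable_mult_left mollifier_reflect[OF \<rho>])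
    show "norm (\<rho> (z - y) *\<^sub>R (f y - c)) \<le> \<rho> (z - y) * e" for y
      using close[of y] mollifier_D(2,3)[OF \<rho>, of "z - y"]
      by (cases "r < norm (z - y)") (auto intro: mult_left_mono)
  qed
  also have "\<dots> = e" using mollifier_reflect[OF \<rho>] by simp
  finally show ?thesis .
qed

subsection \<open>Partitions of unity\<close>

text \<open>Mollification at scale \<open>d / 3\<close> of the indicator of the
  \<open>d / 3\<close>-neighbourhood of \<open>K\<close>, where \<open>d\<close> separates
  \<open>K\<close> from the complement of \<open>V\<close>: the total spread
  \<open>2 * d / 3\<close> stays below \<open>d\<close>.\<close>

lemma smooth_cutoff:
  fixes K :: "'a::euclidean_space set"
  assumes "compact K" "open V" "K \<subseteq> V"
  obtains \<eta> :: "'a \<Rightarrow> real" where "smooth_on \<eta> UNIV" "\<And>z. 0 \<le> \<eta> z" "\<And>z. \<eta> z \<le> 1"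
    "\<And>z. z \<in> K \<Longrightarrow> \<eta> z = 1" "\<And>z. z \<notin> V \<Longrightarrow> \<eta> z = 0"
proof -
  obtain d where d: "d > 0" "\<And>x y. x \<in> K \<Longrightarrow> y \<notin> V \<Longrightarrow> d \<le> dist x y"
    using separate_compact_closed[of K "- V"] assms by (auto simp: closed_Compl) blast
  define A where "A = {x + y |x y. x \<in> K \<and> y \<in> cball 0 (d / 3)}"
  have "compact A" unfolding A_def by (intro compact_sums assms compact_cball)
  obtain \<rho> :: "'a \<Rightarrow> real" where \<rho>: "mollifier (d / 3) \<rho>" using mollifier_exists[of "d / 3"] d(1) by auto
  define \<eta> where "\<eta> = convolve \<rho> (indicator A :: 'a \<Rightarrow> real)"
  have A: "integrable lborel (indicator A :: 'a \<Rightarrow> real)"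
    using \<open>compact A\<close> emeasure_compact_finite[OF \<open>compact A\<close>] borel_compact[OF \<open>compact A\<close>]
    by (simp add: less_top[symmetric])
  note close = convolve_close_pointwise[OF \<rho> A, folded \<eta>_def]
  show thesis
  proof
    show "smooth_on \<eta> UNIV"
      unfolding \<eta>_def by (rule smooth_on_convolve[OF mollifier_D(1)[OF \<rho>] A])
    have "norm (\<eta> z - 1 / 2) \<le> 1 / 2" for z by (rule close) (auto simp: indicator_def)
    then have "\<bar>\<eta> z - 1 / 2\<bar> \<le> 1 / 2" for z by (simp only: real_norm_def)
    then show "0 \<le> \<eta> z" "\<eta> z \<le> 1" for z by (smt (verit) field_sum_of_halves)+
    show "\<eta> z = 1" if "z \<in> K" for z
    proof -
      have "y \<in> A" if "norm (z - y) \<le> d / 3" for y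
      proof -
        have "y = z + (y - z) \<and> z \<in> K \<and> y - z \<in> cball 0 (d / 3)"
          using \<open>z \<in> K\<close> that by (simp add: norm_minus_commute)
        then show ?thesis unfolding A_def by blast
      qed
      then have "norm (\<eta> z - 1) \<le> 0" by (intro close) simp
      then show ?thesis by simp
    qed
    show "\<eta> z = 0" if "z \<notin> V" for z
    proof -
      have "y \<notin> A" if y: "norm (z - y) \<le> d / 3" for y
      proof
        assume "y \<in> A"
        then obtain x v where x: "y = x + v" "x \<in> K" "norm v \<le> d / 3" by (auto simp: A_def)
        have "d \<le> norm (x - z)" using d(2)[OF x(2) \<open>z \<notin> V\<close>] by (simp add: dist_norm)
        also have "\<dots> = norm (- v - (z - y))" by (simp add: x(1))
        also have "\<dots> \<le> norm v + norm (z - y)" using norm_triangle_ineq4[of "- v" "z - y"] by simp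
        finally show False using x(3) y d(1) by simp
      qed
      then have "norm (\<eta> z - 0) \<le> 0" by (intro close) simp
      then show ?thesis by simp
    qed
  qed
qed

text \<open>Telescoping: the functions are differences of successive cutoffs, equal to 1 on
  \<open>D n\<close> and to 0 off \<open>D (Suc n)\<close>, so the partial sums are the cutoffs
  themselves. On \<open>D n\<close> the terms up to index \<open>n\<close> already sum to 1 and all
  later ones vanish, which makes every series over the partition finite there.\<close>

lemma smooth_partition_of_unity:
  fixes U :: "'a::euclidean_space set"
  assumes "open U"
  obtains D :: "nat \<Rightarrow> 'a set" and \<zeta> :: "nat \<Rightarrow> 'a \<Rightarrow> real" where
    "\<And>n. compact (D n)" "\<And>n. D n \<subseteq> U" "\<And>n. D n \<subseteq> interior (D (Suc n))" "(\<Union>n. D n) = U"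
    "\<And>n. smooth_on (\<zeta> n) UNIV" "\<And>n z. 0 \<le> \<zeta> n z" "\<And>n z. z \<notin> D (Suc n) \<Longrightarrow> \<zeta> n z = 0"
    "\<And>n j z. z \<in> D n \<Longrightarrow> n < j \<Longrightarrow> \<zeta> j z = 0" "\<And>n z. z \<in> D n \<Longrightarrow> (\<Sum>i\<le>n. \<zeta> i z) = 1"
proof -
  obtain D where D: "\<And>n. compact (D n)" "\<And>n. D n \<subseteq> U" "\<And>n. D n \<subseteq> interior (D (Suc n))" "\<Union>(range D) = U"
    using open_Union_compact_subsets[OF assms] by metis
  have mono: "D m \<subseteq> D n" if "m \<le> n" for m n
    by (rule lift_Suc_mono_le[OF _ that]) (use D(3) interior_subset in blast)
  have "\<exists>\<eta>::'a \<Rightarrow> real. smooth_on \<eta> UNIV \<and> (\<forall>z. 0 \<le> \<eta> z \<and> \<eta> z \<le> 1 \<and> (z \<in> D n \<longrightarrow> \<eta> z = 1) \<and> (z \<notin> D (Suc n) \<longrightarrow> \<eta> z = 0))" for n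
    by (rule smooth_cutoff[OF D(1) open_interior D(3), of n]) (meson interior_subset subset_iff)
  then obtain \<eta> :: "nat \<Rightarrow> 'a \<Rightarrow> real" where \<eta>: "\<And>n. smooth_on (\<eta> n) UNIV"
    "\<And>n z. 0 \<le> \<eta> n z" "\<And>n z. \<eta> n z \<le> 1" "\<And>n z. z \<in> D n \<Longrightarrow> \<eta> n z = 1" "\<And>n z. z \<notin> D (Suc n) \<Longrightarrow> \<eta> n z = 0"
    by metis
  define \<zeta> where "\<zeta> n z = \<eta> n z - (if n = 0 then 0 else \<eta> (n - 1) z)" for n z
  have sum: "(\<Sum>i\<le>n. \<zeta> i z) = \<eta> n z" for n z
    by (induction n) (auto simp: \<zeta>_def)
  show thesis
  proof
    show "smooth_on (\<zeta> n) UNIV" for n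
    proof -
      have "times_differentiable_on k (\<lambda>z. \<eta> n z + (if n = 0 then 0 else - 1) *\<^sub>R \<eta> (n - 1) z) UNIV" for k
        using \<eta>(1) by (intro times_differentiable_on_add times_differentiable_on_scaleR
            times_differentiable_on_const open_UNIV) (auto simp: smooth_on_def)
      moreover have "(\<lambda>z. \<eta> n z + (if n = 0 then 0 else - 1) *\<^sub>R \<eta> (n - 1) z) = \<zeta> n"
        by (auto simp: \<zeta>_def)
      ultimately show ?thesis by (simp add: smooth_on_def)
    qed
    show "0 \<le> \<zeta> n z" for n z
    proof (cases n)
      case (Suc m)
      \<comment> \<open>On \<open>D n\<close> the minuend is 1; off \<open>D n\<close>, with
        \<open>n = Suc m\<close>, the subtrahend is 0.\<close>
      then show ?thesis using \<eta>(3)[of m z] \<eta>(2)[of n z] \<eta>(4)[of z n] \<eta>(5)[of z m]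
        by (cases "z \<in> D n") (auto simp: \<zeta>_def)
    qed (use \<eta>(2) in \<open>auto simp: \<zeta>_def\<close>)
    show "\<zeta> n z = 0" if "z \<notin> D (Suc n)" for n z
      using that \<eta>(5)[of z n] \<eta>(5)[of z "n - 1"] mono[of n "Suc n"] by (cases n) (auto simp: \<zeta>_def)
    show "\<zeta> j z = 0" if "z \<in> D n" "n < j" for n j z
    proof (cases j)
      case (Suc m)
      then have "z \<in> D j" "z \<in> D m" using that mono[of n j] mono[of n m] by auto
      then show ?thesis using \<eta>(4) Suc by (simp add: \<zeta>_def)
    qed (use that in simp)
    show "(\<Sum>i\<le>n. \<zeta> i z) = 1" if "z \<in> D n" for n z
      using \<eta>(4)[OF that] sum by simp
  qed (use D in auto)
qed

subsection \<open>Local mollification\<close>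

text \<open>One kernel must serve all three functions: the derivative of the smoothed
  \<open>b\<close> is to be the smoothed \<open>G\<close>, and Jensen compares averages of
  \<open>G\<close> and \<open>\<Phi>\<close>. So the radius is the least of four thresholds.\<close>

lemma local_mollification:
  fixes b :: "'a::euclidean_space \<Rightarrow> 'b::euclidean_space" and G :: "'a \<Rightarrow> 'c::euclidean_space"
    and \<Phi> :: "'a \<Rightarrow> real"
  assumes K: "compact K" "K \<subseteq> interior L" and L: "compact L" "continuous_on L b"
    and G: "integrable lborel (\<lambda>z. indicator L z *\<^sub>R G z)"
    and \<Phi>: "integrable lborel (\<lambda>z. indicator L z *\<^sub>R \<Phi> z)" and e: "e > 0"
  shows "\<exists>r \<rho>. mollifier r \<rho> \<and> (\<forall>z\<in>K. cball z r \<subseteq> L) \<and>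
    (\<forall>z\<in>K. norm (convolve \<rho> (\<lambda>y. indicator L y *\<^sub>R b y) z - b z) \<le> e) \<and>
    (\<integral>\<^sup>+z. ennreal (norm (convolve \<rho> (\<lambda>y. indicator L y *\<^sub>R G y) z - indicator L z *\<^sub>R G z)) \<partial>lborel) \<le> ennreal e \<and>
    (\<integral>\<^sup>+z. ennreal (norm (convolve \<rho> (\<lambda>y. indicator L y *\<^sub>R \<Phi> y) z - indicator L z *\<^sub>R \<Phi> z)) \<partial>lborel) \<le> ennreal e"
proof -
  obtain d0 where d0: "d0 > 0" "\<And>x y. x \<in> K \<Longrightarrow> y \<notin> interior L \<Longrightarrow> d0 \<le> dist x y"
    using separate_compact_closed[of K "- interior L"] K by (auto simp: closed_Compl) blast
  obtain d1 where d1: "d1 > 0" "\<And>x y. x \<in> L \<Longrightarrow> y \<in> L \<Longrightarrow> dist y x < d1 \<Longrightarrow> dist (b y) (b x) < e"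
    using compact_uniformly_continuous[OF L(2,1)] e unfolding uniformly_continuous_on_def by metis
  obtain d2 where d2: "d2 > 0" "\<And>r \<rho>. r \<le> d2 \<Longrightarrow> mollifier r \<rho> \<Longrightarrow>
      (\<integral>\<^sup>+z. ennreal (norm (convolve \<rho> (\<lambda>y. indicator L y *\<^sub>R G y) z - indicator L z *\<^sub>R G z)) \<partial>lborel) \<le> ennreal e"
    using convolve_L1_close[OF G e] by auto
  obtain d3 where d3: "d3 > 0" "\<And>r \<rho>. r \<le> d3 \<Longrightarrow> mollifier r \<rho> \<Longrightarrow>
      (\<integral>\<^sup>+z. ennreal (norm (convolve \<rho> (\<lambda>y. indicator L y *\<^sub>R \<Phi> y) z - indicator L z *\<^sub>R \<Phi> z)) \<partial>lborel) \<le> ennreal e"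
    using convolve_L1_close[OF \<Phi> e] by auto
  \<comment> \<open>Halving \<open>d0\<close> and \<open>d1\<close> yields strict inequalities; at
    \<open>d2\<close> and \<open>d3\<close> equality is allowed.\<close>
  define r where "r = min (min (d0 / 2) (d1 / 2)) (min d2 d3)"
  have r: "r > 0" "r < d0" "r < d1" "r \<le> d2" "r \<le> d3"
    using d0(1) d1(1) d2(1) d3(1) by (auto simp: r_def)
  obtain \<rho> :: "'a \<Rightarrow> real" where \<rho>: "mollifier r \<rho>" using mollifier_exists[OF r(1)] by auto
  have b: "integrable lborel (\<lambda>y. indicator L y *\<^sub>R b y)"
    by (rule borel_integrable_compact[OF L])
  have ball: "cball z r \<subseteq> L" if "z \<in> K" for z
  proof
    fix y assume "y \<in> cball z r"
    then have "\<not> d0 \<le> dist z y" using r(2) by auto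
    then show "y \<in> L" using d0(2)[OF that] interior_subset by blast
  qed
  have "norm (convolve \<rho> (\<lambda>y. indicator L y *\<^sub>R b y) z - b z) \<le> e" if "z \<in> K" for z
  proof (rule convolve_close_pointwise[OF \<rho> b])
    fix y assume y: "norm (z - y) \<le> r"
    then have "y \<in> L" "z \<in> L" using ball[OF that] r(1) by (auto simp: subset_iff dist_norm)
    moreover have "dist y z < d1" using y r(3) by (simp add: dist_norm norm_minus_commute)
    ultimately show "norm (indicator L y *\<^sub>R b y - b z) \<le> e"
      using d1(2)[of z y] by (simp add: dist_norm)
  qed
  then show ?thesis using \<rho> ball d2(2)[OF r(4) \<rho>] d3(2)[OF r(5) \<rho>] by blast
qed

text \<open>A slice is the composition with an affine embedding, so its derivative is the joint
  derivative restricted to directions \<open>(0, v)\<close>.\<close>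

lemma space_deriv_eq:
  fixes B :: "real \<times> (real^'n) \<Rightarrow> real^'m"
  assumes "(B has_derivative B') (at z)"
  shows "space_deriv B z = (\<chi> k j. B' (0, axis j 1) $ k)"
proof -
  obtain t x where z: "z = (t, x)" by (cases z)
  have "((\<lambda>y. (t, y)) has_derivative (\<lambda>v. (0, v))) (at x)"
    by (auto intro!: derivative_eq_intros)
  from has_derivative_compose[OF this, of B B'] assms
  have "((\<lambda>y. B (t, y)) has_derivative (\<lambda>v. B' (0, v))) (at x)" by (simp add: z)
  then have "frechet_derivative (\<lambda>y. B (t, y)) (at x) = (\<lambda>v. B' (0, v))"
    using frechet_derivative_at by metis
  then show ?thesis by (simp add: z space_deriv_def jacobian_def matrix_def)
qed

text \<open>Testing in space-time instead of on almost every slice makes convolution in \<open>(t, x)\<close> commute with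
  the spatial derivative.\<close>

definition weak_space_deriv ::
    "(real \<times> (real^'n)) set \<Rightarrow> (real \<times> (real^'n) \<Rightarrow> real^'m) \<Rightarrow> (real \<times> (real^'n) \<Rightarrow> real^'n^'m) \<Rightarrow> bool" where
  "weak_space_deriv U b G \<longleftrightarrow> (\<forall>\<Psi> C k j. smooth_on \<Psi> UNIV \<longrightarrow> compact C \<longrightarrow> C \<subseteq> U \<longrightarrow>
     (\<forall>z. z \<notin> C \<longrightarrow> \<Psi> z = 0) \<longrightarrow>
     (LINT z|lborel. frechet_derivative \<Psi> (at z) (0, axis j 1) * b z $ k) = - (LINT z|lborel. \<Psi> z * G z $ k $ j))"

lemma integral_vec_nth:
  fixes f :: "'a \<Rightarrow> 'b::euclidean_space ^ 'k"
  assumes "integrable M f"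
  shows "(LINT y|M. f y) $ k = (LINT y|M. f y $ k)"
  using integral_bounded_linear[OF bounded_linear_vec_nth assms, of k] by simp

text \<open>The reflected kernel \<open>y \<mapsto> \<rho> (z - y)\<close> is an admissible test
  function, since it vanishes off the ball around \<open>z\<close>, which lies in \<open>U\<close>.
  The sign from the reflection cancels the sign from integration by parts.\<close>

lemma frechet_derivative_convolve_weak:
  fixes b :: "real \<times> (real^'n) \<Rightarrow> real^'m" and G :: "real \<times> (real^'n) \<Rightarrow> real^'n^'m"
  assumes weak: "weak_space_deriv U b G" and \<rho>: "mollifier r \<rho>" and L: "cball z r \<subseteq> L" "L \<subseteq> U"
    and b: "integrable lborel (\<lambda>y. indicator L y *\<^sub>R b y)"
    and G: "integrable lborel (\<lambda>y. indicator L y *\<^sub>R G y)"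
  shows "frechet_derivative (convolve \<rho> (\<lambda>y. indicator L y *\<^sub>R b y)) (at z) (0, axis j 1) $ k
    = convolve \<rho> (\<lambda>y. indicator L y *\<^sub>R G y) z $ k $ j"
proof -
  let ?e = "(0, axis j 1) :: real \<times> (real^'n)"
  let ?D = "\<lambda>z. frechet_derivative \<rho> (at z)"
  define \<Psi> where "\<Psi> y = \<rho> (z - y)" for y
  have sm: "smooth_on \<rho> UNIV" using mollifier_D(1)[OF \<rho>] by (simp add: smooth_supported_def)
  have "times_differentiable_on n (\<lambda>y. \<rho> (z + (- y))) UNIV" for n
    by (rule times_differentiable_on_affine) (use sm in \<open>auto simp: smooth_on_def intro: bounded_linear_minus bounded_linear_ident\<close>)
  then have 1: "smooth_on \<Psi> UNIV" by (simp add: smooth_on_def \<Psi>_def[abs_def])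
  have "(\<Psi> has_derivative (\<lambda>v. ?D (z - y) (- v))) (at y)" for y
    unfolding \<Psi>_def
    by (rule has_derivative_compose[OF _ smooth_on_has_derivative[OF sm]]) (auto intro!: derivative_eq_intros)
  moreover have "?D (z - y) (- v) = - ?D (z - y) v" for y v
    using linear_neg[OF has_derivative_linear[OF smooth_on_has_derivative[OF sm]]] by simp
  ultimately have 2: "frechet_derivative \<Psi> (at y) v = - ?D (z - y) v" for y v
    using frechet_derivative_at by metis
  have 3: "\<Psi> y = 0" if "y \<notin> cball z r" for y
    using that mollifier_D(3)[OF \<rho>, of "z - y"] by (auto simp: \<Psi>_def dist_norm)
  note D = smooth_supported_derivative[OF mollifier_D(1)[OF \<rho>], of ?e]
  have 4: "?D (z - y) ?e = 0" if "y \<notin> cball z r" for y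
    using that conjunct2[OF D[unfolded smooth_supported_def], rule_format, of "z - y"]
    by (simp add: dist_norm)
  have Psi_off: "\<Psi> y = 0" if "y \<notin> L" for y
    by (rule 3) (use that L(1) in blast)
  have D_off: "?D (z - y) ?e = 0" if "y \<notin> L" for y
    by (rule 4) (use that L(1) in blast)
  have eq: "(LINT y|lborel. frechet_derivative \<Psi> (at y) ?e * b y $ k) = - (LINT y|lborel. \<Psi> y * G y $ k $ j)"
    using weak 1 3 L unfolding weak_space_deriv_def 
    by (meson compact_cball order_trans[OF L(1) L(2)])
  have "frechet_derivative (convolve \<rho> (\<lambda>y. indicator L y *\<^sub>R b y)) (at z) ?e $ k
    = (LINT y|lborel. (?D (z - y) ?e *\<^sub>R indicator L y *\<^sub>R b y) $ k)"
    unfolding frechet_derivative_convolve[OF mollifier_D(1)[OF \<rho>] b] convolve_def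
    by (rule integral_vec_nth[OF smooth_supported_integrable_scaleR[OF D b]])
  also have "\<dots> = (LINT y|lborel. - (frechet_derivative \<Psi> (at y) ?e * b y $ k))"
    using D_off by (intro Bochner_Integration.integral_cong) (auto simp: 2 indicator_def)
  also have "\<dots> = (LINT y|lborel. \<Psi> y * G y $ k $ j)" using eq by simp
  also have "\<dots> = (LINT y|lborel. (\<rho> (z - y) *\<^sub>R indicator L y *\<^sub>R G y) $ k $ j)"
    using Psi_off by (intro Bochner_Integration.integral_cong) (auto simp: \<Psi>_def indicator_def)
  also have "\<dots> = convolve \<rho> (\<lambda>y. indicator L y *\<^sub>R G y) z $ k $ j"
  proof -
    note i = mollifier_integrable_scaleR[OF \<rho> G]
    show ?thesis unfolding convolve_def integral_vec_nth[OF i]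
      by (rule integral_vec_nth[symmetric]) (rule integrable_bounded_linear[OF bounded_linear_vec_nth i])
  qed
  finally show ?thesis .
qed

subsection \<open>Gluing local mollifications\<close>

text \<open>Bookkeeping for all later error estimates: piece \<open>i\<close> may cost
  \<open>e / 2 ^ Suc i\<close>, and these shares add up to \<open>e\<close>.\<close>

lemma nn_integral_suminf_geometric:
  fixes F :: "nat \<Rightarrow> 'a \<Rightarrow> ennreal"
  assumes [measurable]: "\<And>i. F i \<in> borel_measurable M" and "e \<ge> 0"
    and le: "\<And>i. (\<integral>\<^sup>+z. F i z \<partial>M) \<le> ennreal (e * (1/2) ^ Suc i)"
  shows "(\<integral>\<^sup>+z. (\<Sum>i. F i z) \<partial>M) \<le> ennreal e"
proof -
  have s: "(\<lambda>i. e * (1/2) ^ Suc i) sums e" using sums_mult[OF power_half_series, of e] by simp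
  have "(\<integral>\<^sup>+z. (\<Sum>i. F i z) \<partial>M) = (\<Sum>i. \<integral>\<^sup>+z. F i z \<partial>M)" by (rule nn_integral_suminf) measurable
  also have "\<dots> \<le> (\<Sum>i. ennreal (e * (1/2) ^ Suc i))" by (intro suminf_le le) auto
  also have "\<dots> = ennreal e"
    using s \<open>e \<ge> 0\<close> by (subst suminf_ennreal2) (auto simp: sums_iff)
  finally show ?thesis .
qed

text \<open>Jensen's inequality in affine form, obtained by integrating a supporting line against a
  probability density. The coefficients \<open>p\<close> and \<open>a\<close> can be shared by all
  kernels of a partition, so the inequalities add up to Jensen for the combined density.\<close>

lemma convolve_supporting_line:
  fixes g \<Phi> :: "'a::euclidean_space \<Rightarrow> real"
  assumes \<rho>: "mollifier r \<rho>" and L: "cball z r \<subseteq> L"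
    and g: "integrable lborel (\<lambda>y. indicator L y *\<^sub>R g y)"
    and \<Phi>: "integrable lborel (\<lambda>y. indicator L y *\<^sub>R \<Phi> y)"
    and line: "\<And>y. p + a * g y \<le> \<Phi> y"
  shows "p + a * convolve \<rho> (\<lambda>y. indicator L y *\<^sub>R g y) z \<le> convolve \<rho> (\<lambda>y. indicator L y *\<^sub>R \<Phi> y) z"
proof -
  note i = mollifier_integrable_scaleR[OF \<rho> g, of z]
  have i1: "integrable lborel (\<lambda>y. \<rho> (z - y) * p)"
    by (intro integrable_mult_left mollifier_reflect[OF \<rho>])
  have i2: "integrable lborel (\<lambda>y. a * (\<rho> (z - y) *\<^sub>R indicator L y *\<^sub>R g y))"
    by (rule integrable_mult_right[OF i])
  have "p + a * convolve \<rho> (\<lambda>y. indicator L y *\<^sub>R g y) z =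
      (LINT y|lborel. \<rho> (z - y) * p + a * (\<rho> (z - y) *\<^sub>R indicator L y *\<^sub>R g y))"
    unfolding convolve_def Bochner_Integration.integral_add[OF i1 i2]
    using mollifier_reflect[OF \<rho>, of z] by simp
  also have "\<dots> \<le> convolve \<rho> (\<lambda>y. indicator L y *\<^sub>R \<Phi> y) z"
    unfolding convolve_def
  proof (rule integral_mono[OF Bochner_Integration.integrable_add[OF i1 i2] mollifier_integrable_scaleR[OF \<rho> \<Phi>]])
    fix y
    show "\<rho> (z - y) * p + a * (\<rho> (z - y) *\<^sub>R indicator L y *\<^sub>R g y) \<le> \<rho> (z - y) *\<^sub>R indicator L y *\<^sub>R \<Phi> y"
    \<comment> \<open>Where the indicators vanish the kernel vanishes too, so the constant
      \<open>p\<close>, which carries no indicator, does no harm.\<close>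
    proof (cases "y \<in> L")
      case True
      then show ?thesis
        using mult_left_mono[OF line[of y] mollifier_D(2)[OF \<rho>, of "z - y"]] by (simp add: algebra_simps)
    next
      case False
      then have "\<not> norm (z - y) \<le> r" using L by (auto simp: subset_iff dist_norm)
      then have "r < norm (z - y)" by simp
      then show ?thesis using mollifier_D(3)[OF \<rho>] by simp
    qed
  qed
  finally show ?thesis .
qed

lemma norm_matrix_le:
  fixes A :: "real^'n^'m"
  assumes "\<And>k j. \<bar>A $ k $ j\<bar> \<le> c"
  shows "norm A \<le> real CARD('m) * real CARD('n) * c"
proof -
  have "norm A \<le> (\<Sum>k\<in>UNIV. norm (A $ k))" unfolding norm_vec_def by (intro L2_set_le_sum) auto
  also have "\<dots> \<le> (\<Sum>k\<in>(UNIV::'m set). \<Sum>j\<in>(UNIV::'n set). c)"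
    by (intro sum_mono order_trans[OF norm_le_l1_cart] assms)
  finally show ?thesis by simp
qed

text \<open>The cutoffs sum to 1 near \<open>z\<close>, so their derivatives sum to 0. Hence
  \<open>b z\<close> can be subtracted from every \<open>u i z\<close> in the part of the product
  rule that differentiates cutoffs, and this part is as small as \<open>u i z - b z\<close>; no
  derivative of \<open>b\<close> appears in it.\<close>

lemma glued_derivative:
  fixes B b :: "real \<times> (real^'n) \<Rightarrow> real^'m" and H :: "nat \<Rightarrow> real \<times> (real^'n) \<Rightarrow> real^'n^'m"
  assumes S: "open S" "z \<in> S"
    and B: "\<And>y. y \<in> S \<Longrightarrow> B y = (\<Sum>i\<le>n. \<zeta> i y *\<^sub>R u i y)"
    and one: "\<And>y. y \<in> S \<Longrightarrow> (\<Sum>i\<le>n. \<zeta> i y) = (1::real)"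
    and \<zeta>: "\<And>i. smooth_on (\<zeta> i) UNIV" and u: "\<And>i. smooth_on (u i) UNIV"
    and H: "\<And>i k j. \<zeta> i z \<noteq> 0 \<Longrightarrow> frechet_derivative (u i) (at z) (0, axis j 1) $ k = H i z $ k $ j"
    and R: "\<And>i j k. \<bar>frechet_derivative (\<zeta> i) (at z) (0, axis j 1) * (u i z - b z) $ k\<bar> \<le> m i"
  shows "norm (space_deriv B z - (\<Sum>i\<le>n. \<zeta> i z *\<^sub>R H i z)) \<le> (\<Sum>i\<le>n. real CARD('m) * real CARD('n) * m i)"
proof -
  let ?d\<zeta> = "\<lambda>i. frechet_derivative (\<zeta> i) (at z)" and ?du = "\<lambda>i. frechet_derivative (u i) (at z)"
  have d\<zeta>: "(\<zeta> i has_derivative ?d\<zeta> i) (at z)" for i by (rule smooth_on_has_derivative[OF \<zeta>]) simp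
  have du: "(u i has_derivative ?du i) (at z)" for i by (rule smooth_on_has_derivative[OF u]) simp
  have "((\<lambda>y. \<Sum>i\<le>n. \<zeta> i y *\<^sub>R u i y) has_derivative (\<lambda>v. \<Sum>i\<le>n. \<zeta> i z *\<^sub>R ?du i v + ?d\<zeta> i v *\<^sub>R u i z)) (at z)"
    by (intro has_derivative_sum has_derivative_scaleR d\<zeta> du)
  then have "(B has_derivative (\<lambda>v. \<Sum>i\<le>n. \<zeta> i z *\<^sub>R ?du i v + ?d\<zeta> i v *\<^sub>R u i z)) (at z)"
    by (rule has_derivative_transform_within_open[OF _ S]) (simp add: B)
  note sd = space_deriv_eq[OF this]
  have "((\<lambda>y. \<Sum>i\<le>n. \<zeta> i y) has_derivative (\<lambda>v. \<Sum>i\<le>n. ?d\<zeta> i v)) (at z)"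
    by (intro has_derivative_sum d\<zeta>)
  then have "((\<lambda>y. 1) has_derivative (\<lambda>v. \<Sum>i\<le>n. ?d\<zeta> i v)) (at z)"
    by (rule has_derivative_transform_within_open[OF _ S]) (simp add: one)
  then have "(\<lambda>v. \<Sum>i\<le>n. ?d\<zeta> i v) = (\<lambda>v. 0)"
    by (rule has_derivative_unique[OF _ has_derivative_const])
  then have zero: "(\<Sum>i\<le>n. ?d\<zeta> i v) = 0" for v by (rule fun_cong)
  define R where "R i = (\<chi> k j. ?d\<zeta> i (0, axis j 1) * (u i z - b z) $ k)" for i
  have "space_deriv B z - (\<Sum>i\<le>n. \<zeta> i z *\<^sub>R H i z) = (\<Sum>i\<le>n. R i)"
  proof (simp add: vec_eq_iff sd R_def, intro allI)
    fix k j
    have "(\<Sum>i\<le>n. ?d\<zeta> i (0, axis j 1) * (u i z $ k - b z $ k)) =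
        (\<Sum>i\<le>n. ?d\<zeta> i (0, axis j 1) * u i z $ k) - (\<Sum>i\<le>n. ?d\<zeta> i (0, axis j 1)) * b z $ k"
      by (simp add: right_diff_distrib sum_subtractf sum_distrib_right)
    moreover have "(\<Sum>i\<le>n. \<zeta> i z * ?du i (0, axis j 1) $ k) = (\<Sum>i\<le>n. \<zeta> i z * H i z $ k $ j)"
    proof (intro sum.cong refl)
      \<comment> \<open>The formula for the derivative of \<open>u i\<close> is available only where
        \<open>\<zeta> i z\<close> is nonzero; elsewhere the factor annihilates both sides.\<close>
      fix i show "\<zeta> i z * ?du i (0, axis j 1) $ k = \<zeta> i z * H i z $ k $ j"
        by (cases "\<zeta> i z = 0") (simp_all add: H)
    qed
    ultimately show "(\<Sum>i\<le>n. \<zeta> i z * ?du i (0, axis j 1) $ k + ?d\<zeta> i (0, axis j 1) * u i z $ k) -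
        (\<Sum>i\<le>n. \<zeta> i z * H i z $ k $ j) = (\<Sum>i\<le>n. ?d\<zeta> i (0, axis j 1) * (u i z $ k - b z $ k))"
      by (simp add: zero sum.distrib)
  qed
  moreover have "norm (\<Sum>i\<le>n. R i) \<le> (\<Sum>i\<le>n. real CARD('m) * real CARD('n) * m i)"
    by (intro sum_norm_le norm_matrix_le) (simp only: R_def vec_lambda_beta R)
  ultimately show ?thesis by simp
qed

text \<open>The complement of the compact set \<open>K\<close> is open, so the derivative vanishes
  there as well. The indicator records this: errors produced by differentiating the cutoff then cost
  no more than the measure of \<open>K\<close>.\<close>

lemma bounded_space_derivative:
  fixes \<zeta> :: "real \<times> (real^'n) \<Rightarrow> real"
  assumes "smooth_on \<zeta> UNIV" "compact K" "\<And>z. z \<notin> K \<Longrightarrow> \<zeta> z = 0"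
  shows "\<exists>M\<ge>0. \<forall>z j. \<bar>frechet_derivative \<zeta> (at z) (0, axis j 1)\<bar> \<le> M * indicator K z"
proof -
  obtain d where "\<And>z. z \<in> K \<Longrightarrow> norm z \<le> d"
    using compact_imp_bounded[OF assms(2)] unfolding bounded_iff by auto
  then have "smooth_supported d \<zeta>" using assms unfolding smooth_supported_def by (meson not_le)
  from smooth_supported_bounded[OF smooth_supported_derivative[OF this]]
  have "\<forall>j. \<exists>M\<ge>0. \<forall>z. \<bar>frechet_derivative \<zeta> (at z) (0, axis j 1)\<bar> \<le> M" by blast
  then obtain M where M: "\<And>j. M j \<ge> 0" "\<And>j z. \<bar>frechet_derivative \<zeta> (at z) (0, axis j 1)\<bar> \<le> M j"
    by metis
  have le: "M j \<le> (\<Sum>j\<in>UNIV. M j)" for j by (rule member_le_sum) (use M in auto)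
  have zero: "frechet_derivative \<zeta> (at z) v = 0" if "z \<notin> K" for z v
  proof -
    have "(\<zeta> has_derivative (\<lambda>v. 0)) (at z)"
      using has_derivative_transform_within_open[of "\<lambda>z. 0" "\<lambda>v. 0" z UNIV "- K" \<zeta>] assms(3) that
        open_Compl[OF compact_imp_closed[OF assms(2)]] by simp
    then show ?thesis by (metis frechet_derivative_at)
  qed
  have "\<bar>frechet_derivative \<zeta> (at z) (0, axis j 1)\<bar> \<le> (\<Sum>j\<in>UNIV. M j) * indicator K z" for z j
    using order_trans[OF M(2)[where z=z] le[of j]] zero[of z] by (cases "z \<in> K") simp_all
  moreover have "0 \<le> (\<Sum>j\<in>UNIV. M j)" by (rule sum_nonneg) (rule M)
  ultimately show ?thesis by blast
qed

text \<open>One approximation of accuracy \<open>e\<close>. The majorant \<open>q\<close> is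
  delivered with it because no fixed dominating function is at hand: its L^1 closeness to
  \<open>w z * \<phi> (norm (G z))\<close> takes over that role in the limit.\<close>

lemma glued_mollification:
  fixes U :: "(real \<times> (real^'n)) set" and b :: "real \<times> (real^'n) \<Rightarrow> real^'m"
    and G :: "real \<times> (real^'n) \<Rightarrow> real^'n^'m" and w :: "real \<times> (real^'n) \<Rightarrow> real" and \<phi> :: "real \<Rightarrow> real"
  assumes U: "open U" and b: "continuous_on U b"
    and Gm [measurable]: "G \<in> borel_measurable borel"
    and Gloc: "\<And>K. compact K \<Longrightarrow> K \<subseteq> U \<Longrightarrow> integrable lborel (\<lambda>z. indicator K z *\<^sub>R G z)"
    and weak: "weak_space_deriv U b G"
    and wm [measurable]: "w \<in> borel_measurable borel"
    and wb: "\<And>K. compact K \<Longrightarrow> K \<subseteq> U \<Longrightarrow> \<exists>c C. 0 < c \<and> c \<le> C \<and> (\<forall>z\<in>K. c \<le> w z \<and> w z \<le> C)"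
    and \<phi>m [measurable]: "\<phi> \<in> borel_measurable borel"
    and \<phi>nn: "\<And>s. 0 \<le> s \<Longrightarrow> 0 \<le> \<phi> s"
    and \<phi>mono: "\<And>s t. 0 \<le> s \<Longrightarrow> s \<le> t \<Longrightarrow> \<phi> s \<le> \<phi> t"
    and line: "\<And>s. 0 \<le> s \<Longrightarrow> \<exists>a. \<forall>t\<ge>0. \<phi> s + a * (t - s) \<le> \<phi> t"
    and C: "0 \<le> C" "\<And>s d. 0 \<le> s \<Longrightarrow> 0 \<le> d \<Longrightarrow> d \<le> 1 \<Longrightarrow> \<phi> (s + d) \<le> C * (\<phi> s + d)"
    and energy: "(\<integral>\<^sup>+z. ennreal (w z * \<phi> (norm (G z))) * indicator U z \<partial>lborel) < \<infinity>"
    and e: "0 < e" "e \<le> 1"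
  shows "\<exists>B q. smooth_on B U \<and> (\<forall>z\<in>U. norm (B z - b z) \<le> e) \<and>
    (\<integral>\<^sup>+z. ennreal (norm (space_deriv B z - G z)) * indicator U z \<partial>lborel) \<le> ennreal e \<and>
    q \<in> borel_measurable borel \<and> (\<forall>z\<in>U. w z * \<phi> (norm (space_deriv B z)) \<le> C * q z) \<and>
    (\<integral>\<^sup>+z. ennreal \<bar>q z - w z * \<phi> (norm (G z))\<bar> * indicator U z \<partial>lborel) \<le> ennreal e"
proof -
  define \<Phi> where "\<Phi> z = \<phi> (norm (G z))" for z
  have [measurable]: "\<Phi> \<in> borel_measurable borel" unfolding \<Phi>_def[abs_def] by measurable
  have \<Phi>nn: "0 \<le> \<Phi> z" for z by (simp add: \<Phi>_def \<phi>nn)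
  obtain D :: "nat \<Rightarrow> (real \<times> (real^'n)) set"
    and \<zeta> :: "nat \<Rightarrow> real \<times> (real^'n) \<Rightarrow> real" where
    D: "\<And>n. compact (D n)" "\<And>n. D n \<subseteq> U" "\<And>n. D n \<subseteq> interior (D (Suc n))" "(\<Union>n. D n) = U"
    and \<zeta>: "\<And>n. smooth_on (\<zeta> n) UNIV" "\<And>n z. 0 \<le> \<zeta> n z" "\<And>n z. z \<notin> D (Suc n) \<Longrightarrow> \<zeta> n z = 0"
    "\<And>n j z. z \<in> D n \<Longrightarrow> n < j \<Longrightarrow> \<zeta> j z = 0" "\<And>n z. z \<in> D n \<Longrightarrow> (\<Sum>i\<le>n. \<zeta> i z) = 1"
  proof (rule smooth_partition_of_unity[OF U], goal_cases)
    case (1 D \<zeta>)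
    show ?case by (rule 1(1)[OF 1(2-)])
  qed
  define K where "K i = D (Suc i)" for i
  define L where "L i = D (Suc (Suc i))" for i
  have K: "compact (K i)" "K i \<subseteq> U" "K i \<subseteq> L i" "K i \<subseteq> interior (L i)" and L: "compact (L i)" "L i \<subseteq> U" for i
    using D interior_subset[of "L i"] unfolding K_def L_def by blast+
  have KL: "z \<in> L i" if "z \<in> K i" for z i using that K(3) by blast
  have LU: "z \<in> U" if "z \<in> L i" for z i using that L(2) by blast
  have [measurable]: "U \<in> sets borel" using U by simp
  have [measurable]: "K i \<in> sets borel" "L i \<in> sets borel" for i
    using K(1) L(1) borel_compact by blast+
  have \<zeta>K: "\<zeta> i z = 0" if "z \<notin> K i" for i z using \<zeta>(3)[of z i] that by (simp add: K_def)
  \<comment> \<open>The lower bound of \<open>w\<close> on \<open>L i\<close> turns the finite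
    weighted energy into integrability of \<open>\<Phi>\<close> there.\<close>
  have \<Phi>int: "integrable lborel (\<lambda>z. indicator (L i) z *\<^sub>R \<Phi> z)" for i
  proof -
    obtain c where c: "0 < c" "\<And>z. z \<in> L i \<Longrightarrow> c \<le> w z" using wb[OF L] by metis
    have "(\<integral>\<^sup>+z. ennreal (norm (indicator (L i) z *\<^sub>R \<Phi> z)) \<partial>lborel)
        \<le> (\<integral>\<^sup>+z. ennreal (1 / c) * (ennreal (w z * \<phi> (norm (G z))) * indicator U z) \<partial>lborel)"
    proof (intro nn_integral_mono)
      fix z
      show "ennreal (norm (indicator (L i) z *\<^sub>R \<Phi> z)) \<le> ennreal (1 / c) * (ennreal (w z * \<phi> (norm (G z))) * indicator U z)"
      proof (cases "z \<in> L i")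
        case True
        then have "c * \<Phi> z \<le> w z * \<Phi> z" using c(2) \<Phi>nn by (intro mult_right_mono) auto
        then have "\<Phi> z \<le> 1 / c * (w z * \<Phi> z)" using c(1) by (simp add: field_simps)
        then show ?thesis using True c(1) \<Phi>nn[of z]
          by (simp add: LU[OF True] \<Phi>_def[symmetric] ennreal_leI flip: ennreal_mult')
      qed simp
    qed
    also have "\<dots> = ennreal (1 / c) * (\<integral>\<^sup>+z. ennreal (w z * \<phi> (norm (G z))) * indicator U z \<partial>lborel)"
      by (intro nn_integral_cmult) measurable
    also have "\<dots> < \<infinity>" using energy by (simp add: ennreal_mult_less_top)
    finally show ?thesis by (intro integrableI_bounded) auto
  qed
  have Gint: "integrable lborel (\<lambda>z. indicator (L i) z *\<^sub>R G z)" for i by (rule Gloc[OF L])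
  have bint: "integrable lborel (\<lambda>z. indicator (L i) z *\<^sub>R b z)" for i
    by (rule borel_integrable_compact[OF L(1) continuous_on_subset[OF b L(2)]])
  have nGint: "integrable lborel (\<lambda>z. indicator (L i) z *\<^sub>R norm (G z))" for i
    using integrable_norm[OF Gint[of i]] by simp

  \<comment> \<open>Constants of the partition and error budget\<close>
  have "\<exists>W. \<forall>i. 0 \<le> W i \<and> (\<forall>z\<in>K i. w z \<le> W i)"
  proof (rule choice, rule allI)
    fix i show "\<exists>W. 0 \<le> W \<and> (\<forall>z\<in>K i. w z \<le> W)"
      using wb[OF K(1,2), of i] by (meson less_imp_le order_trans)
  qed
  then obtain W where W: "\<And>i. 0 \<le> W i" "\<And>i z. z \<in> K i \<Longrightarrow> w z \<le> W i" by blast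
  have "\<exists>M. \<forall>i. 0 \<le> M i \<and> (\<forall>z j. \<bar>frechet_derivative (\<zeta> i) (at z) (0, axis j 1)\<bar> \<le> M i * indicator (K i) z)"
    by (rule choice, rule allI) (use bounded_space_derivative[OF \<zeta>(1) K(1) \<zeta>K] in blast)
  then obtain M where M: "\<And>i. 0 \<le> M i"
    "\<And>i z j. \<bar>frechet_derivative (\<zeta> i) (at z) (0, axis j 1)\<bar> \<le> M i * indicator (K i) z" by blast
  define N where "N = real CARD('m) * real CARD('n)"
  have N: "0 \<le> N" by (simp add: N_def)
  define V where "V i = measure lborel (K i)" for i
  have V: "0 \<le> V i" "emeasure lborel (K i) = ennreal (V i)" for i
    using emeasure_compact_finite[OF K(1)[of i]] by (auto simp: V_def emeasure_eq_ennreal_measure)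
  define s where "s i = e * (1/2) ^ Suc i" for i
  have s: "0 < s i" "s i \<le> e" "s i \<le> 1" for i
  proof -
    have "(1/2::real) ^ Suc i \<le> 1" by (rule power_le_one) auto
    then have "e * (1/2) ^ Suc i \<le> e * 1" using e by (intro mult_left_mono) auto
    then show "s i \<le> e" "s i \<le> 1" unfolding s_def using e by linarith+
    show "0 < s i" using e by (simp add: s_def)
  qed
  \<comment> \<open>The tolerance pays in advance for its later factors: the derivative of
    \<open>\<zeta> i\<close> over all matrix entries (\<open>N * M i\<close>), the weight
    (\<open>W i\<close>) and the volume of \<open>K i\<close> (\<open>V i\<close>). Adding 1 to each
    keeps the divisor positive and lets every partial product fit into \<open>s i\<close>.\<close>
  define \<epsilon> where "\<epsilon> i = s i / ((1 + N * M i) * (1 + W i) * (1 + V i))" for i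
  \<comment> \<open>Pointwise bound on \<open>K i\<close> for the part of the derivative in which
    \<open>\<zeta> i\<close> is differentiated.\<close>
  define c where "c i = N * (M i * \<epsilon> i)" for i
  have pos: "0 < (1 + N * M i) * (1 + W i) * (1 + V i)" for i
    using N M(1) W(1) V(1) by (intro mult_pos_pos add_pos_nonneg mult_nonneg_nonneg) auto
  have \<epsilon>: "0 < \<epsilon> i" for i using s(1) pos by (simp add: \<epsilon>_def)
  have c0: "0 \<le> c i" for i unfolding c_def using N M(1) \<epsilon> by (simp add: less_imp_le)
  have budget: "c i \<le> s i" "\<epsilon> i + c i * V i \<le> s i" "W i * (\<epsilon> i + c i * V i) \<le> s i" "\<epsilon> i \<le> e" for i
  proof -
    \<comment> \<open>Undoing the first divisor gives \<open>E = \<epsilon> i + c i\<close>, and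
      \<open>s i\<close> is \<open>E\<close> times two factors that are at least 1; the claims
      differ in which of these factors they use.\<close>
    define E where "E = \<epsilon> i * (1 + N * M i)"
    have si: "s i = E * (1 + V i) * (1 + W i)" using pos[of i] by (simp add: \<epsilon>_def E_def field_simps)
    have E: "E = \<epsilon> i + c i" by (simp add: E_def c_def algebra_simps)
    have le: "a \<le> a * (1 + x)" if "0 \<le> a" "0 \<le> x" for a x :: real
      using that by (simp add: algebra_simps)
    have E0: "0 \<le> E" "c i \<le> E" "\<epsilon> i \<le> E" using E \<epsilon>[of i] c0[of i] by auto
    have E1: "E \<le> E * (1 + V i)" by (rule le[OF E0(1) V(1)])
    have E2: "E * (1 + V i) \<le> s i" unfolding si
      by (rule le) (use E0 V W in auto)
    have E3: "\<epsilon> i + c i * V i \<le> E * (1 + V i)"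
      using E \<epsilon>[of i] c0[of i] V(1)[of i] by (simp add: algebra_simps)
    show "c i \<le> s i" "\<epsilon> i \<le> e" using E0 E1 E2 s(2)[of i] by linarith+
    show "\<epsilon> i + c i * V i \<le> s i" using E2 E3 by linarith
    have "W i * (\<epsilon> i + c i * V i) \<le> W i * (E * (1 + V i))" by (rule mult_left_mono[OF E3 W(1)])
    also have "\<dots> \<le> (1 + W i) * (E * (1 + V i))"
      using E0(1) V(1)[of i] by (intro mult_right_mono) auto
    also have "\<dots> = s i" by (simp add: si mult.commute)
    finally show "W i * (\<epsilon> i + c i * V i) \<le> s i" .
  qed

  \<comment> \<open>Choice of the kernels\<close>
  define good where "good i \<rho> r \<longleftrightarrow> mollifier r \<rho> \<and> (\<forall>z\<in>K i. cball z r \<subseteq> L i) \<and>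
    (\<forall>z\<in>K i. norm (convolve \<rho> (\<lambda>y. indicator (L i) y *\<^sub>R b y) z - b z) \<le> \<epsilon> i) \<and>
    (\<integral>\<^sup>+z. ennreal (norm (convolve \<rho> (\<lambda>y. indicator (L i) y *\<^sub>R G y) z - indicator (L i) z *\<^sub>R G z)) \<partial>lborel) \<le> ennreal (\<epsilon> i) \<and>
    (\<integral>\<^sup>+z. ennreal (norm (convolve \<rho> (\<lambda>y. indicator (L i) y *\<^sub>R \<Phi> y) z - indicator (L i) z *\<^sub>R \<Phi> z)) \<partial>lborel) \<le> ennreal (\<epsilon> i)"
    for i \<rho> r
  have "\<forall>i. \<exists>\<rho> r. good i \<rho> r"
    unfolding good_def
    using local_mollification[OF K(1,4) L(1) continuous_on_subset[OF b L(2)] Gint \<Phi>int \<epsilon>] by blast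
  from choice[OF this] obtain \<rho> where "\<forall>i. \<exists>r. good i (\<rho> i) r" ..
  from choice[OF this] obtain r where "\<forall>i. good i (\<rho> i) (r i)" ..
  then have good: "good i (\<rho> i) (r i)" for i by (rule spec)
  have \<rho>: "mollifier (r i) (\<rho> i)" for i
    using good[of i] unfolding good_def by (elim conjE)
  have ball: "cball z (r i) \<subseteq> L i"
    and ub: "norm (convolve (\<rho> i) (\<lambda>y. indicator (L i) y *\<^sub>R b y) z - b z) \<le> \<epsilon> i" if "z \<in> K i" for i z
    using good[of i] that unfolding good_def by (elim conjE, simp)+
  have HG: "(\<integral>\<^sup>+z. ennreal (norm (convolve (\<rho> i) (\<lambda>y. indicator (L i) y *\<^sub>R G y) z - indicator (L i) z *\<^sub>R G z)) \<partial>lborel) \<le> ennreal (\<epsilon> i)" for i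
    using good[of i] unfolding good_def by (elim conjE)
  have P\<Phi>: "(\<integral>\<^sup>+z. ennreal (norm (convolve (\<rho> i) (\<lambda>y. indicator (L i) y *\<^sub>R \<Phi> y) z - indicator (L i) z *\<^sub>R \<Phi> z)) \<partial>lborel) \<le> ennreal (\<epsilon> i)" for i
    using good[of i] unfolding good_def by (elim conjE)
  define u where "u i = convolve (\<rho> i) (\<lambda>y. indicator (L i) y *\<^sub>R b y)" for i
  define H where "H i = convolve (\<rho> i) (\<lambda>y. indicator (L i) y *\<^sub>R G y)" for i
  \<comment> \<open>The average of the norm dominates the norm of the average \<open>H i\<close>,
    and it is the scalar to which Jensen is applied.\<close>
  define A where "A i = convolve (\<rho> i) (\<lambda>y. indicator (L i) y *\<^sub>R norm (G y))" for i
  define P where "P i = convolve (\<rho> i) (\<lambda>y. indicator (L i) y *\<^sub>R \<Phi> y)" for i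
  have usm: "smooth_on (u i) UNIV" for i
    unfolding u_def by (rule smooth_on_convolve[OF mollifier_D(1)[OF \<rho>] bint])
  have [measurable]: "H i \<in> borel_measurable borel" "P i \<in> borel_measurable borel" for i
    unfolding H_def P_def
    by (rule borel_measurable_continuous_onI,
        rule smooth_on_imp_continuous_on[OF smooth_on_convolve[OF mollifier_D(1)[OF \<rho>]]], rule Gint \<Phi>int)+
  have [measurable]: "\<zeta> i \<in> borel_measurable borel" for i
    by (rule borel_measurable_continuous_onI[OF smooth_on_imp_continuous_on[OF \<zeta>(1)]])

  \<comment> \<open>The glued function: smoothness and uniform distance to b\<close>
  define B where "B z = (\<Sum>i. \<zeta> i z *\<^sub>R u i z)" for z
  have Bn: "B z = (\<Sum>i\<le>n. \<zeta> i z *\<^sub>R u i z)" if "z \<in> D n" for z n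
    unfolding B_def by (rule suminf_finite) (use \<zeta>(4)[OF that] in \<open>auto simp: not_le\<close>)
  have inD: "\<exists>n. z \<in> interior (D n)" if "z \<in> U" for z using that D(3,4) by blast
  have smB: "smooth_on B U"
    unfolding smooth_on_def
  proof (rule allI, rule times_differentiable_on_locally)
    fix k z assume "z \<in> U"
    then obtain n where n: "z \<in> interior (D n)" using inD by blast
    have "times_differentiable_on k (\<lambda>z. \<Sum>i\<le>n. \<zeta> i z *\<^sub>R u i z) (interior (D n))"
      using \<zeta>(1) usm unfolding smooth_on_def
      by (intro times_differentiable_on_sum times_differentiable_on_scaleR open_interior)
        (meson times_differentiable_on_subset subset_UNIV)+
    then have "times_differentiable_on k B (interior (D n))"
      by (rule times_differentiable_on_cong[OF open_interior, rotated])
        (use Bn interior_subset[of "D n"] in auto)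
    then show "\<exists>V. open V \<and> z \<in> V \<and> times_differentiable_on k B V" using n by blast
  qed
  have closeB: "norm (B z - b z) \<le> e" if "z \<in> U" for z
  proof -
    obtain n where n: "z \<in> D n" using \<open>z \<in> U\<close> D(4) by blast
    \<comment> \<open>A convex combination of the individual errors, as the weights sum to
      1.\<close>
    have "B z - b z = (\<Sum>i\<le>n. \<zeta> i z *\<^sub>R (u i z - b z))"
      using \<zeta>(5)[OF n] by (simp add: Bn[OF n] scaleR_diff_right sum_subtractf flip: scaleR_sum_left)
    also have "norm \<dots> \<le> (\<Sum>i\<le>n. \<zeta> i z * e)"
    proof (rule sum_norm_le)
      fix i show "norm (\<zeta> i z *\<^sub>R (u i z - b z)) \<le> \<zeta> i z * e"
      proof (cases "z \<in> K i")
        case True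
        then have "norm (u i z - b z) \<le> e" using ub[of z i] budget(4)[of i] by (simp add: u_def)
        then show ?thesis using \<zeta>(2)[of i z] by (simp add: mult_left_mono)
      qed (simp add: \<zeta>K)
    qed
    also have "\<dots> = e" using \<zeta>(5)[OF n] by (simp flip: sum_distrib_right)
    finally show ?thesis .
  qed

  \<comment> \<open>Its spatial derivative: average plus remainder\<close>
  define g where "g = space_deriv B"
  \<comment> \<open>The interior is needed because differentiation takes a neighbourhood on which
    the number of terms is fixed.\<close>
  have gn: "norm (g z - (\<Sum>i\<le>n. \<zeta> i z *\<^sub>R H i z)) \<le> (\<Sum>i\<le>n. c i * indicator (K i) z)"
    if n: "z \<in> interior (D n)" for n z
  proof -
    have "norm (space_deriv B z - (\<Sum>i\<le>n. \<zeta> i z *\<^sub>R H i z)) \<le>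
        (\<Sum>i\<le>n. real CARD('m) * real CARD('n) * (M i * indicator (K i) z * \<epsilon> i))"
    proof (rule glued_derivative[OF open_interior n, where b=b])
      show "B y = (\<Sum>i\<le>n. \<zeta> i y *\<^sub>R u i y)" "(\<Sum>i\<le>n. \<zeta> i y) = 1" if "y \<in> interior (D n)" for y
        using Bn \<zeta>(5) that interior_subset by blast+
      show "frechet_derivative (u i) (at z) (0, axis j 1) $ k = H i z $ k $ j" if "\<zeta> i z \<noteq> 0" for i k j
      proof -
        have "z \<in> K i" using that \<zeta>K by blast
        then show ?thesis unfolding u_def H_def
          by (intro frechet_derivative_convolve_weak[OF weak \<rho> ball L(2) bint Gint])
      qed
      show "\<bar>frechet_derivative (\<zeta> i) (at z) (0, axis j 1) * (u i z - b z) $ k\<bar> \<le> M i * indicator (K i) z * \<epsilon> i" for i j k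
      proof (cases "z \<in> K i")
        case True
        have "\<bar>(u i z - b z) $ k\<bar> \<le> \<epsilon> i"
          using order_trans[OF component_le_norm_cart ub[OF True]] by (simp add: u_def)
        then show ?thesis unfolding abs_mult by (intro mult_mono M(2)) (use M(1) in auto)
      next
        case False
        then show ?thesis using M(2)[of i z j] by simp
      qed
    qed (use \<zeta>(1) usm in auto)
    also have "\<dots> = (\<Sum>i\<le>n. c i * indicator (K i) z)" by (simp add: c_def N_def mult_ac)
    finally show ?thesis by (simp add: g_def)
  qed
  \<comment> \<open>A majorant of the remainder that does not depend on \<open>n\<close>. Since
    \<open>c i \<le> s i\<close>, it is at most \<open>e \<le> 1\<close>, as the shift inequality in
    \<open>C\<close> demands.\<close>
  define \<delta> where "\<delta> z = (\<Sum>i. c i * indicator (K i) z)" for z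
  have sums: "s sums e" using sums_mult[OF power_half_series, of e] by (simp add: s_def[abs_def])
  have cs: "0 \<le> c i * indicator (K i) z" "c i * indicator (K i) z \<le> s i" for i z
    using c0[of i] budget(1)[of i] s(1)[of i] by (auto simp: indicator_def)
  have csm: "summable (\<lambda>i. c i * indicator (K i) z)" for z
    by (rule summable_comparison_test'[OF sums_summable[OF sums]]) (use cs in auto)
  have \<delta>: "(\<Sum>i\<le>n. c i * indicator (K i) z) \<le> \<delta> z" "0 \<le> \<delta> z" "\<delta> z \<le> 1" for n z
  proof -
    show "(\<Sum>i\<le>n. c i * indicator (K i) z) \<le> \<delta> z" unfolding \<delta>_def
      by (rule sum_le_suminf[OF csm]) (use cs in auto)
    show "0 \<le> \<delta> z" unfolding \<delta>_def by (rule suminf_nonneg[OF csm cs(1)])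
    have "\<delta> z \<le> (\<Sum>i. s i)" unfolding \<delta>_def
      by (rule suminf_le[OF cs(2) csm sums_summable[OF sums]])
    then show "\<delta> z \<le> 1" using sums_unique[OF sums] e by simp
  qed
  have \<delta>e: "ennreal (\<delta> z) = (\<Sum>i. ennreal (c i * indicator (K i) z))" for z
    unfolding \<delta>_def by (rule suminf_ennreal2[symmetric]) (use cs csm in auto)
  have [measurable]: "\<delta> \<in> borel_measurable borel" unfolding \<delta>_def[abs_def] by measurable

  \<comment> \<open>The majorant of the energy density\<close>
  define Q where "Q z = (\<Sum>i. \<zeta> i z * P i z)" for z
  have [measurable]: "Q \<in> borel_measurable borel" unfolding Q_def[abs_def] by measurable
  have Qn: "Q z = (\<Sum>i\<le>n. \<zeta> i z * P i z)" if "z \<in> D n" for z n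
    unfolding Q_def by (rule suminf_finite) (use \<zeta>(4)[OF that] in \<open>auto simp: not_le\<close>)
  \<comment> \<open>\<open>Q\<close> averages \<open>\<Phi>\<close> without the weight;
    \<open>w\<close> multiplies afterwards, so its oscillation never matters, only its bound
    \<open>W i\<close> on \<open>K i\<close>.\<close>
  define q where "q z = w z * (Q z + \<delta> z)" for z
  have w0: "0 \<le> w z" if "z \<in> U" for z using wb[of "{z}"] that by force

  \<comment> \<open>L^1 distance of the derivatives\<close>
  have T1: "(\<integral>\<^sup>+z. ennreal (norm (g z - G z)) * indicator U z \<partial>lborel) \<le> ennreal e"
  proof -
    let ?F = "\<lambda>i z. ennreal (norm (H i z - indicator (L i) z *\<^sub>R G z)) + ennreal (c i) * indicator (K i) z"
    have "(\<integral>\<^sup>+z. ennreal (norm (g z - G z)) * indicator U z \<partial>lborel) \<le> (\<integral>\<^sup>+z. (\<Sum>i. ?F i z) \<partial>lborel)"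
    proof (intro nn_integral_mono)
      fix z
      show "ennreal (norm (g z - G z)) * indicator U z \<le> (\<Sum>i. ?F i z)"
      proof (cases "z \<in> U")
        case True
        then obtain n where n: "z \<in> interior (D n)" using inD by blast
        then have nD: "z \<in> D n" using interior_subset by blast
        have "(\<Sum>i\<le>n. \<zeta> i z *\<^sub>R H i z) - G z = (\<Sum>i\<le>n. \<zeta> i z *\<^sub>R (H i z - G z))"
          using \<zeta>(5)[OF nD] by (simp add: scaleR_diff_right sum_subtractf flip: scaleR_sum_left)
        also have "norm \<dots> \<le> (\<Sum>i\<le>n. norm (H i z - indicator (L i) z *\<^sub>R G z))"
        proof (rule sum_norm_le)
          fix i assume "i \<in> {..n}"
          then have "\<zeta> i z \<le> 1" using \<zeta>(5)[OF nD] member_le_sum[of i "{..n}" "\<lambda>i. \<zeta> i z"] \<zeta>(2) by simp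
          then show "norm (\<zeta> i z *\<^sub>R (H i z - G z)) \<le> norm (H i z - indicator (L i) z *\<^sub>R G z)"
            using \<zeta>(2)[of i z] \<zeta>K[of z i] KL[of z i] mult_right_mono[of "\<zeta> i z" 1 "norm (H i z - G z)"]
            by (cases "z \<in> K i") auto
        qed
        finally have "norm (g z - G z) \<le> (\<Sum>i\<le>n. norm (H i z - indicator (L i) z *\<^sub>R G z) + c i * indicator (K i) z)"
          using gn[OF n] norm_triangle_ineq[of "g z - (\<Sum>i\<le>n. \<zeta> i z *\<^sub>R H i z)" "(\<Sum>i\<le>n. \<zeta> i z *\<^sub>R H i z) - G z"]
          by (simp add: sum.distrib)
        then have "ennreal (norm (g z - G z)) \<le> (\<Sum>i\<le>n. ennreal (norm (H i z - indicator (L i) z *\<^sub>R G z) + c i * indicator (K i) z))"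
          using cs by (subst sum_ennreal) (auto intro: ennreal_leI add_nonneg_nonneg)
        also have "\<dots> = (\<Sum>i\<le>n. ?F i z)"
          using c0 by (intro sum.cong refl) (auto simp: indicator_def)
        also have "\<dots> \<le> (\<Sum>i. ?F i z)" by (rule sum_le_suminf) auto
        finally show ?thesis using True by simp
      qed simp
    qed
    also have "\<dots> \<le> ennreal e"
    proof (rule nn_integral_suminf_geometric)
      fix i
      have "(\<integral>\<^sup>+z. ?F i z \<partial>lborel) = (\<integral>\<^sup>+z. ennreal (norm (H i z - indicator (L i) z *\<^sub>R G z)) \<partial>lborel) + ennreal (c i) * ennreal (V i)"
        by (simp add: nn_integral_add nn_integral_cmult V(2))
      also have "\<dots> \<le> ennreal (\<epsilon> i) + ennreal (c i) * ennreal (V i)"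
        using HG[of i] by (intro add_right_mono) (simp add: H_def)
      also have "\<dots> \<le> ennreal (s i)"
        using \<epsilon>[of i] c0[of i] V(1)[of i] budget(2)[of i] by (simp add: less_imp_le ennreal_leI flip: ennreal_mult ennreal_plus)
      finally show "(\<integral>\<^sup>+z. ?F i z \<partial>lborel) \<le> ennreal (e * (1/2) ^ Suc i)" by (simp add: s_def)
    qed (use e in auto)
    finally show ?thesis .
  qed

  \<comment> \<open>L^1 distance of the majorant to the energy density\<close>
  have T2: "(\<integral>\<^sup>+z. ennreal \<bar>q z - w z * \<Phi> z\<bar> * indicator U z \<partial>lborel) \<le> ennreal e"
  proof -
    \<comment> \<open>\<open>W i\<close> may replace \<open>w z\<close> in the \<open>i\<close>-th
      term because that term, before being enlarged, vanishes off \<open>K i\<close>.\<close>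
    let ?F = "\<lambda>i z. ennreal (W i) * (ennreal (norm (P i z - indicator (L i) z *\<^sub>R \<Phi> z)) + ennreal (c i) * indicator (K i) z)"
    have "(\<integral>\<^sup>+z. ennreal \<bar>q z - w z * \<Phi> z\<bar> * indicator U z \<partial>lborel) \<le> (\<integral>\<^sup>+z. (\<Sum>i. ?F i z) \<partial>lborel)"
    proof (intro nn_integral_mono)
      fix z
      show "ennreal \<bar>q z - w z * \<Phi> z\<bar> * indicator U z \<le> (\<Sum>i. ?F i z)"
      proof (cases "z \<in> U")
        case True
        then obtain n where nD: "z \<in> D n" using D(4) by blast
        let ?a = "\<lambda>i. \<zeta> i z * \<bar>P i z - \<Phi> z\<bar>"
        have "Q z - \<Phi> z = (\<Sum>i\<le>n. \<zeta> i z * (P i z - \<Phi> z))"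
          using \<zeta>(5)[OF nD] by (simp add: Qn[OF nD] right_diff_distrib sum_subtractf flip: sum_distrib_right)
        also have "\<bar>\<dots>\<bar> \<le> (\<Sum>i\<le>n. ?a i)"
          by (rule order_trans[OF sum_abs]) (simp add: abs_mult \<zeta>(2))
        finally have "\<bar>Q z + \<delta> z - \<Phi> z\<bar> \<le> (\<Sum>i\<le>n. ?a i) + \<delta> z" using \<delta>(2)[of z] by linarith
        then have "\<bar>q z - w z * \<Phi> z\<bar> \<le> w z * ((\<Sum>i\<le>n. ?a i) + \<delta> z)"
          using w0[OF True] by (simp add: q_def abs_mult mult_left_mono flip: right_diff_distrib)
        then have "ennreal \<bar>q z - w z * \<Phi> z\<bar> \<le> ennreal (w z) * (ennreal (\<Sum>i\<le>n. ?a i) + ennreal (\<delta> z))"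
          using w0[OF True] \<delta>(2)[of z] \<zeta>(2)
          by (simp add: ennreal_leI sum_nonneg flip: ennreal_mult ennreal_plus)
        also have "ennreal (\<Sum>i\<le>n. ?a i) = (\<Sum>i\<le>n. ennreal (?a i))"
          using \<zeta>(2) by (subst sum_ennreal) auto
        also have "ennreal (w z) * ((\<Sum>i\<le>n. ennreal (?a i)) + ennreal (\<delta> z))
            \<le> ennreal (w z) * ((\<Sum>i. ennreal (?a i)) + (\<Sum>i. ennreal (c i * indicator (K i) z)))"
          unfolding \<delta>e by (intro mult_left_mono add_right_mono sum_le_suminf) auto
        also have "\<dots> = (\<Sum>i. ennreal (w z) * (ennreal (?a i) + ennreal (c i * indicator (K i) z)))"
          by (simp add: suminf_add ennreal_suminf_cmult)
        also have "\<dots> \<le> (\<Sum>i. ?F i z)"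
        proof (intro suminf_le)
          fix i
          show "ennreal (w z) * (ennreal (?a i) + ennreal (c i * indicator (K i) z)) \<le> ?F i z"
          proof (cases "z \<in> K i")
            case zK: True
            have "\<zeta> i z \<le> 1"
            proof (cases "i \<le> n")
              case True
              then show ?thesis using \<zeta>(5)[OF nD] member_le_sum[of i "{..n}" "\<lambda>i. \<zeta> i z"] \<zeta>(2) by simp
            qed (use \<zeta>(4)[OF nD, of i] in auto)
            then have "?a i \<le> norm (P i z - indicator (L i) z *\<^sub>R \<Phi> z)"
              using KL[OF zK] mult_right_mono[of "\<zeta> i z" 1 "\<bar>P i z - \<Phi> z\<bar>"] by simp
            then show ?thesis using zK W(2)[OF zK]
              by (intro mult_mono add_mono ennreal_leI) auto
          next
            case False
            then show ?thesis by (simp add: \<zeta>K)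
          qed
        qed auto
        finally show ?thesis using True by simp
      qed simp
    qed
    also have "\<dots> \<le> ennreal e"
    proof (rule nn_integral_suminf_geometric)
      fix i
      have "(\<integral>\<^sup>+z. ?F i z \<partial>lborel) = ennreal (W i) * ((\<integral>\<^sup>+z. ennreal (norm (P i z - indicator (L i) z *\<^sub>R \<Phi> z)) \<partial>lborel) + ennreal (c i) * ennreal (V i))"
        by (simp add: nn_integral_add nn_integral_cmult V(2))
      also have "\<dots> \<le> ennreal (W i) * (ennreal (\<epsilon> i) + ennreal (c i) * ennreal (V i))"
        using P\<Phi>[of i] by (intro mult_left_mono add_right_mono) (simp_all add: P_def)
      also have "\<dots> \<le> ennreal (s i)"
        using \<epsilon>[of i] c0[of i] V(1)[of i] W(1)[of i] budget(3)[of i]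
        by (simp add: less_imp_le ennreal_leI flip: ennreal_mult ennreal_plus)
      finally show "(\<integral>\<^sup>+z. ?F i z \<partial>lborel) \<le> ennreal (e * (1/2) ^ Suc i)" by (simp add: s_def)
    qed (use e in auto)
    finally show ?thesis .
  qed

  \<comment> \<open>Pointwise domination by Jensen's inequality\<close>
  have dom: "w z * \<phi> (norm (g z)) \<le> C * q z" if "z \<in> U" for z
  proof -
    obtain n where n: "z \<in> interior (D n)" using inD \<open>z \<in> U\<close> by blast
    then have nD: "z \<in> D n" using interior_subset by blast
    \<comment> \<open>The mean of \<open>norm (G y)\<close> under the probability density
      \<open>y \<mapsto> (\<Sum>i\<le>n. \<zeta> i z * \<rho> i (z - y))\<close>.\<close>
    define S where "S = (\<Sum>i\<le>n. \<zeta> i z * A i z)"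
    have A0: "0 \<le> A i z" for i
      unfolding A_def convolve_def by (intro Bochner_Integration.integral_nonneg) (simp add: mollifier_D(2)[OF \<rho>])
    have S0: "0 \<le> S" unfolding S_def by (intro sum_nonneg mult_nonneg_nonneg A0 \<zeta>(2))
    have HA: "norm (H i z) \<le> A i z" for i
      unfolding H_def A_def convolve_def
      by (rule order_trans[OF integral_norm_bound]) (simp add: mollifier_D(2)[OF \<rho>] mult.assoc)
    have "norm (\<Sum>i\<le>n. \<zeta> i z *\<^sub>R H i z) \<le> S" unfolding S_def
      by (rule sum_norm_le) (simp add: \<zeta>(2) HA mult_left_mono)
    then have "norm (g z) \<le> S + \<delta> z"
      using gn[OF n] \<delta>(1)[where n=n and z=z] norm_triangle_sub[of "g z" "\<Sum>i\<le>n. \<zeta> i z *\<^sub>R H i z"] by linarith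
    then have 1: "\<phi> (norm (g z)) \<le> C * (\<phi> S + \<delta> z)"
      using \<phi>mono[of "norm (g z)" "S + \<delta> z"] C(2)[OF S0 \<delta>(2,3)[of z]] by simp
    \<comment> \<open>The supporting line is taken at the mean \<open>S\<close> itself, so averaging
      it returns \<open>\<phi> S\<close>; one slope \<open>a\<close> serves all kernels.\<close>
    obtain a where a: "\<And>t. 0 \<le> t \<Longrightarrow> \<phi> S + a * (t - S) \<le> \<phi> t" using line[OF S0] by blast
    have "\<phi> S = (\<Sum>i\<le>n. \<zeta> i z * (\<phi> S - a * S)) + a * (\<Sum>i\<le>n. \<zeta> i z * A i z)"
      using \<zeta>(5)[OF nD] by (simp add: S_def[symmetric] flip: sum_distrib_right)
    also have "\<dots> = (\<Sum>i\<le>n. \<zeta> i z * ((\<phi> S - a * S) + a * A i z))"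
      by (simp add: sum_distrib_left sum.distrib distrib_left mult_ac)
    also have "\<dots> \<le> (\<Sum>i\<le>n. \<zeta> i z * P i z)"
    proof (rule sum_mono)
      fix i
      show "\<zeta> i z * ((\<phi> S - a * S) + a * A i z) \<le> \<zeta> i z * P i z"
      proof (cases "z \<in> K i")
        case True
        have "\<phi> S - a * S + a * norm (G y) \<le> \<Phi> y" for y
          using a[of "norm (G y)"] by (simp add: \<Phi>_def algebra_simps)
        from convolve_supporting_line[OF \<rho> ball[OF True] nGint \<Phi>int this]
        show ?thesis using \<zeta>(2) by (intro mult_left_mono) (simp_all add: A_def P_def)
      qed (simp add: \<zeta>K)
    qed
    finally have "\<phi> S \<le> Q z" by (simp add: Qn[OF nD])
    then have "\<phi> (norm (g z)) \<le> C * (Q z + \<delta> z)"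
      using 1 C(1) by (meson add_right_mono mult_left_mono order_trans)
    then show ?thesis using mult_left_mono[OF _ w0[OF that], of "\<phi> (norm (g z))" "C * (Q z + \<delta> z)"]
      by (simp add: q_def mult_ac)
  qed
  have "q \<in> borel_measurable borel" unfolding q_def[abs_def] by measurable
  then show ?thesis
    using smB closeB T1 T2 dom unfolding g_def \<Phi>_def by blast
qed

subsection \<open>The damped exponential\<close>

text \<open>With a negative power the exponent becomes the product
  \<open>t * log_damping \<gamma> \<tau> t\<close>, convenient to differentiate; the value at 0 is
  the coefficient of the subtracted linear term.\<close>

definition log_damping :: "real \<Rightarrow> real \<Rightarrow> real \<Rightarrow> real" where
  "log_damping \<gamma> \<tau> t = ln (t + \<tau>) powr (- \<gamma>)"

lemma exp_gt_tilde_eq: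
  "exp_gt_tilde \<gamma> \<tau> t = exp (t * log_damping \<gamma> \<tau> t) - 1 - t * log_damping \<gamma> \<tau> 0"
  by (simp add: exp_gt_tilde_def exp_gt_def log_damping_def powr_minus_divide)

text \<open>From \<open>exp 1 \<le> 3\<close> follows \<open>exp 4 \<le> 81\<close>, which is below
  100.\<close>

lemma four_le_ln:
  assumes "100 \<le> x"
  shows "4 \<le> ln (x::real)"
proof -
  have "exp (1::real) ^ 4 \<le> 3 ^ 4" by (intro power_mono exp_le) auto
  then have "exp (4::real) \<le> x" using assms by (simp flip: exp_of_nat_mult)
  then show ?thesis using assms by (subst ln_ge_iff) auto
qed

locale damped_exponential =
  fixes \<gamma> \<tau> :: real
  assumes \<gamma>: "0 \<le> \<gamma>" "\<gamma> \<le> 1" and \<tau>: "100 \<le> \<tau>"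
begin

abbreviation "p \<equiv> log_damping \<gamma> \<tau>"
abbreviation "\<phi> \<equiv> exp_gt_tilde \<gamma> \<tau>"

text \<open>Relative loss of slope caused by the damping: \<open>t * p t\<close> has derivative
  \<open>p t * (1 - \<gamma> * r t)\<close>.\<close>

definition "r t = t / ((t + \<tau>) * ln (t + \<tau>))"
text \<open>The derivative of \<open>exp (t * p t)\<close>; the slope of \<open>\<phi>\<close> is
  therefore \<open>h t - p 0\<close>.\<close>

definition "h t = exp (t * p t) * (p t * (1 - \<gamma> * r t))"

context
  fixes t :: real
  assumes t: "0 \<le> t"
begin

lemma ln4: "4 \<le> ln (t + \<tau>)" using four_le_ln \<tau> t by simp

text \<open>The base is at least 4, so the power increases with its exponent, which lies between -1
  and 0; the lower bound is the extreme case \<open>\<gamma> = 1\<close>.\<close>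

lemma p_bounds: "0 < p t" "p t \<le> 1" "1 / ln (t + \<tau>) \<le> p t"
proof -
  show "0 < p t" using ln4 by (simp add: log_damping_def)
  show "p t \<le> 1" using ln4 \<gamma> powr_mono[of "- \<gamma>" 0 "ln (t + \<tau>)"] by (simp add: log_damping_def)
  show "1 / ln (t + \<tau>) \<le> p t"
    using ln4 \<gamma> powr_mono[of "- 1" "- \<gamma>" "ln (t + \<tau>)"] by (simp add: log_damping_def powr_minus_divide)
qed

text \<open>\<open>r t\<close> is the product of \<open>t / (t + \<tau>) \<le> 1\<close> and
  \<open>1 / ln (t + \<tau>) \<le> 1 / 4\<close>.\<close>

lemma r_bounds: "0 \<le> r t" "\<gamma> * r t \<le> 1 / 4" "0 \<le> \<gamma> * r t"
proof -
  have pos: "0 < t + \<tau>" using t \<tau> by simp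
  show r0: "0 \<le> r t" unfolding r_def
    using t \<tau> pos ln4 by (intro divide_nonneg_nonneg mult_nonneg_nonneg) auto
  have "r t = (t / (t + \<tau>)) * (1 / ln (t + \<tau>))" by (simp add: r_def)
  also have "\<dots> \<le> 1 * (1 / 4)"
    using t \<tau> ln4 by (intro mult_mono) (auto simp: divide_le_eq)
  finally have r4: "r t \<le> 1 / 4" by simp
  have "\<gamma> * r t \<le> 1 * r t" using r0 \<gamma> by (intro mult_right_mono) auto
  then show "\<gamma> * r t \<le> 1 / 4" using r4 by simp
  show "0 \<le> \<gamma> * r t" using \<gamma> r0 by simp
qed

lemma p_deriv: "(p has_real_derivative - (\<gamma> * p t / ((t + \<tau>) * ln (t + \<tau>)))) (at t)"
proof -
  have pos: "0 < t + \<tau>" using t \<tau> by simp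
  have ln: "((\<lambda>t. ln (t + \<tau>)) has_real_derivative 1 / (t + \<tau>)) (at t)"
    using pos by (auto intro!: derivative_eq_intros)
  have l: "0 < ln (t + \<tau>)" using ln4 by simp
  from DERIV_chain2[OF has_real_derivative_powr[OF l, of "- \<gamma>"] ln]
  show ?thesis using l
    by (simp add: log_damping_def[abs_def] powr_diff abs_of_pos mult.commute)
qed

lemma exponent_deriv: "((\<lambda>t. t * p t) has_real_derivative p t * (1 - \<gamma> * r t)) (at t)"
proof -
  have "((\<lambda>t. t * p t) has_real_derivative 1 * p t + - (\<gamma> * p t / ((t + \<tau>) * ln (t + \<tau>))) * t) (at t)"
    by (rule DERIV_mult[OF DERIV_ident p_deriv])
  then show ?thesis by (simp add: r_def algebra_simps)
qed

lemma \<phi>_deriv: "(\<phi> has_real_derivative h t - p 0) (at t)"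
proof -
  have "((\<lambda>t. exp (t * p t) - 1 - t * p 0) has_real_derivative
      exp (t * p t) * (p t * (1 - \<gamma> * r t)) - 0 - 1 * p 0) (at t)"
    by (intro DERIV_diff DERIV_fun_exp exponent_deriv DERIV_const DERIV_cmult_right DERIV_ident)
  then show ?thesis by (simp add: h_def exp_gt_tilde_eq[abs_def])
qed

text \<open>This is the strict convexity of \<open>\<phi>\<close>. Up to a positive factor the
  derivative is a main term of at least \<open>9 / 16\<close> times
  \<open>1 / ln (t + \<tau>)\<close>, minus two corrections of at most \<open>1 / 100\<close> times
  the same quantity each. The 9/16 comes from the logarithm being at least 4, the 1/100 from
  \<open>t + \<tau> \<ge> 100\<close>.\<close>

lemma h_deriv: "\<exists>d>0. (h has_real_derivative d) (at t)"
proof -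
  let ?x = "t + \<tau>" and ?l = "ln (t + \<tau>)"
  have x: "100 \<le> ?x" "0 < ?x" and l: "0 < ?l" using t \<tau> ln4 by auto
  define r' where "r' = (1 * (?x * ?l) - t * (1 * ?l + 1 / ?x * ?x)) / ((?x * ?l) * (?x * ?l))"
  have ln: "((\<lambda>t. ln (t + \<tau>)) has_real_derivative 1 / ?x) (at t)"
    using x by (auto intro!: derivative_eq_intros)
  have id: "((\<lambda>t. t + \<tau>) has_real_derivative 1) (at t)" by (auto intro!: derivative_eq_intros)
  have r: "(r has_real_derivative r') (at t)"
    unfolding r_def[abs_def] r'_def
    by (rule DERIV_divide[OF DERIV_ident DERIV_mult[OF id ln]]) (use x l in auto)
  \<comment> \<open>An upper bound suffices, since \<open>r'\<close> enters the derivative of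
    \<open>h\<close> with a minus sign.\<close>
  have r'_le: "r' \<le> 1 / (?x * ?l)"
  proof -
    have "r' \<le> (?x * ?l) / ((?x * ?l) * (?x * ?l))"
      unfolding r'_def using t x l by (intro divide_right_mono) auto
    then show ?thesis using x l by simp
  qed
  let ?d = "exp (t * p t) * (p t * (1 - \<gamma> * r t)) * (p t * (1 - \<gamma> * r t)) +
    (- (\<gamma> * p t / (?x * ?l)) * (1 - \<gamma> * r t) + (0 - \<gamma> * r') * p t) * exp (t * p t)"
  have "(h has_real_derivative ?d) (at t)"
    unfolding h_def[abs_def]
    by (rule DERIV_mult[OF DERIV_fun_exp[OF exponent_deriv]
          DERIV_mult[OF p_deriv DERIV_diff[OF DERIV_const DERIV_cmult[OF r]]]])
  moreover have "?d = exp (t * p t) * p t * (p t * (1 - \<gamma> * r t)\<^sup>2 - \<gamma> * (1 - \<gamma> * r t) / (?x * ?l) - \<gamma> * r')"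
    by (simp add: algebra_simps power2_eq_square)
  moreover have "0 < p t * (1 - \<gamma> * r t)\<^sup>2 - \<gamma> * (1 - \<gamma> * r t) / (?x * ?l) - \<gamma> * r'"
  proof -
    have xl: "1 / (?x * ?l) \<le> 1 / 100 * (1 / ?l)"
      using x l by (simp add: divide_simps)
    have "(3 / 4) ^ 2 \<le> (1 - \<gamma> * r t)\<^sup>2" using r_bounds by (intro power_mono) auto
    then have "(1 / ?l) * (9 / 16) \<le> p t * (1 - \<gamma> * r t)\<^sup>2"
      using p_bounds l by (intro mult_mono) (auto simp: power2_eq_square)
    moreover have "\<gamma> * (1 - \<gamma> * r t) / (?x * ?l) \<le> 1 / (?x * ?l)"
      using r_bounds \<gamma> x l mult_mono[of \<gamma> 1 "1 - \<gamma> * r t" 1] by (intro divide_right_mono) auto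
    moreover have "\<gamma> * r' \<le> 1 / (?x * ?l)"
    proof -
      have "\<gamma> * r' \<le> \<gamma> * (1 / (?x * ?l))" using \<gamma> r'_le by (intro mult_left_mono) auto
      also have "\<dots> \<le> 1 * (1 / (?x * ?l))" using \<gamma> x l by (intro mult_right_mono) auto
      finally show ?thesis by simp
    qed
    moreover have "0 < 1 / ?l" using l by simp
    moreover have "0 < a - b - c" if "z * (9 / 16) \<le> a" "b \<le> y" "c \<le> y" "0 < z" "y \<le> 1 / 100 * z"
      for a b c y z :: real using that by linarith
    ultimately show ?thesis using xl by blast
  qed
  ultimately show ?thesis using p_bounds(1) by (intro exI[of _ ?d]) simp
qed

end

lemma h_strict_mono:
  assumes "0 \<le> s" "s < t"
  shows "h s < h t"
proof (rule DERIV_pos_imp_increasing[OF assms(2)])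
  fix x assume "s \<le> x"
  then obtain d where "d > 0" "(h has_real_derivative d) (at x)" using h_deriv[of x] assms by auto
  then show "\<exists>y. (h has_real_derivative y) (at x) \<and> 0 < y" by blast
qed

lemma h_0: "h 0 = p 0" by (simp add: h_def r_def)

lemma \<phi>_0: "\<phi> 0 = 0" by (simp add: exp_gt_tilde_eq)

text \<open>Mean value theorem and monotonicity of the slope, applied on either side of
  \<open>s\<close>.\<close>

lemma supporting_line:
  assumes "0 \<le> s" "0 \<le> t"
  shows "\<phi> s + (h s - p 0) * (t - s) \<le> \<phi> t"
proof -
  consider "s < t" | "t < s" | "s = t" by linarith
  then show ?thesis
  proof cases
    case 1
    obtain z where z: "s < z" "z < t" "\<phi> t - \<phi> s = (t - s) * (h z - p 0)"
      using MVT2[OF 1, of \<phi> "\<lambda>t. h t - p 0"] \<phi>_deriv assms by force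
    then have "(t - s) * (h s - p 0) \<le> (t - s) * (h z - p 0)"
      using h_strict_mono[of s z] assms by (intro mult_left_mono) auto
    then show ?thesis using z(3) by (simp add: mult.commute)
  next
    case 2
    obtain z where z: "t < z" "z < s" "\<phi> s - \<phi> t = (s - t) * (h z - p 0)"
      using MVT2[OF 2, of \<phi> "\<lambda>t. h t - p 0"] \<phi>_deriv assms by force
    then have "(s - t) * (h z - p 0) \<le> (s - t) * (h s - p 0)"
      using h_strict_mono[of z s] assms by (intro mult_left_mono) auto
    then show ?thesis using z(3) by (simp add: algebra_simps)
  qed simp
qed

lemma slope_nonneg: "0 \<le> s \<Longrightarrow> 0 \<le> h s - p 0"
  using h_strict_mono[of 0 s] h_0 by (cases "s = 0") auto

lemma \<phi>_nonneg: "0 \<le> s \<Longrightarrow> 0 \<le> \<phi> s"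
  using supporting_line[of 0 s] by (simp add: \<phi>_0 h_0)

lemma \<phi>_mono:
  assumes "0 \<le> s" "s \<le> t"
  shows "\<phi> s \<le> \<phi> t"
  using supporting_line[of s t] mult_nonneg_nonneg[OF slope_nonneg[OF assms(1)], of "t - s"] assms by simp

text \<open>Strictness matters: \<open>\<phi> 1\<close> becomes a divisor in the growth
  bound.\<close>

lemma \<phi>_1_pos: "0 < \<phi> 1"
proof -
  obtain z where "0 < z" "z < 1" "\<phi> 1 - \<phi> 0 = (1 - 0) * (h z - p 0)"
    using MVT2[of 0 1 \<phi> "\<lambda>t. h t - p 0"] \<phi>_deriv by force
  then show ?thesis using h_strict_mono[of 0 z] h_0 \<phi>_0 by simp
qed

text \<open>By convexity and \<open>\<phi> 0 = 0\<close>, \<open>\<phi> s\<close> is at least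
  \<open>\<phi> 1 * s\<close> once \<open>s > 1\<close>; the summand 1 covers the smaller
  arguments.\<close>

lemma linear_growth:
  assumes "0 \<le> s"
  shows "s \<le> 1 + \<phi> s / \<phi> 1"
proof (cases "s \<le> 1")
  case True
  have "0 \<le> \<phi> s / \<phi> 1" using \<phi>_nonneg[OF assms] \<phi>_1_pos by simp
  then show ?thesis using True by linarith
next
  case False
  have "\<phi> 1 \<le> h 1 - p 0" using supporting_line[of 1 0] by (simp add: \<phi>_0)
  then have "\<phi> 1 * (s - 1) \<le> (h 1 - p 0) * (s - 1)" using False by (intro mult_right_mono) auto
  then have "\<phi> 1 * s \<le> \<phi> s" using supporting_line[of 1 s] assms by (simp add: algebra_simps)
  then have "s \<le> \<phi> s / \<phi> 1" using \<phi>_1_pos by (simp add: pos_le_divide_eq mult.commute)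
  then show ?thesis by simp
qed

text \<open>The exponent has slope \<open>p z * (1 - \<gamma> * r z) \<le> 1\<close>, so a shift by
  \<open>d\<close> multiplies the exponential by at most \<open>exp d\<close>.\<close>

lemma exponent_lipschitz:
  assumes "0 \<le> s" "0 \<le> d"
  shows "(s + d) * p (s + d) \<le> s * p s + d"
proof (cases "d = 0")
  case False
  then have sd: "s < s + d" using assms by simp
  obtain z where z: "s < z" "z < s + d" "(s + d) * p (s + d) - s * p s = (s + d - s) * (p z * (1 - \<gamma> * r z))"
    using MVT2[OF sd, of "\<lambda>t. t * p t" "\<lambda>t. p t * (1 - \<gamma> * r t)"] exponent_deriv assms by force
  have "0 \<le> z" using z assms by simp
  then have "p z * (1 - \<gamma> * r z) \<le> 1 * 1"
    using p_bounds[of z] r_bounds[of z] by (intro mult_mono) auto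
  then have "d * (p z * (1 - \<gamma> * r z)) \<le> d * 1" using assms by (intro mult_left_mono) auto
  then show ?thesis using z(3) by simp
qed simp

text \<open>A shift by \<open>d \<le> 1\<close> multiplies the exponential by at most
  \<open>1 + 2 * d\<close>. The excess keeps the factor \<open>d\<close>, and the exponential itself
  is \<open>\<phi> s\<close> plus an affine function of \<open>s\<close>, which linear growth
  absorbs into \<open>\<phi> s\<close> and a constant.\<close>

lemma shift_bound:
  assumes "0 \<le> s" "0 \<le> d" "d \<le> 1"
  shows "\<phi> (s + d) \<le> (7 + 2 / \<phi> 1) * (\<phi> s + d)"
proof -
  have p0: "0 < p 0" "p 0 \<le> 1" using p_bounds[of 0] by auto
  have "exp d \<le> 1 + 2 * d"
    using exp_bound[of d] assms mult_left_le_one_le[of d d] by (simp add: power2_eq_square)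
  then have e: "exp (s * p s) * exp d \<le> exp (s * p s) * (1 + 2 * d)" by (intro mult_left_mono) auto
  have "exp ((s + d) * p (s + d)) \<le> exp (s * p s + d)"
    using exponent_lipschitz assms by simp
  also have "\<dots> \<le> exp (s * p s) + 2 * d * exp (s * p s)" using e by (simp add: exp_add algebra_simps)
  finally have "\<phi> (s + d) \<le> \<phi> s + 2 * d * exp (s * p s)"
    using mult_nonneg_nonneg[OF assms(2) less_imp_le[OF p0(1)]] distrib_right[of s d "p 0"]
    unfolding exp_gt_tilde_eq by linarith
  moreover have "exp (s * p s) \<le> \<phi> s + 1 + (1 + \<phi> s / \<phi> 1)"
  proof -
    have "exp (s * p s) = \<phi> s + 1 + s * p 0" by (simp add: exp_gt_tilde_eq)
    moreover have "s * p 0 \<le> s" using p0 assms by (simp add: mult_left_le)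
    ultimately show ?thesis using linear_growth[OF assms(1)] by linarith
  qed
  then have "2 * d * exp (s * p s) \<le> 2 * d * (\<phi> s + 1 + (1 + \<phi> s / \<phi> 1))"
    using assms by (intro mult_left_mono) auto
  ultimately have "\<phi> (s + d) \<le> \<phi> s + 2 * d * (\<phi> s + 1 + (1 + \<phi> s / \<phi> 1))" by linarith
  also have "2 * d * (\<phi> s + 1 + (1 + \<phi> s / \<phi> 1)) = 4 * d + d * (2 * \<phi> s + 2 / \<phi> 1 * \<phi> s)"
    by (simp add: algebra_simps)
  also have "d * (2 * \<phi> s + 2 / \<phi> 1 * \<phi> s) \<le> 1 * (2 * \<phi> s + 2 / \<phi> 1 * \<phi> s)"
    using assms \<phi>_nonneg[OF assms(1)] \<phi>_1_pos by (intro mult_right_mono) auto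
  finally have "\<phi> (s + d) \<le> \<phi> s + (4 * d + (2 * \<phi> s + 2 / \<phi> 1 * \<phi> s))" by simp
  \<comment> \<open>At this point the coefficients are \<open>3 + 2 / \<phi> 1\<close> for
    \<open>\<phi> s\<close> and 4 for \<open>d\<close>; the 7 is the crude sum of 3 and 4.\<close>
  moreover have "0 \<le> 2 / \<phi> 1 * d" using assms \<phi>_1_pos by simp
  ultimately show ?thesis
    using \<phi>_nonneg[OF assms(1)] assms by (simp add: algebra_simps add_divide_distrib)
qed

lemma isCont_\<phi>: "0 \<le> t \<Longrightarrow> isCont \<phi> t"
  using \<phi>_deriv DERIV_isCont by blast

lemma \<phi>_measurable: "\<phi> \<in> borel_measurable borel"
  unfolding exp_gt_tilde_def[abs_def] exp_gt_def[abs_def] by measurable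

end

subsection \<open>Passage to the limit\<close>

lemma continuous_on_space_deriv:
  fixes B :: "real \<times> (real^'n) \<Rightarrow> real^'m"
  assumes "smooth_on B U"
  shows "continuous_on U (space_deriv B)"
proof -
  have "continuous_on U (\<lambda>z. \<chi> k j. frechet_derivative B (at z) (0, axis j 1) $ k)"
    by (intro continuous_on_vec_lambda continuous_on_component
        smooth_on_imp_continuous_on[OF smooth_on_frechet_derivative[OF assms]])
  then show ?thesis
    by (rule continuous_on_eq) (simp add: space_deriv_eq[OF smooth_on_has_derivative[OF assms]])
qed

text \<open>Truncating \<open>p\<close> at \<open>(C + 1) f\<close> makes dominated convergence applicable; the excess is at most
  \<open>C |q - f|\<close>.\<close>

lemma L1_convergence_dominated:
  fixes p q :: "nat \<Rightarrow> 'a \<Rightarrow> real" and f :: "'a \<Rightarrow> real"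
  assumes [measurable]: "\<And>h. p h \<in> borel_measurable M" "\<And>h. q h \<in> borel_measurable M" "f \<in> borel_measurable M"
    and nn: "\<And>z. 0 \<le> f z" "\<And>h z. 0 \<le> p h z" and C: "0 \<le> C" "\<And>h z. p h z \<le> C * q h z"
    and fin: "(\<integral>\<^sup>+z. ennreal (f z) \<partial>M) < \<infinity>"
    and q: "(\<lambda>h. \<integral>\<^sup>+z. ennreal \<bar>q h z - f z\<bar> \<partial>M) \<longlonglongrightarrow> 0"
    and ae: "AE z in M. (\<lambda>h. p h z) \<longlonglongrightarrow> f z"
  shows "(\<lambda>h. \<integral>\<^sup>+z. ennreal \<bar>p h z - f z\<bar> \<partial>M) \<longlonglongrightarrow> 0"
proof -
  \<comment> \<open>The extra 1 guarantees \<open>f \<le> T\<close> even if \<open>C < 1\<close>, so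
    that truncation does not alter the limit.\<close>
  define T where "T z = (C + 1) * f z" for z
  have [measurable]: "T \<in> borel_measurable M" unfolding T_def[abs_def] by measurable
  have T: "f z \<le> T z" "0 \<le> T z" for z using nn(1)[of z] C(1) by (auto simp: T_def algebra_simps)
  have le: "\<bar>p h z - f z\<bar> \<le> C * \<bar>q h z - f z\<bar> + \<bar>min (p h z) (T z) - f z\<bar>" for h z
  proof (cases "p h z \<le> T z")
    case True
    then show ?thesis using C(1) by simp
  next
    case False
    have "C * (q h z - f z) \<le> C * \<bar>q h z - f z\<bar>" using C(1) by (intro mult_left_mono) auto
    then have "p h z - f z \<le> C * \<bar>q h z - f z\<bar> + (T z - f z)"
      using C(2)[of h z] nn(1)[of z] by (simp add: T_def algebra_simps)
    moreover have "f z \<le> p h z" using False T(1)[of z] by simp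
    moreover have "min (p h z) (T z) = T z" using False by simp
    ultimately show ?thesis using T(1)[of z] by simp
  qed
  have "(\<lambda>h. \<integral>\<^sup>+z. ennreal \<bar>min (p h z) (T z) - f z\<bar> \<partial>M) \<longlonglongrightarrow> (\<integral>\<^sup>+z. 0 \<partial>M)"
  proof (rule nn_integral_dominated_convergence[where w="\<lambda>z. ennreal (C + 2) * ennreal (f z)"])
    show "(\<integral>\<^sup>+z. ennreal (C + 2) * ennreal (f z) \<partial>M) < \<infinity>"
      using fin by (simp add: nn_integral_cmult ennreal_mult_less_top)
    show "AE z in M. ennreal \<bar>min (p h z) (T z) - f z\<bar> \<le> ennreal (C + 2) * ennreal (f z)" for h
    proof (rule AE_I2)
      fix z
      have "0 \<le> min (p h z) (T z)" "min (p h z) (T z) \<le> T z" using nn(2)[of h z] T(2)[of z] by auto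
      moreover have "T z + f z = (C + 2) * f z" by (simp add: T_def algebra_simps)
      ultimately have "\<bar>min (p h z) (T z) - f z\<bar> \<le> (C + 2) * f z" using nn(1)[of z] T(1)[of z] by linarith
      then show "ennreal \<bar>min (p h z) (T z) - f z\<bar> \<le> ennreal (C + 2) * ennreal (f z)"
        using C(1) nn(1)[of z] by (subst ennreal_mult[symmetric]) (auto intro: ennreal_leI)
    qed
    show "AE z in M. (\<lambda>h. ennreal \<bar>min (p h z) (T z) - f z\<bar>) \<longlonglongrightarrow> 0"
      using ae
    proof eventually_elim
      case (elim z)
      have "(\<lambda>h. \<bar>min (p h z) (T z) - f z\<bar>) \<longlonglongrightarrow> \<bar>min (f z) (T z) - f z\<bar>"
        by (intro tendsto_intros elim)
      then have "(\<lambda>h. ennreal \<bar>min (p h z) (T z) - f z\<bar>) \<longlonglongrightarrow> ennreal \<bar>min (f z) (T z) - f z\<bar>"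
        by (rule tendsto_ennrealI)
      then show ?case using T(1)[of z] by simp
    qed
  qed auto
  then have 1: "(\<lambda>h. \<integral>\<^sup>+z. ennreal \<bar>min (p h z) (T z) - f z\<bar> \<partial>M) \<longlonglongrightarrow> 0" by simp
  have "(\<lambda>h. ennreal C * (\<integral>\<^sup>+z. ennreal \<bar>q h z - f z\<bar> \<partial>M)) \<longlonglongrightarrow> ennreal C * 0"
    by (intro ennreal_tendsto_cmult q) simp
  from tendsto_add[OF this 1]
  have lim: "(\<lambda>h. ennreal C * (\<integral>\<^sup>+z. ennreal \<bar>q h z - f z\<bar> \<partial>M) + (\<integral>\<^sup>+z. ennreal \<bar>min (p h z) (T z) - f z\<bar> \<partial>M)) \<longlonglongrightarrow> 0"
    by simp
  show ?thesis
  proof (rule tendsto_sandwich[OF _ _ tendsto_const lim])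
    show "\<forall>\<^sub>F h in sequentially. (\<integral>\<^sup>+z. ennreal \<bar>p h z - f z\<bar> \<partial>M) \<le>
      ennreal C * (\<integral>\<^sup>+z. ennreal \<bar>q h z - f z\<bar> \<partial>M) + (\<integral>\<^sup>+z. ennreal \<bar>min (p h z) (T z) - f z\<bar> \<partial>M)"
    proof (rule always_eventually, rule allI)
      fix h
      have "(\<integral>\<^sup>+z. ennreal \<bar>p h z - f z\<bar> \<partial>M) \<le>
        (\<integral>\<^sup>+z. ennreal C * ennreal \<bar>q h z - f z\<bar> + ennreal \<bar>min (p h z) (T z) - f z\<bar> \<partial>M)"
        using le C(1) by (intro nn_integral_mono) (simp add: ennreal_leI flip: ennreal_mult ennreal_plus)
      also have "\<dots> = ennreal C * (\<integral>\<^sup>+z. ennreal \<bar>q h z - f z\<bar> \<partial>M) + (\<integral>\<^sup>+z. ennreal \<bar>min (p h z) (T z) - f z\<bar> \<partial>M)"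
        by (simp add: nn_integral_add nn_integral_cmult)
      finally show "(\<integral>\<^sup>+z. ennreal \<bar>p h z - f z\<bar> \<partial>M) \<le>
        ennreal C * (\<integral>\<^sup>+z. ennreal \<bar>q h z - f z\<bar> \<partial>M) + (\<integral>\<^sup>+z. ennreal \<bar>min (p h z) (T z) - f z\<bar> \<partial>M)" .
    qed
  qed auto
qed

lemma nn_integral_finite_of_close:
  fixes p f :: "'a \<Rightarrow> real"
  assumes [measurable]: "p \<in> borel_measurable M" "f \<in> borel_measurable M"
    and "(\<integral>\<^sup>+z. ennreal \<bar>p z - f z\<bar> \<partial>M) < \<infinity>" "(\<integral>\<^sup>+z. ennreal (f z) \<partial>M) < \<infinity>" "\<And>z. 0 \<le> f z"
  shows "(\<integral>\<^sup>+z. ennreal (p z) \<partial>M) < \<infinity>"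
proof -
  have "(\<integral>\<^sup>+z. ennreal (p z) \<partial>M) \<le> (\<integral>\<^sup>+z. ennreal \<bar>p z - f z\<bar> + ennreal (f z) \<partial>M)"
    using assms(5) by (intro nn_integral_mono) (simp add: ennreal_leI flip: ennreal_plus)
  also have "\<dots> = (\<integral>\<^sup>+z. ennreal \<bar>p z - f z\<bar> \<partial>M) + (\<integral>\<^sup>+z. ennreal (f z) \<partial>M)"
    by (intro nn_integral_add) auto
  also have "\<dots> < \<infinity>" using assms(3,4) by simp
  finally show ?thesis .
qed

text \<open>Composing with \<open>\<phi>\<close> calls for pointwise convergence, while L^1
  convergence of the derivatives gives it only along a subsequence \<open>r\<close>. Passing to it
  is free, because \<open>h \<le> r h\<close> keeps every accuracy below
  \<open>1 / real (Suc h)\<close>.\<close>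

lemma smoothing_sequence:
  fixes U :: "(real \<times> (real^'n)) set" and b :: "real \<times> (real^'n) \<Rightarrow> real^'m"
    and G :: "real \<times> (real^'n) \<Rightarrow> real^'n^'m" and w :: "real \<times> (real^'n) \<Rightarrow> real" and \<phi> :: "real \<Rightarrow> real"
  assumes U: "open U" and b: "continuous_on U b"
    and Gm [measurable]: "G \<in> borel_measurable borel"
    and Gloc: "\<And>K. compact K \<Longrightarrow> K \<subseteq> U \<Longrightarrow> integrable lborel (\<lambda>z. indicator K z *\<^sub>R G z)"
    and weak: "weak_space_deriv U b G"
    and wm [measurable]: "w \<in> borel_measurable borel"
    and wb: "\<And>K. compact K \<Longrightarrow> K \<subseteq> U \<Longrightarrow> \<exists>c C. 0 < c \<and> c \<le> C \<and> (\<forall>z\<in>K. c \<le> w z \<and> w z \<le> C)"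
    and \<phi>m [measurable]: "\<phi> \<in> borel_measurable borel"
    and \<phi>nn: "\<And>s. 0 \<le> s \<Longrightarrow> 0 \<le> \<phi> s"
    and \<phi>mono: "\<And>s t. 0 \<le> s \<Longrightarrow> s \<le> t \<Longrightarrow> \<phi> s \<le> \<phi> t"
    and line: "\<And>s. 0 \<le> s \<Longrightarrow> \<exists>a. \<forall>t\<ge>0. \<phi> s + a * (t - s) \<le> \<phi> t"
    and C: "0 \<le> C" "\<And>s d. 0 \<le> s \<Longrightarrow> 0 \<le> d \<Longrightarrow> d \<le> 1 \<Longrightarrow> \<phi> (s + d) \<le> C * (\<phi> s + d)"
    and cont: "\<And>s. 0 \<le> s \<Longrightarrow> isCont \<phi> s"
    and energy: "(\<integral>\<^sup>+z. ennreal (w z * \<phi> (norm (G z))) * indicator U z \<partial>lborel) < \<infinity>"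
  obtains bh where "\<And>h. smooth_on (bh h) U"
    "\<And>h z. z \<in> U \<Longrightarrow> norm (bh h z - b z) \<le> 1 / real (Suc h)"
    "(\<lambda>h. \<integral>\<^sup>+z. ennreal (norm (space_deriv (bh h) z - G z)) * indicator U z \<partial>lborel) \<longlonglongrightarrow> 0"
    "(\<lambda>h. \<integral>\<^sup>+z. ennreal \<bar>w z * \<phi> (norm (space_deriv (bh h) z)) - w z * \<phi> (norm (G z))\<bar> * indicator U z \<partial>lborel) \<longlonglongrightarrow> 0"
    "\<And>h. (\<integral>\<^sup>+z. ennreal (w z * \<phi> (norm (space_deriv (bh h) z))) * indicator U z \<partial>lborel) < \<infinity>"
    "(\<lambda>h. \<integral>\<^sup>+z. ennreal (w z * \<phi> (norm (space_deriv (bh h) z))) * indicator U z \<partial>lborel)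
      \<longlonglongrightarrow> (\<integral>\<^sup>+z. ennreal (w z * \<phi> (norm (G z))) * indicator U z \<partial>lborel)"
proof -
  have [measurable]: "U \<in> sets borel" using U by simp
  define e where "e k = 1 / real (Suc k)" for k
  have e: "0 < e k" "e k \<le> 1" for k by (auto simp: e_def)
  define good where "good k B q \<longleftrightarrow> smooth_on B U \<and> (\<forall>z\<in>U. norm (B z - b z) \<le> e k) \<and>
    (\<integral>\<^sup>+z. ennreal (norm (space_deriv B z - G z)) * indicator U z \<partial>lborel) \<le> ennreal (e k) \<and>
    q \<in> borel_measurable borel \<and> (\<forall>z\<in>U. w z * \<phi> (norm (space_deriv B z)) \<le> C * q z) \<and>
    (\<integral>\<^sup>+z. ennreal \<bar>q z - w z * \<phi> (norm (G z))\<bar> * indicator U z \<partial>lborel) \<le> ennreal (e k)" for k B q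
  have "\<forall>k. \<exists>B q. good k B q"
    unfolding good_def
    by (intro allI glued_mollification[OF U b Gm Gloc weak wm wb \<phi>m \<phi>nn \<phi>mono line C energy e])
  from choice[OF this] obtain B where "\<forall>k. \<exists>q. good k (B k) q" ..
  from choice[OF this] obtain q where "\<forall>k. good k (B k) (q k)" ..
  then have good: "good k (B k) (q k)" for k by (rule spec)
  have smB: "smooth_on (B k) U" and closeB: "\<forall>z\<in>U. norm (B k z - b z) \<le> e k"
    and dG: "(\<integral>\<^sup>+z. ennreal (norm (space_deriv (B k) z - G z)) * indicator U z \<partial>lborel) \<le> ennreal (e k)"
    and [measurable]: "q k \<in> borel_measurable borel"
    and dom: "\<forall>z\<in>U. w z * \<phi> (norm (space_deriv (B k) z)) \<le> C * q k z"
    and dq: "(\<integral>\<^sup>+z. ennreal \<bar>q k z - w z * \<phi> (norm (G z))\<bar> * indicator U z \<partial>lborel) \<le> ennreal (e k)" for k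
    using good[of k] unfolding good_def by blast+
  \<comment> \<open>Off \<open>U\<close> nothing is known about \<open>space_deriv (B k)\<close>;
    truncation makes it Borel on the whole space.\<close>
  define g where "g k z = indicator U z *\<^sub>R space_deriv (B k) z" for k z
  have [measurable]: "g k \<in> borel_measurable borel" for k
    unfolding g_def[abs_def]
    by (rule borel_measurable_continuous_on_indicator[OF _ continuous_on_space_deriv[OF smB]]) simp
  have g: "g k z = space_deriv (B k) z" if "z \<in> U" for k z using that by (simp add: g_def)
  have w0: "0 \<le> w z" if "z \<in> U" for z using wb[of "{z}"] that by force
  define f where "f z = indicator U z * (w z * \<phi> (norm (G z)))" for z
  define p where "p k z = indicator U z * (w z * \<phi> (norm (g k z)))" for k z
  define q' where "q' k z = indicator U z * q k z" for k z
  have [measurable]: "f \<in> borel_measurable borel" "p k \<in> borel_measurable borel" "q' k \<in> borel_measurable borel" for k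
    unfolding f_def[abs_def] p_def[abs_def] q'_def[abs_def] by measurable
  have nn: "0 \<le> f z" "0 \<le> p k z" for k z
    using w0[of z] \<phi>nn by (auto simp: f_def p_def indicator_def)
  have f_int: "(\<integral>\<^sup>+z. ennreal (f z) \<partial>lborel) = (\<integral>\<^sup>+z. ennreal (w z * \<phi> (norm (G z))) * indicator U z \<partial>lborel)"
    by (intro nn_integral_cong) (simp add: f_def indicator_def)
  have p_int: "(\<integral>\<^sup>+z. ennreal (p k z) \<partial>lborel) = (\<integral>\<^sup>+z. ennreal (w z * \<phi> (norm (space_deriv (B k) z))) * indicator U z \<partial>lborel)" for k
    by (intro nn_integral_cong) (simp add: p_def indicator_def g)
  have pf_int: "(\<integral>\<^sup>+z. ennreal \<bar>p k z - f z\<bar> \<partial>lborel) =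
      (\<integral>\<^sup>+z. ennreal \<bar>w z * \<phi> (norm (space_deriv (B k) z)) - w z * \<phi> (norm (G z))\<bar> * indicator U z \<partial>lborel)" for k
    by (intro nn_integral_cong) (simp add: p_def f_def indicator_def g)
  have qf_int: "(\<integral>\<^sup>+z. ennreal \<bar>q' k z - f z\<bar> \<partial>lborel) =
      (\<integral>\<^sup>+z. ennreal \<bar>q k z - w z * \<phi> (norm (G z))\<bar> * indicator U z \<partial>lborel)" for k
    by (intro nn_integral_cong) (simp add: q'_def f_def indicator_def)
  define v where "v k z = g k z - indicator U z *\<^sub>R G z" for k z
  have [measurable]: "v k \<in> borel_measurable borel" for k unfolding v_def[abs_def] by measurable
  have v_int: "(\<integral>\<^sup>+z. ennreal (norm (v k z)) \<partial>lborel) =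
      (\<integral>\<^sup>+z. ennreal (norm (space_deriv (B k) z - G z)) * indicator U z \<partial>lborel)" for k
    by (intro nn_integral_cong) (simp add: v_def g_def indicator_def)
  have v: "integrable lborel (v k)" for k
    using dG[of k] by (intro integrableI_bounded) (auto simp: v_int intro: le_less_trans)
  have e0: "e \<longlonglongrightarrow> 0" unfolding e_def[abs_def] by (rule LIMSEQ_Suc[OF lim_1_over_n])
  have "(LINT z|lborel. norm (v k z)) \<le> e k" for k
  proof -
    have "ennreal (LINT z|lborel. norm (v k z)) \<le> ennreal (e k)"
      using nn_integral_eq_integral[OF integrable_norm[OF v[of k]]] dG[of k] by (simp add: v_int)
    then show ?thesis using e(1)[of k] by (simp add: ennreal_le_iff)
  qed
  then have "(\<lambda>k. LINT z|lborel. norm (v k z)) \<longlonglongrightarrow> 0"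
    by (intro tendsto_sandwich[OF _ _ tendsto_const e0] always_eventually) auto
  from tendsto_L1_AE_subseq[OF v this]
  obtain r where r: "strict_mono r" "AE z in lborel. (\<lambda>n. v (r n) z) \<longlonglongrightarrow> 0" by blast
  have er: "e (r h) \<le> 1 / real (Suc h)" for h
    using seq_suble[OF r(1), of h] by (simp add: e_def field_simps)
  have er0: "(\<lambda>h. ennreal (e (r h))) \<longlonglongrightarrow> 0"
    using tendsto_ennrealI[OF LIMSEQ_subseq_LIMSEQ[OF e0 r(1)]] by (simp add: o_def)
  have conv: "(\<lambda>h. \<integral>\<^sup>+z. ennreal \<bar>p (r h) z - f z\<bar> \<partial>lborel) \<longlonglongrightarrow> 0"
  proof (rule L1_convergence_dominated[where q="\<lambda>h. q' (r h)" and C=C])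
    show "p (r h) z \<le> C * q' (r h) z" for h z
      using dom[of "r h"] by (auto simp: p_def q'_def indicator_def g)
    show "(\<lambda>h. \<integral>\<^sup>+z. ennreal \<bar>q' (r h) z - f z\<bar> \<partial>lborel) \<longlonglongrightarrow> 0"
      by (rule tendsto_sandwich[OF _ _ tendsto_const er0]) (auto simp: qf_int dq)
    show "AE z in lborel. (\<lambda>h. p (r h) z) \<longlonglongrightarrow> f z"
      using r(2)
    proof eventually_elim
      case (elim z)
      show ?case
      proof (cases "z \<in> U")
        case True
        have "(\<lambda>h. g (r h) z - G z) \<longlonglongrightarrow> 0" using elim True by (simp add: v_def)
        then have "(\<lambda>h. norm (g (r h) z)) \<longlonglongrightarrow> norm (G z)"
          by (intro tendsto_norm) (simp add: LIM_zero_iff)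
        then have "(\<lambda>h. \<phi> (norm (g (r h) z))) \<longlonglongrightarrow> \<phi> (norm (G z))"
          by (rule isCont_tendsto_compose[OF cont[OF norm_ge_zero]])
        then show ?thesis using True by (simp add: p_def f_def tendsto_mult_left)
      qed (simp add: p_def f_def)
    qed
  qed (use nn C(1) energy f_int in auto)
  \<comment> \<open>The majorant has finite L^1 distance to \<open>f\<close>, so each single energy
    is finite; L^1 convergence then yields convergence of the integrals.\<close>
  have fin: "(\<integral>\<^sup>+z. ennreal (p k z) \<partial>lborel) < \<infinity>" for k
  proof -
    have "(\<integral>\<^sup>+z. ennreal \<bar>q' k z - f z\<bar> \<partial>lborel) < \<infinity>"
      using le_less_trans[OF dq[of k]] by (simp add: qf_int)
    then have "(\<integral>\<^sup>+z. ennreal (q' k z) \<partial>lborel) < \<infinity>"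
      by (rule nn_integral_finite_of_close[rotated 2]) (use nn energy f_int in auto)
    moreover have "(\<integral>\<^sup>+z. ennreal (p k z) \<partial>lborel) \<le> (\<integral>\<^sup>+z. ennreal C * ennreal (q' k z) \<partial>lborel)"
      using dom[of k] C(1)
      by (intro nn_integral_mono) (auto simp: p_def q'_def indicator_def g ennreal_leI simp flip: ennreal_mult')
    ultimately show ?thesis
      by (simp add: nn_integral_cmult ennreal_mult_less_top le_less_trans)
  qed
  have p: "integrable lborel (p k)" and f: "integrable lborel f" for k
    using fin[of k] energy nn f_int by (auto intro!: integrableI_nonneg)
  have "(\<lambda>h. LINT z|lborel. p (r h) z) \<longlonglongrightarrow> (LINT z|lborel. f z)"
    by (rule tendsto_L1_int[OF p f]) (use conv in simp)
  then have "(\<lambda>h. ennreal (LINT z|lborel. p (r h) z)) \<longlonglongrightarrow> ennreal (LINT z|lborel. f z)"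
    by (rule tendsto_ennrealI)
  then have "(\<lambda>h. \<integral>\<^sup>+z. ennreal (p (r h) z) \<partial>lborel) \<longlonglongrightarrow> (\<integral>\<^sup>+z. ennreal (f z) \<partial>lborel)"
    using nn by (simp add: nn_integral_eq_integral[OF p] nn_integral_eq_integral[OF f])
  note energies = this[unfolded p_int f_int]
  show thesis
  proof (rule that[of "\<lambda>h. B (r h)"])
    show "smooth_on (B (r h)) U" for h by (rule smB)
    show "norm (B (r h) z - b z) \<le> 1 / real (Suc h)" if "z \<in> U" for h z
      using closeB[of "r h"] that er[of h] by force
    show "(\<lambda>h. \<integral>\<^sup>+z. ennreal (norm (space_deriv (B (r h)) z - G z)) * indicator U z \<partial>lborel) \<longlonglongrightarrow> 0"
      by (rule tendsto_sandwich[OF _ _ tendsto_const er0]) (auto simp: dG)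
    show "(\<lambda>h. \<integral>\<^sup>+z. ennreal \<bar>w z * \<phi> (norm (space_deriv (B (r h)) z)) - w z * \<phi> (norm (G z))\<bar> * indicator U z \<partial>lborel) \<longlonglongrightarrow> 0"
      using conv by (simp add: pf_int)
    show "(\<integral>\<^sup>+z. ennreal (w z * \<phi> (norm (space_deriv (B (r h)) z))) * indicator U z \<partial>lborel) < \<infinity>" for h
      using fin[of "r h"] by (simp add: p_int)
  qed (rule energies)
qed

subsection \<open>Slices and iterated integrals\<close>

text \<open>\<open>Db\<close> is only Lebesgue measurable, whereas convolutions and Fubini are
  carried out with Borel functions; the representative is assembled coordinate by
  coordinate.\<close>

lemma lebesgue_measurable_borel_representative:
  fixes f :: "'a::euclidean_space \<Rightarrow> 'b::euclidean_space"
  assumes "f \<in> borel_measurable lebesgue"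
  obtains g where "g \<in> borel_measurable borel" "AE z in lborel. f z = g z"
proof -
  have "\<forall>i. \<exists>h. h \<in> borel_measurable lborel \<and> (AE z in lborel. f z \<bullet> i = h z)"
  proof
    fix i
    have "(\<lambda>z. f z \<bullet> i) \<in> borel_measurable (completion lborel)"
      using assms by (intro borel_measurable_inner) auto
    from completion_ex_borel_measurable_real[OF this]
    show "\<exists>h. h \<in> borel_measurable lborel \<and> (AE z in lborel. f z \<bullet> i = h z)" by blast
  qed
  from choice[OF this] obtain h where
    h: "\<forall>i. h i \<in> borel_measurable lborel \<and> (AE z in lborel. f z \<bullet> i = h i z)" ..
  show thesis
  proof (rule that[of "\<lambda>z. \<Sum>i\<in>Basis. h i z *\<^sub>R i"])
    show "(\<lambda>z. \<Sum>i\<in>Basis. h i z *\<^sub>R i) \<in> borel_measurable borel"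
      using h by (intro borel_measurable_sum borel_measurable_scaleR) auto
    have "AE z in lborel. \<forall>i\<in>Basis. f z \<bullet> i = h i z"
      using h by (intro AE_finite_allI) auto
    then show "AE z in lborel. f z = (\<Sum>i\<in>Basis. h i z *\<^sub>R i)"
    proof eventually_elim
      case (elim z)
      then have "(\<Sum>i\<in>Basis. h i z *\<^sub>R i) = (\<Sum>i\<in>Basis. (f z \<bullet> i) *\<^sub>R i)" by (intro sum.cong) auto
      then show ?case by (simp add: euclidean_representation)
    qed
  qed
qed

lemma borel_measurable_vec_component [measurable]:
  fixes f :: "'a \<Rightarrow> 'b::euclidean_space ^ 'k"
  assumes "f \<in> borel_measurable M"
  shows "(\<lambda>x. f x $ k) \<in> borel_measurable M"
proof -
  have "(\<lambda>v::'b^'k. v $ k) \<in> borel_measurable borel"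
    by (intro borel_measurable_continuous_onI continuous_on_component continuous_on_id)
  from measurable_compose[OF assms this] show ?thesis .
qed

lemma borel_measurable_slice:
  fixes f :: "'a::euclidean_space \<times> 'b::euclidean_space \<Rightarrow> 'c::topological_space"
  assumes "f \<in> borel_measurable borel"
  shows "(\<lambda>x. f (t, x)) \<in> borel_measurable borel"
proof -
  have "(\<lambda>x::'b. (t, x)) \<in> borel_measurable borel"
    by (intro borel_measurable_continuous_onI continuous_intros)
  from measurable_compose[OF this assms] show ?thesis .
qed

lemma AE_lborel_pair:
  fixes P :: "'a::euclidean_space \<times> 'b::euclidean_space \<Rightarrow> bool"
  assumes "AE z in lborel. P z"
  shows "AE t in lborel. AE x in lborel. P (t, x)"
  by (rule lborel_pair.AE_pair) (use assms in \<open>simp only: lborel_prod\<close>)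

text \<open>Lebesgue measure on a product is the completion of the product measure and not the
  product of the completions, so Fubini is applied to a Borel representative, which agrees with
  \<open>f\<close> almost everywhere on almost every slice.\<close>

lemma nn_integral_lebesgue_iterated:
  fixes f :: "'a::euclidean_space \<times> 'b::euclidean_space \<Rightarrow> ennreal"
  assumes "f \<in> borel_measurable lebesgue"
  shows "(\<integral>\<^sup>+t. \<integral>\<^sup>+x. f (t, x) \<partial>lebesgue \<partial>lebesgue) = (\<integral>\<^sup>+z. f z \<partial>lborel)"
proof -
  obtain f' where f' [measurable]: "f' \<in> borel_measurable lborel" and ae: "AE z in lborel. f z = f' z"
    using completion_ex_borel_measurable[OF assms] by blast
  have "(\<integral>\<^sup>+t. \<integral>\<^sup>+x. f (t, x) \<partial>lebesgue \<partial>lebesgue) = (\<integral>\<^sup>+t. \<integral>\<^sup>+x. f (t, x) \<partial>lborel \<partial>lborel)"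
    by (simp add: nn_integral_completion)
  also have "\<dots> = (\<integral>\<^sup>+t. \<integral>\<^sup>+x. f' (t, x) \<partial>lborel \<partial>lborel)"
    using AE_lborel_pair[OF ae] by (intro nn_integral_cong_AE) (auto intro: nn_integral_cong_AE)
  also have "\<dots> = (\<integral>\<^sup>+z. f' z \<partial>(lborel \<Otimes>\<^sub>M lborel))"
    by (rule lborel.nn_integral_fst) (use f' in \<open>simp only: lborel_prod\<close>)
  also have "\<dots> = (\<integral>\<^sup>+z. f z \<partial>lborel)"
    unfolding lborel_prod using ae by (intro nn_integral_cong_AE) auto
  finally show ?thesis .
qed

lemma nn_integral_Times_iterated:
  fixes f :: "'a::euclidean_space \<times> 'b::euclidean_space \<Rightarrow> ennreal"
  assumes "(\<lambda>z. f z * indicator (A \<times> B) z) \<in> borel_measurable lebesgue"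
  shows "(\<integral>\<^sup>+t\<in>A. (\<integral>\<^sup>+x\<in>B. f (t, x) \<partial>lebesgue) \<partial>lebesgue) = (\<integral>\<^sup>+z. f z * indicator (A \<times> B) z \<partial>lborel)"
proof -
  have "(\<integral>\<^sup>+x\<in>B. f (t, x) \<partial>lebesgue) * indicator A t = (\<integral>\<^sup>+x. f (t, x) * indicator (A \<times> B) (t, x) \<partial>lebesgue)" for t
    by (cases "t \<in> A") (auto simp: indicator_times)
  then show ?thesis using nn_integral_lebesgue_iterated[OF assms] by simp
qed

lemma L1_tendsto_onI:
  fixes f :: "'a::euclidean_space \<Rightarrow> 'b::euclidean_space"
  assumes F: "\<And>h. set_integrable lebesgue S (F h)" and f: "set_integrable lebesgue S f"
    and lim: "(\<lambda>h. \<integral>\<^sup>+z. ennreal (norm (F h z - f z)) * indicator S z \<partial>lborel) \<longlonglongrightarrow> 0"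
  shows "L1_tendsto_on S F f"
proof -
  have i: "integrable lebesgue (\<lambda>z. indicator S z *\<^sub>R norm (F h z - f z))" for h
    using set_integrable_norm[OF set_integral_diff(1)[OF F f]] by (simp add: set_integrable_def)
  have "ennreal (LINT z:S|lebesgue. norm (F h z - f z)) = (\<integral>\<^sup>+z. ennreal (norm (F h z - f z)) * indicator S z \<partial>lborel)" for h
  proof -
    have "ennreal (LINT z:S|lebesgue. norm (F h z - f z)) = (\<integral>\<^sup>+z. ennreal (indicator S z *\<^sub>R norm (F h z - f z)) \<partial>lebesgue)"
      unfolding set_lebesgue_integral_def by (rule nn_integral_eq_integral[OF i, symmetric]) auto
    also have "\<dots> = (\<integral>\<^sup>+z. ennreal (norm (F h z - f z)) * indicator S z \<partial>lborel)"
      unfolding nn_integral_completion by (intro nn_integral_cong) (simp add: indicator_def)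
    finally show ?thesis .
  qed
  then have "(\<lambda>h. ennreal (LINT z:S|lebesgue. norm (F h z - f z))) \<longlonglongrightarrow> ennreal 0" using lim by simp
  then have "(\<lambda>h. LINT z:S|lebesgue. norm (F h z - f z)) \<longlonglongrightarrow> 0"
    by (rule tendsto_ennrealD) (auto simp: set_lebesgue_integral_def)
  then show ?thesis using F f by (simp add: L1_tendsto_on_def)
qed

lemma set_integrable_lebesgueI:
  fixes f :: "'a::euclidean_space \<Rightarrow> 'b::euclidean_space"
  assumes "set_borel_measurable lebesgue S f"
    and "(\<integral>\<^sup>+z. ennreal (norm (f z)) * indicator S z \<partial>lborel) < \<infinity>"
  shows "set_integrable lebesgue S f"
  unfolding set_integrable_def
proof (rule integrableI_bounded)
  show "(\<lambda>z. indicator S z *\<^sub>R f z) \<in> borel_measurable lebesgue"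
    using assms(1) by (simp add: set_borel_measurable_def)
  have "(\<integral>\<^sup>+z. ennreal (norm (indicator S z *\<^sub>R f z)) \<partial>lebesgue) = (\<integral>\<^sup>+z. ennreal (norm (f z)) * indicator S z \<partial>lborel)"
    unfolding nn_integral_completion by (intro nn_integral_cong) (simp add: indicator_def)
  then show "(\<integral>\<^sup>+z. ennreal (norm (indicator S z *\<^sub>R f z)) \<partial>lebesgue) < \<infinity>" using assms(2) by simp
qed

lemma set_integrable_continuous_compact:
  fixes f :: "'a::euclidean_space \<Rightarrow> 'b::euclidean_space"
  assumes "compact K" "continuous_on K f"
  shows "set_integrable lebesgue K f"
  unfolding set_integrable_def using borel_integrable_compact[OF assms] by (simp add: integrable_completion)

lemma smooth_supported_of_compact:
  assumes "smooth_on \<Psi> UNIV" "compact C" "\<And>z. z \<notin> C \<Longrightarrow> \<Psi> z = 0"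
  shows "\<exists>d. smooth_supported d \<Psi>"
proof -
  obtain d where "\<And>z. z \<in> C \<Longrightarrow> norm z \<le> d"
    using compact_imp_bounded[OF assms(2)] unfolding bounded_iff by auto
  then show ?thesis using assms unfolding smooth_supported_def by (meson not_le)
qed

text \<open>A slice is the composition with an affine embedding, and its support lies in the
  projection of \<open>C\<close>, a compact subset of \<open>S\<close>.\<close>

lemma test_function_slice:
  fixes \<Psi> :: "real \<times> (real^'n) \<Rightarrow> real"
  assumes \<Psi>: "smooth_on \<Psi> UNIV" and C: "compact C" "C \<subseteq> I \<times> S" and zero: "\<And>z. z \<notin> C \<Longrightarrow> \<Psi> z = 0"
  shows "test_function_on S (\<lambda>x. \<Psi> (t, x))"
    "frechet_derivative (\<lambda>x. \<Psi> (t, x)) (at x) v = frechet_derivative \<Psi> (at (t, x)) (0, v)"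
proof -
  have "times_differentiable_on k (\<lambda>x. \<Psi> ((t, 0) + (0, x))) UNIV" for k
    by (rule times_differentiable_on_affine)
      (use \<Psi> in \<open>auto simp: smooth_on_def intro: bounded_linear_Pair bounded_linear_zero bounded_linear_ident\<close>)
  then have "smooth_on (\<lambda>x. \<Psi> (t, x)) UNIV" by (simp add: smooth_on_def)
  moreover have sub: "closure {x. \<Psi> (t, x) \<noteq> 0} \<subseteq> snd ` C"
    using C(1) zero by (intro closure_minimal compact_imp_closed compact_continuous_image continuous_intros) force+
  moreover have snd: "compact (snd ` C)" by (intro compact_continuous_image continuous_intros C)
  moreover have "snd ` C \<subseteq> S" using C(2) by auto
  moreover have "compact (closure {x. \<Psi> (t, x) \<noteq> 0})"
    using compact_Int_closed[OF snd closed_closure, of "{x. \<Psi> (t, x) \<noteq> 0}"] sub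
    by (simp add: Int_absorb1)
  ultimately show "test_function_on S (\<lambda>x. \<Psi> (t, x))"
    unfolding test_function_on_def by (intro conjI) (assumption | blast)+
  have "((\<lambda>x. (t, x)) has_derivative (\<lambda>v. (0, v))) (at x)"
    by (auto intro!: derivative_eq_intros)
  from has_derivative_compose[OF this smooth_on_has_derivative[OF \<Psi> UNIV_I]]
  show "frechet_derivative (\<lambda>x. \<Psi> (t, x)) (at x) v = frechet_derivative \<Psi> (at (t, x)) (0, v)"
    using frechet_derivative_at by metis
qed

text \<open>For almost every \<open>t\<close> the slicewise identity is tested with
  \<open>x \<mapsto> \<Psi> (t, x)\<close>, and the result is integrated over \<open>t\<close>. The
  Borel function \<open>G\<close> replaces \<open>Db\<close> so that Fubini applies
  directly.\<close>

lemma weak_space_deriv_of_slices: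
  fixes b :: "real \<times> (real^'n) \<Rightarrow> real^'m" and Db G :: "real \<times> (real^'n) \<Rightarrow> real^'n^'m"
  assumes b: "continuous_on (I \<times> S) b" and S: "open S"
    and slices: "AE t in lebesgue. t \<in> I \<longrightarrow> W11_loc_with_deriv S (\<lambda>x. b (t, x)) (\<lambda>x. Db (t, x))"
    and G [measurable]: "G \<in> borel_measurable borel"
    and Gloc: "\<And>K. compact K \<Longrightarrow> K \<subseteq> I \<times> S \<Longrightarrow> integrable lborel (\<lambda>z. indicator K z *\<^sub>R G z)"
    and ae: "AE z in lborel. z \<in> I \<times> S \<longrightarrow> G z = Db z"
  shows "weak_space_deriv (I \<times> S) b G"
  unfolding weak_space_deriv_def
proof (intro allI impI)
  fix \<Psi> :: "real \<times> (real^'n) \<Rightarrow> real" and C :: "(real \<times> (real^'n)) set" and k :: 'm and j :: 'n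
  assume \<Psi>: "smooth_on \<Psi> UNIV" and C: "compact C" "C \<subseteq> I \<times> S" and zero: "\<forall>z. z \<notin> C \<longrightarrow> \<Psi> z = 0"
  let ?D = "\<lambda>z. frechet_derivative \<Psi> (at z) (0, axis j 1)"
  obtain d where d: "smooth_supported d \<Psi>" using smooth_supported_of_compact[OF \<Psi> C(1)] zero by blast
  obtain M where M0: "0 \<le> M" and M: "\<And>z j. \<bar>frechet_derivative \<Psi> (at z) (0, axis j 1)\<bar> \<le> M * indicator C z"
    using bounded_space_derivative[OF \<Psi> C(1)] zero by blast
  have D0: "?D z = 0" if "z \<notin> C" for z using M[of z j] that by simp
  have [measurable]: "?D \<in> borel_measurable borel"
    by (rule smooth_supported_measurable[OF smooth_supported_derivative[OF d]])
  have [measurable]: "\<Psi> \<in> borel_measurable borel" by (rule smooth_supported_measurable[OF d])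
  have [measurable]: "C \<in> sets borel" using C(1) borel_compact by blast
  obtain N where N0: "0 \<le> N" and N: "\<And>z. \<bar>\<Psi> z\<bar> \<le> N" using smooth_supported_bounded[OF d] by blast
  have bC: "integrable lborel (\<lambda>z. indicator C z *\<^sub>R b z)"
    by (rule borel_integrable_compact[OF C(1) continuous_on_subset[OF b C(2)]])
  note [measurable] = borel_measurable_integrable[OF bC]
  \<comment> \<open>The indicator confines \<open>b\<close> and \<open>G\<close> to a compact set
    where they are integrable; \<open>\<Psi>\<close> and its derivative vanish outside it
    anyway.\<close>
  define F1 where "F1 z = ?D z * (indicator C z *\<^sub>R b z) $ k" for z
  define F2 where "F2 z = \<Psi> z * (indicator C z *\<^sub>R G z) $ k $ j" for z
  have F: "F1 \<in> borel_measurable borel" "F2 \<in> borel_measurable borel"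
    unfolding F1_def[abs_def] F2_def[abs_def] by measurable
  have i1: "integrable lborel F1"
  proof -
    have "integrable lborel (\<lambda>z. M * norm (indicator C z *\<^sub>R b z))" 
      by (intro integrable_mult_right integrable_norm bC)
    then show ?thesis
    proof (rule Bochner_Integration.integrable_bound)
      show "F1 \<in> borel_measurable lborel" using F by simp
      have "\<bar>F1 z\<bar> \<le> \<bar>M * norm (indicator C z *\<^sub>R b z)\<bar>" for z
      proof (cases "z \<in> C")
        case True
        then have "\<bar>?D z\<bar> \<le> M" using M[of z j] by simp
        then have "\<bar>?D z\<bar> * \<bar>b z $ k\<bar> \<le> M * norm (b z)"
          by (intro mult_mono component_le_norm_cart) auto
        then show ?thesis using True M0 by (simp add: F1_def abs_mult)
      qed (simp add: F1_def)
      then show "AE z in lborel. norm (F1 z) \<le> norm (M * norm (indicator C z *\<^sub>R b z))" by simp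
    qed
  qed
  have i2: "integrable lborel F2"
  proof -
    have "integrable lborel (\<lambda>z. N * norm (indicator C z *\<^sub>R G z))" 
      by (intro integrable_mult_right integrable_norm Gloc[OF C])
    then show ?thesis
    proof (rule Bochner_Integration.integrable_bound)
      show "F2 \<in> borel_measurable lborel" using F by simp
      have "\<bar>F2 z\<bar> \<le> \<bar>N * norm (indicator C z *\<^sub>R G z)\<bar>" for z
      proof (cases "z \<in> C")
        case True
        have "\<bar>G z $ k $ j\<bar> \<le> norm (G z)"
          by (rule order_trans[OF component_le_norm_cart Finite_Cartesian_Product.norm_nth_le])
        then have "\<bar>\<Psi> z\<bar> * \<bar>G z $ k $ j\<bar> \<le> N * norm (G z)"
          using N[of z] by (intro mult_mono) auto
        then show ?thesis using True N0 by (simp add: F2_def abs_mult)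
      qed (simp add: F2_def)
      then show "AE z in lborel. norm (F2 z) \<le> norm (N * norm (indicator C z *\<^sub>R G z))" by simp
    qed
  qed
  have slice: "AE t in lborel. (LINT x|lborel. F1 (t, x)) = - (LINT x|lborel. F2 (t, x))"
    using AE_lborel_pair[OF ae] slices[unfolded AE_completion_iff]
  proof eventually_elim
    case (elim t)
    show ?case
    proof (cases "t \<in> I")
      case False
      then have "(t, x) \<notin> C" for x using C(2) by auto
      then show ?thesis by (simp add: F1_def F2_def)
    next
      case True
      have W: "locally_L1_on S (\<lambda>x. Db (t, x))"
        "(LINT x:S|lebesgue. b (t, x) $ k * ?D (t, x)) = - (LINT x:S|lebesgue. Db (t, x) $ k $ j * \<Psi> (t, x))"
        using elim(2) True test_function_slice[OF \<Psi> C, of t] zero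
        unfolding W11_loc_with_deriv_def by auto
      have "(LINT x|lborel. F1 (t, x)) = (LINT x|lebesgue. F1 (t, x))"
        by (rule integral_completion[symmetric]) (simp add: borel_measurable_slice[OF F(1)])
      also have "\<dots> = (LINT x:S|lebesgue. b (t, x) $ k * ?D (t, x))"
        unfolding set_lebesgue_integral_def
      proof (intro Bochner_Integration.integral_cong refl)
        fix x show "F1 (t, x) = indicator S x *\<^sub>R (b (t, x) $ k * ?D (t, x))"
          using D0[of "(t, x)"] C(2) by (cases "(t, x) \<in> C") (auto simp: F1_def)
      qed
      also have "\<dots> = - (LINT x:S|lebesgue. Db (t, x) $ k $ j * \<Psi> (t, x))" by (rule W)
      also have "(LINT x:S|lebesgue. Db (t, x) $ k $ j * \<Psi> (t, x)) = (LINT x|lebesgue. F2 (t, x))"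
        unfolding set_lebesgue_integral_def
      proof (rule integral_cong_AE)
        \<comment> \<open>Measurability of a slice of \<open>Db\<close> is known on compact subsets
          of \<open>S\<close>; the projection of \<open>C\<close> is one that contains the support
          of the slice of \<open>\<Psi>\<close>.\<close>
        have K: "compact (snd ` C)" "snd ` C \<subseteq> S" using C by (auto intro!: compact_continuous_image continuous_intros)
        have "(\<lambda>x. indicator (snd ` C) x *\<^sub>R Db (t, x)) \<in> borel_measurable lebesgue"
          using W(1) K unfolding locally_L1_on_def set_integrable_def by auto
        then have "(\<lambda>x. (indicator (snd ` C) x *\<^sub>R Db (t, x)) $ k $ j * \<Psi> (t, x)) \<in> borel_measurable lebesgue"
          by (intro borel_measurable_times borel_measurable_vec_component) (auto intro!: measurable_completion borel_measurable_slice[OF smooth_supported_measurable[OF d]])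
        moreover have "(\<lambda>x. (indicator (snd ` C) x *\<^sub>R Db (t, x)) $ k $ j * \<Psi> (t, x)) =
            (\<lambda>x. indicator S x *\<^sub>R (Db (t, x) $ k $ j * \<Psi> (t, x)))"
        proof
          fix x show "(indicator (snd ` C) x *\<^sub>R Db (t, x)) $ k $ j * \<Psi> (t, x) = indicator S x *\<^sub>R (Db (t, x) $ k $ j * \<Psi> (t, x))"
            using zero K(2) by (cases "(t, x) \<in> C") (force simp: indicator_def)+
        qed
        ultimately show "(\<lambda>x. indicator S x *\<^sub>R (Db (t, x) $ k $ j * \<Psi> (t, x))) \<in> borel_measurable lebesgue" by simp
        show "(\<lambda>x. F2 (t, x)) \<in> borel_measurable lebesgue"
          by (intro measurable_completion) (simp add: borel_measurable_slice[OF F(2)])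
        show "AE x in lebesgue. indicator S x *\<^sub>R (Db (t, x) $ k $ j * \<Psi> (t, x)) = F2 (t, x)"
          unfolding AE_completion_iff using elim(1)
        proof eventually_elim
          case (elim x)
          then show ?case using zero C(2) True by (cases "(t, x) \<in> C") (auto simp: F2_def)
        qed
      qed
      also have "\<dots> = (LINT x|lborel. F2 (t, x))"
        by (rule integral_completion) (simp add: borel_measurable_slice[OF F(2)])
      finally show ?thesis .
    qed
  qed
  have "(LINT z|lborel. ?D z * b z $ k) = (LINT z|lborel. F1 z)"
    using D0 by (intro Bochner_Integration.integral_cong refl) (auto simp: F1_def indicator_def)
  also have "\<dots> = (LINT t|lborel. LINT x|lborel. F1 (t, x))"
    using lborel_pair.integral_fst'[of F1] i1 by (simp add: lborel_prod)
  also have "\<dots> = (LINT t|lborel. - (LINT x|lborel. F2 (t, x)))"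
  proof (rule integral_cong_AE[OF _ _ slice])
    show "(\<lambda>t. LINT x|lborel. F1 (t, x)) \<in> borel_measurable lborel"
      using lborel_pair.integrable_fst'[of F1] i1 unfolding lborel_prod by (intro borel_measurable_integrable) simp
    show "(\<lambda>t. - (LINT x|lborel. F2 (t, x))) \<in> borel_measurable lborel"
      using lborel_pair.integrable_fst'[of F2] i2 unfolding lborel_prod
      by (intro borel_measurable_uminus borel_measurable_integrable) simp
  qed
  also have "\<dots> = - (LINT z|lborel. F2 z)"
    using lborel_pair.integral_fst'[of F2] i2 by (simp add: lborel_prod)
  also have "(LINT z|lborel. F2 z) = (LINT z|lborel. \<Psi> z * G z $ k $ j)"
    using zero by (intro Bochner_Integration.integral_cong refl) (auto simp: F2_def indicator_def)
  finally show "(LINT z|lborel. ?D z * b z $ k) = - (LINT z|lborel. \<Psi> z * G z $ k $ j)" .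
qed

theorem corollary2:
  shows "\<exists>\<tau>0::real. 0 < \<tau>0 \<and> \<tau>0 \<le> 100 \<and>
    (\<forall>(\<gamma>::real) (\<tau>::real) (I::real set) (\<Omega>::(real^'n) set)
        (w::real \<times> (real^'n) \<Rightarrow> real)
        (b::real \<times> (real^'n) \<Rightarrow> real^'m) (Db::real \<times> (real^'n) \<Rightarrow> real^'n^'m) \<phi>.
       0 \<le> \<gamma> \<longrightarrow> \<gamma> \<le> 1 \<longrightarrow> \<tau>0 \<le> \<tau> \<longrightarrow>
       open I \<longrightarrow> is_interval I \<longrightarrow> open \<Omega> \<longrightarrow>
       set_borel_measurable borel (I \<times> \<Omega>) w \<longrightarrow>
       (\<forall>z \<in> I \<times> \<Omega>. 0 < w z) \<longrightarrow>
       (\<forall>K. compact K \<longrightarrow> K \<subseteq> I \<times> \<Omega> \<longrightarrow>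
          (\<exists>c C. 0 < c \<and> c \<le> C \<and> (\<forall>z\<in>K. c \<le> w z \<and> w z \<le> C))) \<longrightarrow>
       \<phi> = exp_gt_tilde \<gamma> \<tau> \<longrightarrow>
       L1_loc_W11_loc_with_deriv I \<Omega> b Db \<longrightarrow>
       continuous_on (I \<times> \<Omega>) b \<longrightarrow>
       weighted_energy I \<Omega> \<phi> w (\<lambda>z. norm (Db z)) < \<infinity> \<longrightarrow>
       (set_integrable lebesgue (I \<times> \<Omega>) (\<lambda>z. w z * norm (Db z)) \<or>
        set_integrable lebesgue (I \<times> \<Omega>) w) \<longrightarrow>
       (\<exists>bh :: nat \<Rightarrow> real \<times> (real^'n) \<Rightarrow> real^'m.
          (\<forall>h. smooth_on (bh h) (I \<times> \<Omega>)) \<and>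
          L1_loc_tendsto_on (I \<times> \<Omega>) bh b \<and>
          L1_loc_tendsto_on (I \<times> \<Omega>) (\<lambda>h. space_deriv (bh h)) Db \<and>
          L1_tendsto_on (I \<times> \<Omega>)
            (\<lambda>h z. w z * \<phi> (norm (space_deriv (bh h) z)))
            (\<lambda>z. w z * \<phi> (norm (Db z))) \<and>
          (\<lambda>h. weighted_energy I \<Omega> \<phi> w (\<lambda>z. norm (space_deriv (bh h) z)))
            \<longlonglongrightarrow> weighted_energy I \<Omega> \<phi> w (\<lambda>z. norm (Db z))))"
\<comment> \<open>The largest threshold the statement admits, matching the requirement
  \<open>100 \<le> \<tau>\<close> of \<open>damped_exponential\<close>.\<close>
proof (rule exI[of _ 100], intro conjI allI impI)
  show "(0::real) < 100" "(100::real) \<le> 100" by simp_all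
next
  fix \<gamma> \<tau> :: real and I :: "real set" and \<Omega> :: "(real^'n) set" and w :: "real \<times> (real^'n) \<Rightarrow> real"
    and b :: "real \<times> (real^'n) \<Rightarrow> real^'m" and Db :: "real \<times> (real^'n) \<Rightarrow> real^'n^'m" and \<phi>
  assume \<gamma>: "0 \<le> \<gamma>" "\<gamma> \<le> 1" and \<tau>: "100 \<le> \<tau>" and I: "open I" and \<Omega>: "open \<Omega>"
    and w: "set_borel_measurable borel (I \<times> \<Omega>) w" "\<forall>z \<in> I \<times> \<Omega>. 0 < w z"
    and wb: "\<forall>K. compact K \<longrightarrow> K \<subseteq> I \<times> \<Omega> \<longrightarrow> (\<exists>c C. 0 < c \<and> c \<le> C \<and> (\<forall>z\<in>K. c \<le> w z \<and> w z \<le> C))"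
    and \<phi>: "\<phi> = exp_gt_tilde \<gamma> \<tau>" and W11: "L1_loc_W11_loc_with_deriv I \<Omega> b Db"
    and b: "continuous_on (I \<times> \<Omega>) b"
    and energy: "weighted_energy I \<Omega> \<phi> w (\<lambda>z. norm (Db z)) < \<infinity>"
  interpret dx: damped_exponential \<gamma> \<tau> by unfold_locales (fact \<gamma> \<tau>)+
  define U where "U = I \<times> \<Omega>"
  have U: "open U" unfolding U_def by (intro open_Times I \<Omega>)
  then have [measurable]: "U \<in> sets borel" by simp
  have UL: "U \<in> sets lebesgue" by simp
  have \<phi>m [measurable]: "\<phi> \<in> borel_measurable borel" unfolding \<phi> by (rule dx.\<phi>_measurable)
  have \<phi>nn: "0 \<le> s \<Longrightarrow> 0 \<le> \<phi> s" for s unfolding \<phi> by (rule dx.\<phi>_nonneg)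
  \<comment> \<open>\<open>w\<close> is Borel on \<open>U\<close> only; its extension by zero is
    Borel everywhere and gives the same integrals over \<open>U\<close>.\<close>
  define w' where "w' z = indicator U z *\<^sub>R w z" for z
  have w'm [measurable]: "w' \<in> borel_measurable borel"
    using w(1) unfolding w'_def[abs_def] set_borel_measurable_def U_def .
  have w': "w' z = w z" if "z \<in> U" for z using that by (simp add: w'_def)
  have w0: "0 \<le> w z" if "z \<in> U" for z using w(2) that by (auto simp: U_def intro: less_imp_le)
  have bm: "(\<lambda>z. indicator U z *\<^sub>R b z) \<in> borel_measurable lebesgue"
    and Dm: "(\<lambda>z. indicator U z *\<^sub>R Db z) \<in> borel_measurable lebesgue"
    and slices: "AE t in lebesgue. t \<in> I \<longrightarrow> W11_loc_with_deriv \<Omega> (\<lambda>x. b (t, x)) (\<lambda>x. Db (t, x))"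
    and loc: "\<And>J K. compact J \<Longrightarrow> J \<subseteq> I \<Longrightarrow> compact K \<Longrightarrow> K \<subseteq> \<Omega> \<Longrightarrow>
        (\<integral>\<^sup>+t\<in>J. (\<integral>\<^sup>+x\<in>K. ennreal (norm (b (t, x)) + norm (Db (t, x))) \<partial>lebesgue) \<partial>lebesgue) < \<infinity>"
    using W11 unfolding L1_loc_W11_loc_with_deriv_def set_borel_measurable_def U_def by blast+
  obtain G where Gm [measurable]: "G \<in> borel_measurable borel" and G: "AE z in lborel. indicator U z *\<^sub>R Db z = G z"
    using lebesgue_measurable_borel_representative[OF Dm] by blast
  have ae: "AE z in lborel. z \<in> U \<longrightarrow> G z = Db z" using G by eventually_elim auto
  \<comment> \<open>Integrability is given on products of compact sets; since \<open>U\<close> is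
    itself a product, the rectangle spanned by the two projections of \<open>K\<close> still lies in
    \<open>U\<close>.\<close>
  have Dloc: "(\<integral>\<^sup>+z. ennreal (norm (Db z)) * indicator K z \<partial>lborel) < \<infinity>" if K: "compact K" "K \<subseteq> U" for K
  proof -
    have c: "compact (fst ` K)" "compact (snd ` K)"
      using K(1) by (auto intro!: compact_continuous_image continuous_intros)
    have sub: "fst ` K \<subseteq> I" "snd ` K \<subseteq> \<Omega>" "fst ` K \<times> snd ` K \<subseteq> U" "K \<subseteq> fst ` K \<times> snd ` K"
      using K(2) by (force simp: U_def)+
    let ?f = "\<lambda>z. ennreal (norm (b z) + norm (Db z))" and ?R = "fst ` K \<times> snd ` K"
    have [measurable]: "?R \<in> sets lebesgue"
      using compact_Times[OF c] by (simp add: borel_compact)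
    have "(\<lambda>z. ennreal (norm (indicator U z *\<^sub>R b z) + norm (indicator U z *\<^sub>R Db z)) * indicator ?R z) \<in> borel_measurable lebesgue"
      using bm Dm by measurable
    moreover have "(\<lambda>z. ennreal (norm (indicator U z *\<^sub>R b z) + norm (indicator U z *\<^sub>R Db z)) * indicator ?R z)
        = (\<lambda>z. ?f z * indicator ?R z)"
      using sub(3) by (intro ext) (force simp: indicator_def)
    ultimately have "(\<lambda>z. ?f z * indicator ?R z) \<in> borel_measurable lebesgue" by simp
    from nn_integral_Times_iterated[OF this] loc[OF c(1) sub(1) c(2) sub(2)]
    have "(\<integral>\<^sup>+z. ?f z * indicator ?R z \<partial>lborel) < \<infinity>" by simp
    moreover have "(\<integral>\<^sup>+z. ennreal (norm (Db z)) * indicator K z \<partial>lborel) \<le> (\<integral>\<^sup>+z. ?f z * indicator ?R z \<partial>lborel)"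
      using sub(4) by (intro nn_integral_mono) (auto simp: indicator_def intro: ennreal_leI)
    ultimately show ?thesis by (rule le_less_trans[rotated])
  qed
  have Gloc: "integrable lborel (\<lambda>z. indicator K z *\<^sub>R G z)" if K: "compact K" "K \<subseteq> U" for K
  proof (rule integrableI_bounded)
    have [measurable]: "K \<in> sets borel" using K(1) borel_compact by blast
    show "(\<lambda>z. indicator K z *\<^sub>R G z) \<in> borel_measurable lborel" by measurable
    have "(\<integral>\<^sup>+z. ennreal (norm (indicator K z *\<^sub>R G z)) \<partial>lborel) = (\<integral>\<^sup>+z. ennreal (norm (Db z)) * indicator K z \<partial>lborel)"
    proof (rule nn_integral_cong_AE)
      show "AE z in lborel. ennreal (norm (indicator K z *\<^sub>R G z)) = ennreal (norm (Db z)) * indicator K z"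
        using ae by eventually_elim (use K(2) in \<open>auto simp: indicator_def\<close>)
    qed
    then show "(\<integral>\<^sup>+z. ennreal (norm (indicator K z *\<^sub>R G z)) \<partial>lborel) < \<infinity>" using Dloc[OF K] by simp
  qed
  have weak: "weak_space_deriv U b G"
    unfolding U_def using b \<Omega> slices Gm Gloc ae by (intro weak_space_deriv_of_slices) (auto simp: U_def)
  \<comment> \<open>Merging the iterated integral needs joint measurability, which is read off from
    the truncations to \<open>U\<close> of \<open>w\<close> and \<open>F\<close>.\<close>
  have energy_eq: "weighted_energy I \<Omega> \<phi> w (\<lambda>z. norm (F z)) =
      (\<integral>\<^sup>+z. ennreal (w z * \<phi> (norm (F z))) * indicator U z \<partial>lborel)"
    if F: "(\<lambda>z. indicator U z *\<^sub>R F z) \<in> borel_measurable lebesgue" for F :: "real \<times> (real^'n) \<Rightarrow> real^'n^'m"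
  proof -
    have [measurable]: "w' \<in> borel_measurable lebesgue" "\<phi> \<in> borel_measurable borel"
      by (auto intro: measurable_completion)
    have "(\<lambda>z. ennreal (w' z * \<phi> (norm (indicator U z *\<^sub>R F z))) * indicator U z) \<in> borel_measurable lebesgue"
      using F UL by measurable
    moreover have "(\<lambda>z. ennreal (w' z * \<phi> (norm (indicator U z *\<^sub>R F z))) * indicator U z) =
        (\<lambda>z. ennreal (w z * \<phi> (norm (F z))) * indicator U z)"
      by (intro ext) (simp add: indicator_def w'_def)
    ultimately show ?thesis
      unfolding weighted_energy_def using nn_integral_Times_iterated[of "\<lambda>z. ennreal (w z * \<phi> (norm (F z)))" I \<Omega>]
      by (simp add: U_def)
  qed
  have Db_energy: "weighted_energy I \<Omega> \<phi> w (\<lambda>z. norm (Db z)) =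
      (\<integral>\<^sup>+z. ennreal (w' z * \<phi> (norm (G z))) * indicator U z \<partial>lborel)"
    unfolding energy_eq[OF Dm]
  proof (rule nn_integral_cong_AE)
    show "AE z in lborel. ennreal (w z * \<phi> (norm (Db z))) * indicator U z = ennreal (w' z * \<phi> (norm (G z))) * indicator U z"
      using ae by eventually_elim (auto simp: indicator_def w')
  qed
  have wb': "\<exists>c C. 0 < c \<and> c \<le> C \<and> (\<forall>z\<in>K. c \<le> w' z \<and> w' z \<le> C)" if K: "compact K" "K \<subseteq> U" for K
  proof -
    obtain c C where "0 < c" "c \<le> C" "\<forall>z\<in>K. c \<le> w z \<and> w z \<le> C" using wb K unfolding U_def by blast
    moreover have "w' z = w z" if "z \<in> K" for z using w' K(2) that by blast
    ultimately show ?thesis by metis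
  qed
  have line: "\<exists>a. \<forall>t\<ge>0. \<phi> s + a * (t - s) \<le> \<phi> t" if "0 \<le> s" for s
    unfolding \<phi> using dx.supporting_line[OF that] by (intro exI[of _ "dx.h s - dx.p 0"]) blast
  have C0: "0 \<le> 7 + 2 / \<phi> 1" using \<phi>nn[of 1] by simp
  have shift: "\<phi> (s + d) \<le> (7 + 2 / \<phi> 1) * (\<phi> s + d)" if "0 \<le> s" "0 \<le> d" "d \<le> 1" for s d
    unfolding \<phi> by (rule dx.shift_bound[OF that])
  have energy': "(\<integral>\<^sup>+z. ennreal (w' z * \<phi> (norm (G z))) * indicator U z \<partial>lborel) < \<infinity>"
    using energy unfolding Db_energy .
  have mono: "\<phi> s \<le> \<phi> t" if "0 \<le> s" "s \<le> t" for s t unfolding \<phi> by (rule dx.\<phi>_mono[OF that])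
  have cont: "isCont \<phi> s" if "0 \<le> s" for s unfolding \<phi> by (rule dx.isCont_\<phi>[OF that])
  have bU: "continuous_on U b" using b by (simp add: U_def)
  obtain bh where smooth: "\<And>h. smooth_on (bh h) U"
    and close: "\<And>h z. z \<in> U \<Longrightarrow> norm (bh h z - b z) \<le> 1 / real (Suc h)"
    and dG: "(\<lambda>h. \<integral>\<^sup>+z. ennreal (norm (space_deriv (bh h) z - G z)) * indicator U z \<partial>lborel) \<longlonglongrightarrow> 0"
    and d\<phi>: "(\<lambda>h. \<integral>\<^sup>+z. ennreal \<bar>w' z * \<phi> (norm (space_deriv (bh h) z)) - w' z * \<phi> (norm (G z))\<bar> * indicator U z \<partial>lborel) \<longlonglongrightarrow> 0"
    and fin: "\<And>h. (\<integral>\<^sup>+z. ennreal (w' z * \<phi> (norm (space_deriv (bh h) z))) * indicator U z \<partial>lborel) < \<infinity>"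
    and energies: "(\<lambda>h. \<integral>\<^sup>+z. ennreal (w' z * \<phi> (norm (space_deriv (bh h) z))) * indicator U z \<partial>lborel)
      \<longlonglongrightarrow> (\<integral>\<^sup>+z. ennreal (w' z * \<phi> (norm (G z))) * indicator U z \<partial>lborel)"
  proof (rule smoothing_sequence[of U b G w' \<phi> "7 + 2 / \<phi> 1"], goal_cases)
    case (16 bh)
    show ?case by (rule 16(1)[OF 16(2-)])
  qed (rule U bU Gm Gloc weak w'm wb' \<phi>m \<phi>nn mono line C0 shift cont energy'; assumption)+
  have gm: "(\<lambda>z. indicator U z *\<^sub>R space_deriv (bh h) z) \<in> borel_measurable borel" for h
    by (rule borel_measurable_continuous_on_indicator[OF _ continuous_on_space_deriv[OF smooth]]) simp
  have gml: "(\<lambda>z. indicator U z *\<^sub>R space_deriv (bh h) z) \<in> borel_measurable lebesgue" for h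
    using gm by (intro measurable_completion) simp
  have w\<phi>m: "set_borel_measurable lebesgue U (\<lambda>z. w z * \<phi> (norm (F z)))"
    if F: "(\<lambda>z. indicator U z *\<^sub>R F z) \<in> borel_measurable lebesgue" for F :: "real \<times> (real^'n) \<Rightarrow> real^'n^'m"
  proof -
    have [measurable]: "w' \<in> borel_measurable lebesgue" by (auto intro: measurable_completion)
    have "(\<lambda>z. indicator U z *\<^sub>R (w' z * \<phi> (norm (indicator U z *\<^sub>R F z)))) \<in> borel_measurable lebesgue"
      using F UL by measurable
    moreover have "(\<lambda>z. indicator U z *\<^sub>R (w' z * \<phi> (norm (indicator U z *\<^sub>R F z)))) =
        (\<lambda>z. indicator U z *\<^sub>R (w z * \<phi> (norm (F z))))"
      by (intro ext) (simp add: indicator_def w'_def)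
    ultimately show ?thesis by (simp add: set_borel_measurable_def)
  qed
  have w\<phi>i: "set_integrable lebesgue U (\<lambda>z. w z * \<phi> (norm (F z)))"
    if F: "(\<lambda>z. indicator U z *\<^sub>R F z) \<in> borel_measurable lebesgue"
      "(\<integral>\<^sup>+z. ennreal (w z * \<phi> (norm (F z))) * indicator U z \<partial>lborel) < \<infinity>" for F :: "real \<times> (real^'n) \<Rightarrow> real^'n^'m"
  proof (rule set_integrable_lebesgueI[OF w\<phi>m[OF F(1)]])
    have "(\<integral>\<^sup>+z. ennreal (norm (w z * \<phi> (norm (F z)))) * indicator U z \<partial>lborel) =
        (\<integral>\<^sup>+z. ennreal (w z * \<phi> (norm (F z))) * indicator U z \<partial>lborel)"
      using w0 \<phi>nn by (intro nn_integral_cong) (auto simp: indicator_def abs_mult)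
    then show "(\<integral>\<^sup>+z. ennreal (norm (w z * \<phi> (norm (F z)))) * indicator U z \<partial>lborel) < \<infinity>"
      using F(2) by simp
  qed
  have w_eq: "(\<integral>\<^sup>+z. ennreal (w' z * \<phi> (norm (F z))) * indicator U z \<partial>lborel) =
      (\<integral>\<^sup>+z. ennreal (w z * \<phi> (norm (F z))) * indicator U z \<partial>lborel)" for F :: "real \<times> (real^'n) \<Rightarrow> real^'n^'m"
    by (intro nn_integral_cong) (simp add: indicator_def w'_def)
  show "\<exists>bh :: nat \<Rightarrow> real \<times> (real^'n) \<Rightarrow> real^'m.
          (\<forall>h. smooth_on (bh h) (I \<times> \<Omega>)) \<and>
          L1_loc_tendsto_on (I \<times> \<Omega>) bh b \<and>
          L1_loc_tendsto_on (I \<times> \<Omega>) (\<lambda>h. space_deriv (bh h)) Db \<and>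
          L1_tendsto_on (I \<times> \<Omega>)
            (\<lambda>h z. w z * \<phi> (norm (space_deriv (bh h) z)))
            (\<lambda>z. w z * \<phi> (norm (Db z))) \<and>
          (\<lambda>h. weighted_energy I \<Omega> \<phi> w (\<lambda>z. norm (space_deriv (bh h) z)))
            \<longlonglongrightarrow> weighted_energy I \<Omega> \<phi> w (\<lambda>z. norm (Db z))"
    unfolding U_def[symmetric]
  proof (intro exI[of _ bh] conjI allI smooth)
    show "L1_loc_tendsto_on U bh b"
      unfolding L1_loc_tendsto_on_def
    proof (intro allI impI L1_tendsto_onI)
      fix K assume K: "compact K" "K \<subseteq> U"
      have [measurable]: "K \<in> sets borel" using K(1) borel_compact by blast
      show "set_integrable lebesgue K (bh h)" for h
        by (rule set_integrable_continuous_compact[OF K(1)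
              continuous_on_subset[OF smooth_on_imp_continuous_on[OF smooth] K(2)]])
      show "set_integrable lebesgue K b"
        by (rule set_integrable_continuous_compact[OF K(1) continuous_on_subset[OF _ K(2)]])
          (use b in \<open>simp add: U_def\<close>)
      \<comment> \<open>Uniform closeness becomes L^1 closeness because \<open>K\<close> has finite
        measure \<open>m\<close>.\<close>
      obtain m where m: "emeasure lborel K = ennreal m" "0 \<le> m"
        using emeasure_compact_finite[OF K(1)] by (cases "emeasure lborel K") auto
      have "(\<lambda>h. 1 / real (Suc h) * m) \<longlonglongrightarrow> 0 * m"
        by (intro tendsto_mult tendsto_const LIMSEQ_Suc[OF lim_1_over_n])
      then have lim: "(\<lambda>h. ennreal (1 / real (Suc h) * m)) \<longlonglongrightarrow> 0" using tendsto_ennrealI by fastforce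
      show "(\<lambda>h. \<integral>\<^sup>+z. ennreal (norm (bh h z - b z)) * indicator K z \<partial>lborel) \<longlonglongrightarrow> 0"
      proof (rule tendsto_sandwich[OF _ _ tendsto_const lim])
        show "\<forall>\<^sub>F h in sequentially. (\<integral>\<^sup>+z. ennreal (norm (bh h z - b z)) * indicator K z \<partial>lborel) \<le> ennreal (1 / real (Suc h) * m)"
        proof (rule always_eventually, rule allI)
          fix h
          have "(\<integral>\<^sup>+z. ennreal (norm (bh h z - b z)) * indicator K z \<partial>lborel) \<le> (\<integral>\<^sup>+z. ennreal (1 / real (Suc h)) * indicator K z \<partial>lborel)"
          proof (intro nn_integral_mono)
            fix z show "ennreal (norm (bh h z - b z)) * indicator K z \<le> ennreal (1 / real (Suc h)) * indicator K z"
              using close[of z h] K(2) by (cases "z \<in> K") (auto intro: ennreal_leI)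
          qed
          also have "\<dots> = ennreal (1 / real (Suc h)) * ennreal m"
            by (subst nn_integral_cmult_indicator) (simp_all add: m(1))
          also have "\<dots> = ennreal (1 / real (Suc h) * m)" by (rule ennreal_mult[symmetric]) (use m in auto)
          finally show "(\<integral>\<^sup>+z. ennreal (norm (bh h z - b z)) * indicator K z \<partial>lborel) \<le> ennreal (1 / real (Suc h) * m)" .
        qed
      qed auto
    qed
    show "L1_loc_tendsto_on U (\<lambda>h. space_deriv (bh h)) Db"
      unfolding L1_loc_tendsto_on_def
    proof (intro allI impI L1_tendsto_onI)
      fix K assume K: "compact K" "K \<subseteq> U"
      have KL: "K \<in> sets lebesgue" using borel_compact[OF K(1)] by simp
      show "set_integrable lebesgue K (space_deriv (bh h))" for h
        by (rule set_integrable_continuous_compact[OF K(1) continuous_on_subset[OF continuous_on_space_deriv[OF smooth] K(2)]])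
      have "(\<lambda>z. indicator K z *\<^sub>R indicator U z *\<^sub>R Db z) \<in> borel_measurable lebesgue"
        using Dm KL by measurable
      moreover have "(\<lambda>z. indicator K z *\<^sub>R indicator U z *\<^sub>R Db z) = (\<lambda>z. indicator K z *\<^sub>R Db z)"
        using K(2) by (intro ext) (auto simp: indicator_def)
      ultimately have "set_borel_measurable lebesgue K Db" by (simp add: set_borel_measurable_def)
      then show "set_integrable lebesgue K Db" by (rule set_integrable_lebesgueI[OF _ Dloc[OF K]])
      show "(\<lambda>h. \<integral>\<^sup>+z. ennreal (norm (space_deriv (bh h) z - Db z)) * indicator K z \<partial>lborel) \<longlonglongrightarrow> 0"
      \<comment> \<open>The convergence to \<open>G\<close> holds on all of \<open>U\<close>, and
        \<open>G = Db\<close> almost everywhere there, so restricting to \<open>K\<close> only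
        lowers the integral.\<close>
      proof (rule tendsto_sandwich[OF _ _ tendsto_const dG])
        show "\<forall>\<^sub>F h in sequentially. (\<integral>\<^sup>+z. ennreal (norm (space_deriv (bh h) z - Db z)) * indicator K z \<partial>lborel)
            \<le> (\<integral>\<^sup>+z. ennreal (norm (space_deriv (bh h) z - G z)) * indicator U z \<partial>lborel)"
        proof (rule always_eventually, rule allI, rule nn_integral_mono_AE)
          fix h
          show "AE z in lborel. ennreal (norm (space_deriv (bh h) z - Db z)) * indicator K z
              \<le> ennreal (norm (space_deriv (bh h) z - G z)) * indicator U z"
            using ae by eventually_elim (use K(2) in \<open>auto simp: indicator_def\<close>)
        qed
      qed auto
    qed
    show "L1_tendsto_on U (\<lambda>h z. w z * \<phi> (norm (space_deriv (bh h) z))) (\<lambda>z. w z * \<phi> (norm (Db z)))"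
    proof (rule L1_tendsto_onI)
      show "set_integrable lebesgue U (\<lambda>z. w z * \<phi> (norm (space_deriv (bh h) z)))" for h
        using fin[of h] by (intro w\<phi>i gml) (simp only: w_eq)
      show "set_integrable lebesgue U (\<lambda>z. w z * \<phi> (norm (Db z)))"
        using energy by (intro w\<phi>i Dm) (simp only: energy_eq[OF Dm])
      have "(\<integral>\<^sup>+z. ennreal (norm (w z * \<phi> (norm (space_deriv (bh h) z)) - w z * \<phi> (norm (Db z)))) * indicator U z \<partial>lborel) =
        (\<integral>\<^sup>+z. ennreal \<bar>w' z * \<phi> (norm (space_deriv (bh h) z)) - w' z * \<phi> (norm (G z))\<bar> * indicator U z \<partial>lborel)" for h
      proof (rule nn_integral_cong_AE)
        show "AE z in lborel. ennreal (norm (w z * \<phi> (norm (space_deriv (bh h) z)) - w z * \<phi> (norm (Db z)))) * indicator U z =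
            ennreal \<bar>w' z * \<phi> (norm (space_deriv (bh h) z)) - w' z * \<phi> (norm (G z))\<bar> * indicator U z"
          using ae by eventually_elim (auto simp: indicator_def w')
      qed
      then show "(\<lambda>h. \<integral>\<^sup>+z. ennreal (norm (w z * \<phi> (norm (space_deriv (bh h) z)) - w z * \<phi> (norm (Db z)))) * indicator U z \<partial>lborel) \<longlonglongrightarrow> 0"
        using d\<phi> by simp
    qed
    show "(\<lambda>h. weighted_energy I \<Omega> \<phi> w (\<lambda>z. norm (space_deriv (bh h) z)))
        \<longlonglongrightarrow> weighted_energy I \<Omega> \<phi> w (\<lambda>z. norm (Db z))"
      unfolding Db_energy energy_eq[OF gml] using energies by (simp only: w_eq)
  qed
qed

end
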